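(* For every integer $n\geq 121$, the cubic polynomial in $x$ $$q(n-1)+3q(n)x+3q(n+1)x^2+q(n+2)x^3$$ has only real zeros.
   Context: For an integer $n\ge 0$, $q(n)$ is the number of partitions of $n$ into distinct parts, with generating function $\sum_{n\ge 0}q(n)x^n=\prod_{j=1}^{\infty}(1+x^j)$. *)

theory Defs
  imports Complex_Main "HOL-Computational_Algebra.Computational_Algebra"
begin

(* A partition into distinct parts has no repeated part, so it is the same thing as the finite
   set of its parts, which are positive integers.  The empty set gives q 0 = 1. *)
definition distinct_partitions :: "nat \<Rightarrow> nat set set" where
  "distinct_partitions n = {P. finite P \<and> (\<forall>k\<in>P. 0 < k) \<and> \<Sum>P = n}"

definition q :: "nat \<Rightarrow> nat" where
  "q n = card (distinct_partitions n)"

lemma distinct_partitions_eq: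
  assumes "n \<le> N"
  shows "distinct_partitions n = {P \<in> Pow {1..N}. \<Sum>P = n}"
proof (intro equalityI subsetI)
  fix P assume P: "P \<in> distinct_partitions n"
  have "k \<in> {1..N}" if "k \<in> P" for k
  proof -
    have "k \<le> \<Sum>P"
      using P that member_le_sum[of k P "\<lambda>i. i"] by (simp add: distinct_partitions_def)
    then show ?thesis
      using P that assms by (auto simp: distinct_partitions_def Suc_le_eq)
  qed
  then show "P \<in> {P \<in> Pow {1..N}. \<Sum>P = n}"
    using P by (auto simp: distinct_partitions_def)
next
  fix P assume "P \<in> {P \<in> Pow {1..N}. \<Sum>P = n}"
  moreover from this have "finite P"
    using finite_subset[of P "{1..N}"] by simp
  ultimately show "P \<in> distinct_partitions n"
    by (auto simp: distinct_partitions_def)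
qed

lemma finite_distinct_partitions: "finite (distinct_partitions n)"
  by (simp add: distinct_partitions_eq[OF order_refl])

lemma fps_nth_prod_distinct_partitions:
  assumes "n \<le> N"
  shows "fps_nth (\<Prod>j=1..N. 1 + fps_X ^ j) n = (of_nat (q n) :: 'a::comm_ring_1)"
proof -
  have "(\<Prod>j=1..N. 1 + fps_X ^ j) = (\<Prod>j=1..N. fps_X ^ j + (1 :: 'a fps))"
    by (intro prod.cong refl add.commute)
  also have "\<dots> = (\<Sum>P\<in>Pow {1..N}. fps_X ^ \<Sum>P)"
    by (simp add: prod_add power_sum)
  finally have "fps_nth (\<Prod>j=1..N. 1 + fps_X ^ j) n
      = (\<Sum>P\<in>Pow {1..N}. fps_nth (fps_X ^ \<Sum>P) n :: 'a)"
    by (simp only: fps_sum_nth)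
  also have "\<dots> = (\<Sum>P\<in>Pow {1..N}. if \<Sum>P = n then 1 else 0)"
    by (intro sum.cong refl) auto
  also have "\<dots> = (\<Sum>P\<in>{P \<in> Pow {1..N}. \<Sum>P = n}. 1)"
    by (rule sum.inter_filter[symmetric]) simp
  also have "\<dots> = of_nat (card {P \<in> Pow {1..N}. \<Sum>P = n})"
    by simp
  finally show ?thesis
    by (simp only: q_def distinct_partitions_eq[OF assms])
qed

lemma distinct_partitions_generating_function:
  "(\<lambda>N. \<Prod>j=1..N. 1 + fps_X ^ j) \<longlonglongrightarrow> Abs_fps (\<lambda>n. of_nat (q n) :: 'a::comm_ring_1)"
proof (rule tendsto_fpsI)
  fix n
  show "\<forall>\<^sub>F N in sequentially. fps_nth (\<Prod>j=1..N. 1 + fps_X ^ j) n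
      = fps_nth (Abs_fps (\<lambda>n. of_nat (q n) :: 'a)) n"
    using eventually_ge_at_top[of n]
    by eventually_elim (simp only: fps_nth_prod_distinct_partitions fps_nth_Abs_fps)
qed

end

(*
The cubic has only real zeros as soon as it takes a positive and then a negative value at two points
x < y < 0.  At x = - exp (- s) its sign is that of the third difference at n - 1, ..., n + 2 of the
tilted sequence q m * exp (- s * m), which is the Fourier coefficient of a product of characteristic
functions of independent Bernoulli variables against 8 * sin (t / 2) ^ 3.

For n >= 5000 the tilt s is chosen so that the mean of the tilted distribution is
n + 1/2 + 4/5 * beta or n + 1/2 - 4/5 * beta, where 2 * beta ^ 2 is its variance.  A third-order
comparison with a Gaussian (keeping the skewness in the phase) shows that the third difference has the
sign of the third derivative of a Gaussian density at these offsets, positive and negative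
respectively; on the minor arcs the product is bounded by an Abel summation.

For 121 <= n < 5000 the two signs are found by exact rational evaluation, for which q is computed
from the expansion of the generating function by the number of parts.
*)
theory Submission
  imports Defs "HOL-Probability.Characteristic_Functions"
begin

section \<open>Real zeros from sign changes\<close>

text \<open>Writing the cubic at x = - exp (- s) probabilistically turns the question into the shape
  of one bell curve on both sides of n + 1/2, the midpoint of the four indices. The obstacle is
  effectiveness. With s of order 1 / sqrt n, the skewness correction has relative size sqrt s and
  the next one s, so the skewness is too large to be given away as an error; in the phase it nearly
  cancels at the offset 4/5. Even so the explicit constants leave room only from about s = 1 / 72
  on, and n >= 5000 is what forces the tilt below that value. In units of beta ^ (- 4) the range
  near 0 then contributes at least 0.115, and everything else at most 0.081. So high a threshold
  leaves almost five thousand cases, whose exact evaluation has to be cheap: a Horner form of the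
  generating function needs additions only, numbers are lists of octal digits added by a table, and
  the inequalities are tested on leading digits with an explicit margin.\<close>

lemma real_root_between:
  fixes f :: "real \<Rightarrow> real"
  assumes "x < y" "f x * f y < 0" "continuous_on UNIV f"
  shows "\<exists>r. x < r \<and> r < y \<and> f r = 0"
proof -
  have c: "continuous_on {x..y} f" using assms(3) continuous_on_subset by blast
  have "\<exists>r. x \<le> r \<and> r \<le> y \<and> f r = 0"
  proof (cases "f x < 0")
    case True
    then have "f y > 0" using assms(2) by (simp add: mult_less_0_iff)
    then show ?thesis using IVT'[of f x 0 y] True assms(1) c by force
  next
    case False
    then have "f y < 0" "f x > 0" using assms(2) by (auto simp: mult_less_0_iff)
    then show ?thesis using IVT2'[of f y 0 x] assms(1) c by force
  qed
  moreover have "f x \<noteq> 0" "f y \<noteq> 0" using assms(2) by auto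
  ultimately show ?thesis by (metis less_le)
qed

definition cubic_changes_sign :: "real \<Rightarrow> real \<Rightarrow> real \<Rightarrow> real \<Rightarrow> bool" where
  "cubic_changes_sign a b c d \<longleftrightarrow> (\<exists>x y. x < y \<and> y < 0
    \<and> a + 3 * b * x + 3 * c * x^2 + d * x^3 > 0 \<and> a + 3 * b * y + 3 * c * y^2 + d * y^3 < 0)"

text \<open>Far to the left, at x, at y and at 0 the signs are -, +, -, + (the last one by a > 0).
  This gives three distinct real zeros, which is all that degree 3 allows.\<close>

lemma cubic_three_real_roots:
  fixes a b c d :: real and z :: complex
  assumes d: "d > 0" and a: "a > 0" and sc: "cubic_changes_sign a b c d"
    and z: "poly [:of_real a, 3 * of_real b, 3 * of_real c, of_real d:] z = 0"
  shows "z \<in> \<real>"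
proof -
  obtain x y where xy: "x < y" "y < 0" and fx: "a + 3 * b * x + 3 * c * x^2 + d * x^3 > 0"
    and fy: "a + 3 * b * y + 3 * c * y^2 + d * y^3 < 0"
    using sc unfolding cubic_changes_sign_def by blast
  note assms = d a xy
  define p where "p = [:a, 3 * b, 3 * c, d:]"
  have p: "poly p t = a + 3 * b * t + 3 * c * t^2 + d * t^3" for t
    by (simp add: p_def power2_eq_square power3_eq_cube algebra_simps)
  have cont: "continuous_on UNIV (poly p)" by (intro continuous_intros)
  \<comment> \<open>A Cauchy-type bound: \<open>w \<le> - 1\<close> lets all lower powers be
    compared with \<open>w^2\<close>, and \<open>- w * d\<close> exceeds the sum of the absolute
    values of the other coefficients.\<close>
  define w where "w = x - 1 - (\<bar>a\<bar> + 3 * \<bar>b\<bar> + 3 * \<bar>c\<bar>) / d"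
  have nn: "0 \<le> (\<bar>a\<bar> + 3 * \<bar>b\<bar> + 3 * \<bar>c\<bar>) / d" using assms(1) by simp
  then have w1: "w < x" "w \<le> - 1" using assms(3,4) by (auto simp: w_def)
  have "- w * d = d * (1 - x) + (\<bar>a\<bar> + 3 * \<bar>b\<bar> + 3 * \<bar>c\<bar>)"
    using assms(1) by (simp add: w_def field_simps)
  moreover have "d * (1 - x) > 0" using assms(1,3,4) by simp
  ultimately have wd: "\<bar>a\<bar> + 3 * \<bar>b\<bar> + 3 * \<bar>c\<bar> < - w * d" by linarith
  have "poly p w < 0"
  proof -
    have w2: "\<bar>w\<bar> \<le> w^2" using w1(2) mult_left_mono[of 1 "\<bar>w\<bar>" "\<bar>w\<bar>"] by (simp add: power2_eq_square abs_if)
    then have w3: "1 \<le> w^2" using w1(2) by linarith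
    have "a \<le> \<bar>a\<bar> * w^2" using mult_left_mono[OF w3, of "\<bar>a\<bar>"] by linarith
    moreover have "3 * b * w \<le> 3 * \<bar>b\<bar> * w^2"
    proof -
      have "b * w \<le> \<bar>b\<bar> * \<bar>w\<bar>" by (metis abs_ge_self abs_mult)
      also have "\<dots> \<le> \<bar>b\<bar> * w^2" using w2 by (intro mult_left_mono) auto
      finally show ?thesis by simp
    qed
    moreover have "3 * c * w^2 \<le> 3 * \<bar>c\<bar> * w^2" by (intro mult_right_mono) auto
    ultimately have "a + 3 * b * w + 3 * c * w^2 + d * w^3
        \<le> \<bar>a\<bar> * w^2 + 3 * \<bar>b\<bar> * w^2 + 3 * \<bar>c\<bar> * w^2 + d * w^3" by linarith
    then have "poly p w \<le> (\<bar>a\<bar> + 3 * \<bar>b\<bar> + 3 * \<bar>c\<bar>) * w^2 + d * w^3" unfolding p by (simp add: algebra_simps)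
    also have "\<dots> = (\<bar>a\<bar> + 3 * \<bar>b\<bar> + 3 * \<bar>c\<bar> + w * d) * w^2"
      by (simp add: algebra_simps power2_eq_square power3_eq_cube)
    also have "\<dots> < 0" using wd w3 by (intro mult_neg_pos) auto
    finally show ?thesis .
  qed
  note w = w1(1) this
  obtain r1 where r1: "w < r1" "r1 < x" "poly p r1 = 0"
    using real_root_between[of w x "poly p"] w fx p cont by (auto simp: mult_less_0_iff)
  obtain r2 where r2: "x < r2" "r2 < y" "poly p r2 = 0"
    using real_root_between[of x y "poly p"] fx fy p cont assms(3) by (auto simp: mult_less_0_iff)
  obtain r3 where r3: "y < r3" "r3 < 0" "poly p r3 = 0"
    using real_root_between[of y 0 "poly p"] fy p[of 0] p[of y] cont assms(2,4) by (auto simp: mult_less_0_iff)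
  define P where "P = map_poly complex_of_real p"
  have P: "P = [:of_real a, 3 * of_real b, 3 * of_real c, of_real d:]"
    using assms(1) by (simp add: P_def p_def map_poly_pCons)
  have Pr: "poly P (of_real r) = of_real (poly p r)" for r
    unfolding P p_def by simp
  have P0: "P \<noteq> 0" "degree P = 3" using assms(1) unfolding P by auto
  let ?R = "{z. poly P z = 0}"
  have "card ?R \<le> 3" using card_poly_roots_bound[OF P0(1)] P0(2) by simp
  have fin: "finite ?R" using P0(1) poly_roots_finite by blast
  have sub: "{of_real r1, of_real r2, of_real r3} \<subseteq> ?R" using Pr r1 r2 r3 by auto
  have "card {complex_of_real r1, of_real r2, of_real r3} = 3" using r1 r2 r3 by auto
  then have "{of_real r1, of_real r2, of_real r3} = ?R"
    using card_subset_eq[OF fin sub] card_mono[OF fin sub] \<open>card ?R \<le> 3\<close> by simp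
  then have "z \<in> {of_real r1, of_real r2, of_real r3}" using z P by simp
  then show ?thesis by auto
qed

section \<open>Exact computation for small n\<close>

datatype oct = Nil8 | D0 oct | D1 oct | D2 oct | D3 oct | D4 oct | D5 oct | D6 oct | D7 oct

text \<open>The least significant digit is outermost: addition proceeds constructor by constructor,
  and division by 8 removes one constructor.\<close>

primrec oval :: "oct \<Rightarrow> nat" where
  "oval Nil8 = 0"
| "oval (D0 x) = 0 + 8 * oval x"
| "oval (D1 x) = 1 + 8 * oval x"
| "oval (D2 x) = 2 + 8 * oval x"
| "oval (D3 x) = 3 + 8 * oval x"
| "oval (D4 x) = 4 + 8 * oval x"
| "oval (D5 x) = 5 + 8 * oval x"
| "oval (D6 x) = 6 + 8 * oval x"
| "oval (D7 x) = 7 + 8 * oval x"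

primrec low_digit :: "oct \<Rightarrow> nat" where
  "low_digit Nil8 = 0" | "low_digit (D0 x) = 0" | "low_digit (D1 x) = 1" | "low_digit (D2 x) = 2" | "low_digit (D3 x) = 3" | "low_digit (D4 x) = 4" | "low_digit (D5 x) = 5" | "low_digit (D6 x) = 6" | "low_digit (D7 x) = 7"

primrec high_digits :: "oct \<Rightarrow> oct" where
  "high_digits Nil8 = Nil8" | "high_digits (D0 x) = x" | "high_digits (D1 x) = x" | "high_digits (D2 x) = x" | "high_digits (D3 x) = x" | "high_digits (D4 x) = x" | "high_digits (D5 x) = x" | "high_digits (D6 x) = x" | "high_digits (D7 x) = x"

definition cons_digit :: "nat \<Rightarrow> oct \<Rightarrow> oct" where
  "cons_digit d = (if d = 0 then D0 else if d = 1 then D1 else if d = 2 then D2 else if d = 3 then D3 else if d = 4 then D4 else if d = 5 then D5 else if d = 6 then D6 else D7)"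

primrec inc :: "oct \<Rightarrow> oct" where
  "inc Nil8 = D1 Nil8"
| "inc (D0 x) = D1 x"
| "inc (D1 x) = D2 x"
| "inc (D2 x) = D3 x"
| "inc (D3 x) = D4 x"
| "inc (D4 x) = D5 x"
| "inc (D5 x) = D6 x"
| "inc (D6 x) = D7 x"
| "inc (D7 x) = D0 (inc x)"

lemma oval_cons_digit:
  assumes "d < 8"
  shows "oval (cons_digit d x) = d + 8 * oval x"
proof -
  have "d = 0 \<or> d = 1 \<or> d = 2 \<or> d = 3 \<or> d = 4 \<or> d = 5 \<or> d = 6 \<or> d = 7"
    using assms by linarith
  then show ?thesis
    by (elim disjE) (simp_all add: cons_digit_def)
qed

lemma oval_digits: "oval x = low_digit x + 8 * oval (high_digits x)"
  by (cases x) simp_all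

lemma low_digit_less: "low_digit x < 8"
  by (cases x) simp_all

lemma oval_inc: "oval (inc x) = Suc (oval x)"
  by (induction x) simp_all

lemma size_high_digits: "x \<noteq> Nil8 \<Longrightarrow> size (high_digits x) < size x"
  by (cases x) simp_all

function addc :: "nat \<Rightarrow> oct \<Rightarrow> oct \<Rightarrow> oct" where
  "addc c x y = (if x = Nil8 then if c = 0 then y else inc y
     else if y = Nil8 then if c = 0 then x else inc x
     else cons_digit ((low_digit x + low_digit y + c) mod 8) (addc ((low_digit x + low_digit y + c) div 8) (high_digits x) (high_digits y)))"
  by auto
termination by (relation "Wellfounded.measure (\<lambda>(c, x, y). size x)") (auto simp: size_high_digits)

declare addc.simps [simp del]

lemma oval_addc: "c < 2 \<Longrightarrow> oval (addc c x y) = oval x + oval y + c"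
proof (induction c x y rule: addc.induct)
  case (1 c x y)
  show ?case
  proof (cases "x = Nil8 \<or> y = Nil8")
    case True
    then show ?thesis using 1(2) by (subst addc.simps) (auto simp: oval_inc)
  next
    case False
    have "(low_digit x + low_digit y + c) div 8 < 2"
      using low_digit_less[of x] low_digit_less[of y] 1(2) by simp
    then have "oval (addc ((low_digit x + low_digit y + c) div 8) (high_digits x) (high_digits y))
        = oval (high_digits x) + oval (high_digits y) + (low_digit x + low_digit y + c) div 8"
      using 1(1) False by blast
    then have "oval (addc c x y) = (low_digit x + low_digit y + c) mod 8
        + 8 * (oval (high_digits x) + oval (high_digits y) + (low_digit x + low_digit y + c) div 8)"
      using False by (subst addc.simps) (simp add: oval_cons_digit)
    then show ?thesis
      using mult_div_mod_eq[of 8 "low_digit x + low_digit y + c"] oval_digits[of x] oval_digits[of y]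
      unfolding distrib_left by linarith
  qed
qed

text \<open>Fixing the carry in the function itself turns each digit position into a single table
  lookup, with no arithmetic on carries; the generic \<open>addc\<close> serves to prove the
  table.\<close>

definition ad :: "oct \<Rightarrow> oct \<Rightarrow> oct" where "ad = addc 0"
definition adc :: "oct \<Rightarrow> oct \<Rightarrow> oct" where "adc = addc 1"

lemma oval_ad: "oval (ad x y) = oval x + oval y"
  by (simp add: ad_def oval_addc)

lemma addc_digits:
  "x \<noteq> Nil8 \<Longrightarrow> y \<noteq> Nil8 \<Longrightarrow>
    addc c x y = cons_digit ((low_digit x + low_digit y + c) mod 8) (addc ((low_digit x + low_digit y + c) div 8) (high_digits x) (high_digits y))"
  by (subst addc.simps) simp

lemma cons_digit_simps:
  "cons_digit 0 = D0" "cons_digit 1 = D1" "cons_digit (Suc 0) = D1" "cons_digit 2 = D2" "cons_digit (Suc (Suc 0)) = D2" "cons_digit 3 = D3" "cons_digit 4 = D4" "cons_digit 5 = D5" "cons_digit 6 = D6" "cons_digit 7 = D7"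
  by (simp_all add: cons_digit_def fun_eq_iff)

lemma ad_rules:
  "ad (D0 x) (D0 y) = D0 (ad x y)" "ad (D0 x) (D1 y) = D1 (ad x y)"
  "ad (D0 x) (D2 y) = D2 (ad x y)" "ad (D0 x) (D3 y) = D3 (ad x y)"
  "ad (D0 x) (D4 y) = D4 (ad x y)" "ad (D0 x) (D5 y) = D5 (ad x y)"
  "ad (D0 x) (D6 y) = D6 (ad x y)" "ad (D0 x) (D7 y) = D7 (ad x y)"
  "ad (D1 x) (D0 y) = D1 (ad x y)" "ad (D1 x) (D1 y) = D2 (ad x y)"
  "ad (D1 x) (D2 y) = D3 (ad x y)" "ad (D1 x) (D3 y) = D4 (ad x y)"
  "ad (D1 x) (D4 y) = D5 (ad x y)" "ad (D1 x) (D5 y) = D6 (ad x y)"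
  "ad (D1 x) (D6 y) = D7 (ad x y)" "ad (D1 x) (D7 y) = D0 (adc x y)"
  "ad (D2 x) (D0 y) = D2 (ad x y)" "ad (D2 x) (D1 y) = D3 (ad x y)"
  "ad (D2 x) (D2 y) = D4 (ad x y)" "ad (D2 x) (D3 y) = D5 (ad x y)"
  "ad (D2 x) (D4 y) = D6 (ad x y)" "ad (D2 x) (D5 y) = D7 (ad x y)"
  "ad (D2 x) (D6 y) = D0 (adc x y)" "ad (D2 x) (D7 y) = D1 (adc x y)"
  "ad (D3 x) (D0 y) = D3 (ad x y)" "ad (D3 x) (D1 y) = D4 (ad x y)"
  "ad (D3 x) (D2 y) = D5 (ad x y)" "ad (D3 x) (D3 y) = D6 (ad x y)"
  "ad (D3 x) (D4 y) = D7 (ad x y)" "ad (D3 x) (D5 y) = D0 (adc x y)"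
  "ad (D3 x) (D6 y) = D1 (adc x y)" "ad (D3 x) (D7 y) = D2 (adc x y)"
  "ad (D4 x) (D0 y) = D4 (ad x y)" "ad (D4 x) (D1 y) = D5 (ad x y)"
  "ad (D4 x) (D2 y) = D6 (ad x y)" "ad (D4 x) (D3 y) = D7 (ad x y)"
  "ad (D4 x) (D4 y) = D0 (adc x y)" "ad (D4 x) (D5 y) = D1 (adc x y)"
  "ad (D4 x) (D6 y) = D2 (adc x y)" "ad (D4 x) (D7 y) = D3 (adc x y)"
  "ad (D5 x) (D0 y) = D5 (ad x y)" "ad (D5 x) (D1 y) = D6 (ad x y)"
  "ad (D5 x) (D2 y) = D7 (ad x y)" "ad (D5 x) (D3 y) = D0 (adc x y)"
  "ad (D5 x) (D4 y) = D1 (adc x y)" "ad (D5 x) (D5 y) = D2 (adc x y)"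
  "ad (D5 x) (D6 y) = D3 (adc x y)" "ad (D5 x) (D7 y) = D4 (adc x y)"
  "ad (D6 x) (D0 y) = D6 (ad x y)" "ad (D6 x) (D1 y) = D7 (ad x y)"
  "ad (D6 x) (D2 y) = D0 (adc x y)" "ad (D6 x) (D3 y) = D1 (adc x y)"
  "ad (D6 x) (D4 y) = D2 (adc x y)" "ad (D6 x) (D5 y) = D3 (adc x y)"
  "ad (D6 x) (D6 y) = D4 (adc x y)" "ad (D6 x) (D7 y) = D5 (adc x y)"
  "ad (D7 x) (D0 y) = D7 (ad x y)" "ad (D7 x) (D1 y) = D0 (adc x y)"
  "ad (D7 x) (D2 y) = D1 (adc x y)" "ad (D7 x) (D3 y) = D2 (adc x y)"
  "ad (D7 x) (D4 y) = D3 (adc x y)" "ad (D7 x) (D5 y) = D4 (adc x y)"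
  "ad (D7 x) (D6 y) = D5 (adc x y)" "ad (D7 x) (D7 y) = D6 (adc x y)"
  "adc (D0 x) (D0 y) = D1 (ad x y)" "adc (D0 x) (D1 y) = D2 (ad x y)"
  "adc (D0 x) (D2 y) = D3 (ad x y)" "adc (D0 x) (D3 y) = D4 (ad x y)"
  "adc (D0 x) (D4 y) = D5 (ad x y)" "adc (D0 x) (D5 y) = D6 (ad x y)"
  "adc (D0 x) (D6 y) = D7 (ad x y)" "adc (D0 x) (D7 y) = D0 (adc x y)"
  "adc (D1 x) (D0 y) = D2 (ad x y)" "adc (D1 x) (D1 y) = D3 (ad x y)"
  "adc (D1 x) (D2 y) = D4 (ad x y)" "adc (D1 x) (D3 y) = D5 (ad x y)"
  "adc (D1 x) (D4 y) = D6 (ad x y)" "adc (D1 x) (D5 y) = D7 (ad x y)"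
  "adc (D1 x) (D6 y) = D0 (adc x y)" "adc (D1 x) (D7 y) = D1 (adc x y)"
  "adc (D2 x) (D0 y) = D3 (ad x y)" "adc (D2 x) (D1 y) = D4 (ad x y)"
  "adc (D2 x) (D2 y) = D5 (ad x y)" "adc (D2 x) (D3 y) = D6 (ad x y)"
  "adc (D2 x) (D4 y) = D7 (ad x y)" "adc (D2 x) (D5 y) = D0 (adc x y)"
  "adc (D2 x) (D6 y) = D1 (adc x y)" "adc (D2 x) (D7 y) = D2 (adc x y)"
  "adc (D3 x) (D0 y) = D4 (ad x y)" "adc (D3 x) (D1 y) = D5 (ad x y)"
  "adc (D3 x) (D2 y) = D6 (ad x y)" "adc (D3 x) (D3 y) = D7 (ad x y)"
  "adc (D3 x) (D4 y) = D0 (adc x y)" "adc (D3 x) (D5 y) = D1 (adc x y)"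
  "adc (D3 x) (D6 y) = D2 (adc x y)" "adc (D3 x) (D7 y) = D3 (adc x y)"
  "adc (D4 x) (D0 y) = D5 (ad x y)" "adc (D4 x) (D1 y) = D6 (ad x y)"
  "adc (D4 x) (D2 y) = D7 (ad x y)" "adc (D4 x) (D3 y) = D0 (adc x y)"
  "adc (D4 x) (D4 y) = D1 (adc x y)" "adc (D4 x) (D5 y) = D2 (adc x y)"
  "adc (D4 x) (D6 y) = D3 (adc x y)" "adc (D4 x) (D7 y) = D4 (adc x y)"
  "adc (D5 x) (D0 y) = D6 (ad x y)" "adc (D5 x) (D1 y) = D7 (ad x y)"
  "adc (D5 x) (D2 y) = D0 (adc x y)" "adc (D5 x) (D3 y) = D1 (adc x y)"
  "adc (D5 x) (D4 y) = D2 (adc x y)" "adc (D5 x) (D5 y) = D3 (adc x y)"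
  "adc (D5 x) (D6 y) = D4 (adc x y)" "adc (D5 x) (D7 y) = D5 (adc x y)"
  "adc (D6 x) (D0 y) = D7 (ad x y)" "adc (D6 x) (D1 y) = D0 (adc x y)"
  "adc (D6 x) (D2 y) = D1 (adc x y)" "adc (D6 x) (D3 y) = D2 (adc x y)"
  "adc (D6 x) (D4 y) = D3 (adc x y)" "adc (D6 x) (D5 y) = D4 (adc x y)"
  "adc (D6 x) (D6 y) = D5 (adc x y)" "adc (D6 x) (D7 y) = D6 (adc x y)"
  "adc (D7 x) (D0 y) = D0 (adc x y)" "adc (D7 x) (D1 y) = D1 (adc x y)"
  "adc (D7 x) (D2 y) = D2 (adc x y)" "adc (D7 x) (D3 y) = D3 (adc x y)"
  "adc (D7 x) (D4 y) = D4 (adc x y)" "adc (D7 x) (D5 y) = D5 (adc x y)"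
  "adc (D7 x) (D6 y) = D6 (adc x y)" "adc (D7 x) (D7 y) = D7 (adc x y)"
  by (simp_all add: ad_def adc_def addc_digits cons_digit_simps)

lemma ad_Nil8_rules: "ad Nil8 y = y" "ad x Nil8 = x" "adc Nil8 y = inc y" "adc x Nil8 = inc x"
  unfolding ad_def adc_def by (subst addc.simps; simp)+

section \<open>Division of power series by 1 - X^j, on coefficient lists cut into blocks\<close>

fun add_lists :: "oct list \<Rightarrow> oct list \<Rightarrow> oct list" where
  "add_lists [] ys = []"
| "add_lists (x # xs) [] = []"
| "add_lists (x # xs) (y # ys) = ad x y # add_lists xs ys"

lemma length_add_lists: "length (add_lists xs ys) = min (length xs) (length ys)"
  by (induction xs ys rule: add_lists.induct) auto

lemma nth_add_lists:
  "i < length xs \<Longrightarrow> i < length ys \<Longrightarrow> oval (add_lists xs ys ! i) = oval (xs ! i) + oval (ys ! i)"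
  by (induction xs ys arbitrary: i rule: add_lists.induct) (auto simp: nth_Cons oval_ad split: nat.split)

text \<open>Solves h (i + j) = h i + f i for a whole block of j indices at a time, so no index is
  ever computed. The detour through \<open>scan_next\<close> keeps the sum of two blocks shared: it
  is evaluated once, then used both as output and as the next state.\<close>

function (sequential) scan_blocks :: "oct list \<Rightarrow> oct list list \<Rightarrow> oct list list"
  and scan_next :: "oct list \<Rightarrow> oct list list \<Rightarrow> oct list list" where
  "scan_blocks a [] = []"
| "scan_blocks a (b # bs) = scan_next (add_lists a b) bs"
| "scan_next v bs = v # scan_blocks v bs"
  by pat_completeness auto
termination by (relation "Wellfounded.measure (\<lambda>x. case x of Inl (a, bs) \<Rightarrow> 2 * length bs
    | Inr (a, bs) \<Rightarrow> 2 * length bs + 1)") auto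

fun blocks :: "nat \<Rightarrow> 'a list list \<Rightarrow> bool" where
  "blocks j [] = True"
| "blocks j (b # bs) = (if bs = [] then length b \<le> j else length b = j \<and> blocks j bs)"

text \<open>The state \<open>a\<close> holds the last j values of h before the current position, so
  the induction step replaces h by its shift by j. Output position i carries h (i + j); the initial
  block itself is not part of the output.\<close>

lemma nth_scan_blocks:
  fixes h :: "nat \<Rightarrow> 'a::semiring_1"
  assumes "blocks j bs" "length a = j"
    and "\<And>i. i < j \<Longrightarrow> of_nat (oval (a ! i)) = h i"
    and "\<And>i. i < length (concat bs) \<Longrightarrow> h (i + j) = h i + of_nat (oval (concat bs ! i))"
  shows "length (concat (scan_blocks a bs)) = length (concat bs)
    \<and> (\<forall>i<length (concat bs). of_nat (oval (concat (scan_blocks a bs) ! i)) = h (i + j))"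
  using assms
proof (induction bs arbitrary: a h)
  case Nil
  then show ?case by simp
next
  case (Cons b bs)
  have lb: "length b \<le> j" using Cons.prems(1) by (auto split: if_splits)
  have v: "length (add_lists a b) = length b"
    using lb Cons.prems(2) by (simp add: length_add_lists)
  have hv: "of_nat (oval (add_lists a b ! i)) = h (i + j)" if "i < length b" for i
    using that lb Cons.prems(2) Cons.prems(3)[of i] Cons.prems(4)[of i]
    by (simp add: nth_add_lists nth_append)
  show ?case
  proof (cases "bs = []")
    case True
    then show ?thesis using v hv by simp
  next
    case False
    then have b: "length b = j" "blocks j bs" using Cons.prems(1) by auto
    have IH: "length (concat (scan_blocks (add_lists a b) bs)) = length (concat bs)
      \<and> (\<forall>i<length (concat bs). of_nat (oval (concat (scan_blocks (add_lists a b) bs) ! i)) = h (i + j + j))"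
    proof (rule Cons.IH[OF b(2)])
      show "length (add_lists a b) = j" using v b by simp
      show "of_nat (oval (add_lists a b ! i)) = h (i + j)" if "i < j" for i using hv b that by simp
      show "h (i + j + j) = h (i + j) + of_nat (oval (concat bs ! i))" if "i < length (concat bs)" for i
        using Cons.prems(4)[of "i + j"] that b(1) by (simp add: nth_append)
    qed
    show ?thesis
    proof (intro conjI allI impI)
      show "length (concat (scan_blocks a (b # bs))) = length (concat (b # bs))"
        using IH v by simp
      fix i assume i: "i < length (concat (b # bs))"
      show "of_nat (oval (concat (scan_blocks a (b # bs)) ! i)) = h (i + j)"
      proof (cases "i < length b")
        case True
        then show ?thesis using hv v by (simp add: nth_append)
      next
        case False
        then show ?thesis
          using IH i v b(1) by (auto simp: nth_append dest!: spec[of _ "i - j"])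
      qed
    qed
  qed
qed

text \<open>Lengths are given by unary templates, which makes cutting a structural recursion free of
  numerals.\<close>

fun take_like :: "unit list \<Rightarrow> 'a list \<Rightarrow> 'a list" where
  "take_like [] ys = []"
| "take_like (t # ts) [] = []"
| "take_like (t # ts) (y # ys) = y # take_like ts ys"

fun drop_like :: "'b list \<Rightarrow> 'a list \<Rightarrow> 'a list" where
  "drop_like [] ys = ys"
| "drop_like (t # ts) [] = []"
| "drop_like (t # ts) (y # ys) = drop_like ts ys"

lemma take_like_eq: "take_like ts ys = take (length ts) ys"
  by (induction ts ys rule: take_like.induct) auto

lemma drop_like_eq: "drop_like ts ys = drop (length ts) ys"
  by (induction ts ys rule: drop_like.induct) auto

text \<open>Cuts the concatenation of the blocks into blocks of lengths 1 + length T, for T running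
  through the list of templates; the last template is used forever.\<close>

function (sequential) reblock :: "unit list list \<Rightarrow> unit list \<Rightarrow> 'a list \<Rightarrow> 'a list \<Rightarrow> 'a list list \<Rightarrow> 'a list list"
  and reblock_next :: "unit list list \<Rightarrow> 'a \<Rightarrow> 'a list \<Rightarrow> 'a list list \<Rightarrow> 'a list list" where
  "reblock Ts ts c [] [] = [c]"
| "reblock Ts ts c [] (b # bs) = reblock Ts ts c b bs"
| "reblock Ts [] c (y # b) bs = c # reblock_next Ts y b bs"
| "reblock Ts (t # ts) c (y # b) bs
    = reblock Ts (drop_like (y # b) (t # ts)) (c @ take_like (t # ts) (y # b)) (drop_like (t # ts) (y # b)) bs"
| "reblock_next [] y b bs = reblock [] [] [y] b bs"
| "reblock_next [T] y b bs = reblock [T] T [y] b bs"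
| "reblock_next (T # T' # Ts) y b bs = reblock (T' # Ts) T [y] b bs"
  by pat_completeness auto
termination
  by (relation "Wellfounded.measure (\<lambda>x. case x of
      Inl (Ts, ts, c, b, bs) \<Rightarrow> 2 * (length b + length (concat bs) + length bs)
    | Inr (Ts, y, b, bs) \<Rightarrow> 2 * (length b + length (concat bs) + length bs) + 1)")
    (auto simp: drop_like_eq)

lemma concat_reblock:
  "concat (reblock Ts ts c b bs) = c @ b @ concat bs"
  "concat (reblock_next Ts y b bs) = y # b @ concat bs"
proof (induction Ts ts c b bs and Ts y b bs rule: reblock_reblock_next.induct)
  case (4 Ts t ts c y b bs)
  then show ?case
    by (simp add: take_like_eq drop_like_eq)
qed simp_all

lemma blocks_reblock:
  "Ts = [T] \<Longrightarrow> length c + length ts = Suc (length T) \<Longrightarrow> blocks (Suc (length T)) (reblock Ts ts c b bs)"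
  "Ts = [T] \<Longrightarrow> blocks (Suc (length T)) (reblock_next Ts y b bs)"
proof (induction Ts ts c b bs and Ts y b bs rule: reblock_reblock_next.induct)
  case (4 Ts t ts c y b bs)
  then show ?case by (simp add: take_like_eq drop_like_eq min_def)
qed simp_all

text \<open>A Horner scheme. Partitions into k distinct parts are counted by the product of x^j / (1
  - x^j) over j = 1, ..., k, so the sum over k is nested as 1 + x / (1 - x) * (1 + x^2 / (1 - x^2) *
  (1 + ...)). Row j replaces F by 1 + x^j * F / (1 - x^j). Because of the factor x^j a row is j
  entries longer than its input, so inner rows stay short.\<close>

fun partition_rows :: "nat list \<Rightarrow> oct list list \<Rightarrow> oct list list" where
  "partition_rows [] bs = bs"
| "partition_rows (j # js) bs = partition_rows js ((D1 Nil8 # replicate (j - 1) Nil8)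
      # scan_blocks (replicate j Nil8) (reblock [replicate (j - 1) ()] (replicate j ()) [] [] bs))"


section \<open>Counting partitions by the number of parts\<close>

definition parts_fps :: "nat \<Rightarrow> rat fps" where
  "parts_fps k = Abs_fps (\<lambda>n. of_nat (card {S \<in> distinct_partitions n. card S = k}))"

lemma sum_image_Suc: "finite S \<Longrightarrow> \<Sum>(Suc ` S) = \<Sum>S + card S"
  by (simp add: sum.reindex sum_Suc)

text \<open>Lower each of the k + 1 parts by 1. If 1 was not a part, k + 1 distinct parts remain; if
  it was, it vanishes and k parts remain.\<close>

lemma card_distinct_partitions_Suc:
  "card {S \<in> distinct_partitions (n + Suc k). card S = Suc k}
    = card {S \<in> distinct_partitions n. card S = Suc k} + card {S \<in> distinct_partitions n. card S = k}"
    (is "card ?A = card ?B + card ?C")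
proof -
  have 1: "(\<lambda>S. Suc ` S) ` ?B = {S \<in> ?A. 1 \<notin> S}"
  proof (intro equalityI subsetI)
    fix S assume "S \<in> (\<lambda>S. Suc ` S) ` ?B"
    then obtain R where R: "R \<in> ?B" "S = Suc ` R" by blast
    then show "S \<in> {S \<in> ?A. 1 \<notin> S}"
      by (auto simp: distinct_partitions_def sum_image_Suc card_image)
  next
    fix S assume S: "S \<in> {S \<in> ?A. 1 \<notin> S}"
    define R where "R = (\<lambda>k. k - 1) ` S"
    have pos: "k \<ge> 2" if "k \<in> S" for k
    proof -
      have "k > 0" "k \<noteq> 1" using S that by (auto simp: distinct_partitions_def)
      then show ?thesis by linarith
    qed
    have fin: "finite R" using S by (auto simp: R_def distinct_partitions_def)
    have SR: "S = Suc ` R"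
      using pos by (force simp: R_def image_image)
    have "card R = Suc k" using S by (auto simp: SR card_image)
    moreover have "\<Sum>R = n" using S fin calculation by (auto simp: SR distinct_partitions_def sum_image_Suc)
    ultimately have "R \<in> ?B" using fin pos by (fastforce simp: R_def distinct_partitions_def)
    then show "S \<in> (\<lambda>S. Suc ` S) ` ?B" using SR by blast
  qed
  have 2: "(\<lambda>S. insert 1 (Suc ` S)) ` ?C = {S \<in> ?A. 1 \<in> S}"
  proof (intro equalityI subsetI)
    fix S assume "S \<in> (\<lambda>S. insert 1 (Suc ` S)) ` ?C"
    then obtain R where R: "R \<in> ?C" "S = insert 1 (Suc ` R)" by blast
    then have "1 \<notin> Suc ` R" by (auto simp: distinct_partitions_def)
    then show "S \<in> {S \<in> ?A. 1 \<in> S}"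
      using R by (auto simp: distinct_partitions_def sum_image_Suc card_image)
  next
    fix S assume S: "S \<in> {S \<in> ?A. 1 \<in> S}"
    define R where "R = (\<lambda>k. k - 1) ` (S - {1})"
    have pos: "k \<ge> 2" if "k \<in> S - {1}" for k
    proof -
      have "k > 0" "k \<noteq> 1" using S that by (auto simp: distinct_partitions_def)
      then show ?thesis by linarith
    qed
    have fin: "finite R" using S by (auto simp: R_def distinct_partitions_def)
    have "S - {1} = Suc ` R"
      using pos by (force simp: R_def image_image)
    then have SR: "S = insert 1 (Suc ` R)" using S by blast
    have R0: "0 \<notin> R" using pos by (fastforce simp: R_def)
    then have N: "1 \<notin> Suc ` R" by auto
    have "card R = k" using S N fin by (auto simp: SR card_image)
    moreover have "\<Sum>R = n" using S fin N calculation by (auto simp: SR distinct_partitions_def sum_image_Suc)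
    ultimately have "R \<in> ?C" using fin R0 by (auto simp: distinct_partitions_def intro: gr0I)
    then show "S \<in> (\<lambda>S. insert 1 (Suc ` S)) ` ?C" using SR by blast
  qed
  have "?A = {S \<in> ?A. 1 \<notin> S} \<union> {S \<in> ?A. 1 \<in> S}" by blast
  moreover have "finite ?A" by (simp add: finite_distinct_partitions)
  ultimately have "card ?A = card {S \<in> ?A. 1 \<notin> S} + card {S \<in> ?A. 1 \<in> S}"
    by (metis (no_types, lifting) card_Un_disjoint disjoint_iff finite_Un mem_Collect_eq)
  also have "card {S \<in> ?A. 1 \<notin> S} = card ?B"
    unfolding 1[symmetric] by (rule card_image) (auto simp: inj_on_def inj_image_eq_iff)
  also have "card {S \<in> ?A. 1 \<in> S} = card ?C"
    unfolding 2[symmetric]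
  proof (rule card_image, rule inj_onI)
    fix S R assume a: "S \<in> ?C" "R \<in> ?C" "insert 1 (Suc ` S) = insert 1 (Suc ` R)"
    have "1 \<notin> Suc ` S" "1 \<notin> Suc ` R" using a by (auto simp: distinct_partitions_def)
    then have "Suc ` S = Suc ` R" using a(3) by (metis insert_ident)
    then show "S = R" by (simp add: inj_image_eq_iff)
  qed
  finally show ?thesis .
qed

text \<open>Lowering all l + 1 parts by 1 takes l + 1 off the sum and leaves at least l parts, so
  the triangular numbers arise by induction through the recurrence above.\<close>

lemma sum_ge_triangle:
  "S \<in> distinct_partitions n \<Longrightarrow> card S = k \<Longrightarrow> k * (k + 1) \<le> 2 * n"
proof (induction n arbitrary: S k rule: less_induct)
  case (less n)
  show ?case
  proof (cases k)
    case 0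
    then show ?thesis by simp
  next
    case (Suc l)
    have fin: "finite S" using less.prems by (simp add: distinct_partitions_def)
    have "card S = (\<Sum>i\<in>S. 1)" by simp
    also have "\<dots> \<le> \<Sum>S" using less.prems by (intro sum_mono) (auto simp: distinct_partitions_def Suc_le_eq)
    finally have kn: "Suc l \<le> n" using less.prems Suc by (simp add: distinct_partitions_def)
    define m where "m = n - Suc l"
    have n: "n = m + Suc l" using kn m_def by simp
    have "S \<in> {S \<in> distinct_partitions (m + Suc l). card S = Suc l}" using less.prems n Suc by simp
    then have "card {S \<in> distinct_partitions (m + Suc l). card S = Suc l} \<noteq> 0"
      by (subst card_0_eq) (auto simp: finite_distinct_partitions)
    then have "card {S \<in> distinct_partitions m. card S = Suc l} + card {S \<in> distinct_partitions m. card S = l} \<noteq> 0"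
      unfolding card_distinct_partitions_Suc .
    then have "{S \<in> distinct_partitions m. card S = Suc l} \<noteq> {} \<or> {S \<in> distinct_partitions m. card S = l} \<noteq> {}"
      by (metis add_is_0 card.empty)
    then obtain R where R: "R \<in> distinct_partitions m" "card R = Suc l \<or> card R = l" by blast
    have "m < n" using n by simp
    from less.IH[OF this R(1) refl] R(2) have "l * (l + 1) \<le> 2 * m" by auto
    then show ?thesis using n Suc by simp
  qed
qed

lemma parts_fps_0: "parts_fps 0 = 1"
proof (rule fps_ext)
  fix n
  have "{S \<in> distinct_partitions n. card S = 0} = (if n = 0 then {{}} else {})"
    by (auto simp: distinct_partitions_def)
  then show "fps_nth (parts_fps 0) n = fps_nth 1 n" by (simp add: parts_fps_def)
qed

lemma parts_fps_Suc:
  "parts_fps (Suc k) = fps_X ^ Suc k * (parts_fps (Suc k) + parts_fps k)"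
proof (rule fps_ext)
  fix n
  show "fps_nth (parts_fps (Suc k)) n = fps_nth (fps_X ^ Suc k * (parts_fps (Suc k) + parts_fps k)) n"
  proof (cases "n < Suc k")
    case True
    have "{S \<in> distinct_partitions n. card S = Suc k} = {}"
    proof (rule ccontr)
      assume "\<not> ?thesis"
      then obtain S where S: "S \<in> distinct_partitions n" "card S = Suc k" by blast
      have "card S = (\<Sum>i\<in>S. 1)" by simp
      also have "\<dots> \<le> \<Sum>S" using S by (intro sum_mono) (auto simp: distinct_partitions_def Suc_le_eq)
      finally show False using S True by (simp add: distinct_partitions_def)
    qed
    then have "card {S \<in> distinct_partitions n. card S = Suc k} = 0" by (simp only: card.empty)
    then show ?thesis using True by (simp add: parts_fps_def fps_X_power_mult_nth del: power_Suc)
  next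
    case False
    then obtain m where n: "n = m + Suc k" by (metis add.commute le_Suc_ex not_less)
    then show ?thesis using card_distinct_partitions_Suc[of m k]
      by (simp add: parts_fps_def fps_X_power_mult_nth del: power_Suc)
  qed
qed

text \<open>More than K distinct parts would already sum to more than n, so cutting the sum at K
  parts loses nothing.\<close>

lemma q_eq_sum_parts_fps:
  assumes "2 * n < Suc K * (K + 2)"
  shows "of_nat (q n) = fps_nth (\<Sum>k\<le>K. parts_fps k) n"
proof -
  have le: "card S \<le> K" if "S \<in> distinct_partitions n" for S
  proof (rule ccontr)
    assume "\<not> card S \<le> K"
    then have "Suc K * (K + 2) \<le> card S * (card S + 1)" by (intro mult_mono) auto
    then show False using sum_ge_triangle[OF that refl] assms by linarith
  qed
  have "distinct_partitions n = (\<Union>k\<in>{..K}. {S \<in> distinct_partitions n. card S = k})"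
    using le by auto
  then have "q n = card (\<Union>k\<in>{..K}. {S \<in> distinct_partitions n. card S = k})"
    by (simp add: q_def)
  also have "\<dots> = (\<Sum>k\<le>K. card {S \<in> distinct_partitions n. card S = k})"
    by (rule card_UN_disjoint) (auto simp: finite_distinct_partitions)
  finally show ?thesis by (simp add: parts_fps_def fps_sum_nth)
qed

definition agrees :: "oct list \<Rightarrow> rat fps \<Rightarrow> bool" where
  "agrees xs F \<longleftrightarrow> (\<forall>i<length xs. of_nat (oval (xs ! i)) = fps_nth F i)"

lemma fps_geom_shift:
  fixes F :: "rat fps"
  assumes "j > 0"
  defines "H \<equiv> fps_X ^ j * F * inverse (1 - fps_X ^ j)"
  shows "H = fps_X ^ j * (H + F)"
    and "i < j \<Longrightarrow> fps_nth H i = 0"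
    and "fps_nth H (i + j) = fps_nth H i + fps_nth F i"
proof -
  have "inverse (1 - fps_X ^ j) * (1 - fps_X ^ j) = (1 :: rat fps)"
    using assms(1) by (intro inverse_mult_eq_1) simp
  then have "H * (1 - fps_X ^ j) = fps_X ^ j * F"
    by (simp add: H_def mult.assoc)
  then show H: "H = fps_X ^ j * (H + F)" by (simp add: algebra_simps)
  show "i < j \<Longrightarrow> fps_nth H i = 0"
    by (subst H) (simp add: fps_X_power_mult_nth)
  show "fps_nth H (i + j) = fps_nth H i + fps_nth F i"
    by (subst H) (simp add: fps_X_power_mult_nth)
qed

lemma agrees_scan_blocks:
  assumes F: "agrees (concat bs) F" and j: "j > 0"
  defines "cs \<equiv> (D1 Nil8 # replicate (j - 1) Nil8)
      # scan_blocks (replicate j Nil8) (reblock [replicate (j - 1) ()] (replicate j ()) [] [] bs)"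
  shows "agrees (concat cs) (1 + fps_X ^ j * F * inverse (1 - fps_X ^ j))"
    and "length (concat cs) = length (concat bs) + j"
proof -
  define H where "H = fps_X ^ j * F * inverse (1 - fps_X ^ j)"
  define rs where "rs = reblock [replicate (j - 1) ()] (replicate j ()) [] [] bs"
  have c: "concat rs = concat bs" by (simp add: rs_def concat_reblock)
  have "blocks (Suc (length (replicate (j - 1) ()))) rs"
    unfolding rs_def using j by (intro blocks_reblock) auto
  then have b: "blocks j rs" using j by simp
  have S: "length (concat (scan_blocks (replicate j Nil8) rs)) = length (concat rs)
    \<and> (\<forall>i<length (concat rs). of_nat (oval (concat (scan_blocks (replicate j Nil8) rs) ! i)) = fps_nth H (i + j))"
  proof (rule nth_scan_blocks[OF b])
    show "of_nat (oval (replicate j Nil8 ! i)) = fps_nth H i" if "i < j" for i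
      using that fps_geom_shift(2)[OF j that] by (simp add: H_def)
    show "fps_nth H (i + j) = fps_nth H i + of_nat (oval (concat rs ! i))" if "i < length (concat rs)" for i
      using fps_geom_shift(3)[OF j] F that by (simp add: H_def agrees_def c)
  qed simp
  show "length (concat cs) = length (concat bs) + j"
    using S j c by (simp add: cs_def rs_def)
  show "agrees (concat cs) (1 + fps_X ^ j * F * inverse (1 - fps_X ^ j))"
    unfolding agrees_def H_def[symmetric]
  proof (intro allI impI)
    fix i assume i: "i < length (concat cs)"
    show "of_nat (oval (concat cs ! i)) = fps_nth (1 + H) i"
    proof (cases "i < j")
      case True
      then have "fps_nth H i = 0" using fps_geom_shift(2)[OF j True] by (simp add: H_def)
      then show ?thesis
        using True j by (cases i) (simp_all add: cs_def nth_append)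
    next
      case False
      then obtain m where m: "i = m + j" by (metis add.commute le_Suc_ex not_less)
      have "concat cs = (D1 Nil8 # replicate (j - 1) Nil8) @ concat (scan_blocks (replicate j Nil8) rs)"
        by (simp add: cs_def rs_def)
      moreover have "length (D1 Nil8 # replicate (j - 1) Nil8) = j" using j by simp
      ultimately have "concat cs ! i = concat (scan_blocks (replicate j Nil8) rs) ! m"
        unfolding m by (metis add.commute nth_append_length_plus)
      moreover have "m < length (concat rs)"
        using i S j m c by (simp add: cs_def rs_def)
      ultimately show ?thesis using S m j by simp
    qed
  qed
qed

text \<open>The Horner invariant: \<open>parts_fps k\<close> collects the factors that the remaining
  rows k, ..., 1 will still multiply in, so the list F built so far represents the terms with at
  least k parts divided by \<open>parts_fps k\<close>.\<close>

lemma agrees_partition_rows: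
  assumes "js = rev [l+1..<Suc k]" "l \<le> k" "agrees (concat bs) F" "parts_fps k * F = (\<Sum>i=k..K. parts_fps i)" "k \<le> K"
  shows "\<exists>G. agrees (concat (partition_rows js bs)) G \<and> parts_fps l * G = (\<Sum>i=l..K. parts_fps i)
     \<and> length (concat (partition_rows js bs)) = length (concat bs) + sum_list js"
  using assms
proof (induction js arbitrary: bs F k)
  case Nil
  then have "l = k" by (auto split: if_splits)
  then show ?case using Nil by auto
next
  case (Cons j js)
  from Cons.prems(1,2) have jk: "j = k" "js = rev [l+1..<k]" "l < k"
    by (auto split: if_splits)
  then obtain k' where k: "k = Suc k'" by (cases k) auto
  define H where "H = fps_X ^ j * F * inverse (1 - fps_X ^ j)"
  define cs where "cs = (D1 Nil8 # replicate (j - 1) Nil8)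
      # scan_blocks (replicate j Nil8) (reblock [replicate (j - 1) ()] (replicate j ()) [] [] bs)"
  have j: "j > 0" using jk by simp
  have H: "H = fps_X ^ j * (H + F)" unfolding H_def by (rule fps_geom_shift(1)[OF j])
  have "parts_fps k * (1 - fps_X ^ k) = fps_X ^ k * parts_fps k'"
    using parts_fps_Suc[of k'] k by (simp add: algebra_simps)
  moreover have "H * (1 - fps_X ^ k) = fps_X ^ k * F" using H jk by (simp add: algebra_simps)
  \<comment> \<open>Both relations are cross-multiplied; the common factor is a nonzero element of
    an integral domain and is cancelled below.\<close>
  ultimately have "parts_fps k' * H * (fps_X ^ k * (1 - fps_X ^ k))
      = parts_fps k * F * (fps_X ^ k * (1 - fps_X ^ k))"
    by (metis (no_types, opaque_lifting) mult.assoc mult.commute)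
  moreover have "fps_X ^ k * (1 - fps_X ^ k) \<noteq> (0 :: rat fps)"
  proof -
    have "fps_nth (1 - fps_X ^ k) 0 = (1::rat)" using jk by simp
    then have "(1 - fps_X ^ k) \<noteq> (0 :: rat fps)" by (metis fps_zero_nth zero_neq_one)
    then show ?thesis by simp
  qed
  ultimately have "parts_fps k' * H = parts_fps k * F" by simp
  then have "parts_fps k' * (1 + H) = parts_fps k' + (\<Sum>i=k..K. parts_fps i)"
    using Cons.prems by (simp add: algebra_simps)
  also have "\<dots> = (\<Sum>i=k'..K. parts_fps i)"
    using Cons.prems(5) k by (simp add: sum.atLeast_Suc_atMost)
  finally have G: "parts_fps k' * (1 + H) = (\<Sum>i=k'..K. parts_fps i)" .
  have "\<exists>G. agrees (concat (partition_rows js cs)) G \<and> parts_fps l * G = (\<Sum>i=l..K. parts_fps i)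
     \<and> length (concat (partition_rows js cs)) = length (concat cs) + sum_list js"
    using agrees_scan_blocks(1)[OF Cons.prems(3) j] jk k Cons.prems(5) G
    by (intro Cons.IH[of k']) (auto simp: cs_def H_def)
  moreover have "length (concat cs) = length (concat bs) + j"
    unfolding cs_def by (rule agrees_scan_blocks(2)[OF Cons.prems(3) j])
  ultimately show ?case unfolding partition_rows.simps cs_def[symmetric] by auto
qed

primrec prefix_sums :: "oct \<Rightarrow> oct list \<Rightarrow> oct list" where
  "prefix_sums a [] = []"
| "prefix_sums a (x # xs) = ad a x # prefix_sums (ad a x) xs"

primrec last_or :: "oct \<Rightarrow> oct list \<Rightarrow> oct" where
  "last_or a [] = a"
| "last_or a (x # xs) = last_or x xs"

primrec prefix_sum_blocks :: "oct \<Rightarrow> oct list list \<Rightarrow> oct list list" where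
  "prefix_sum_blocks a [] = []"
| "prefix_sum_blocks a (b # bs) = prefix_sums a b # prefix_sum_blocks (last_or a (prefix_sums a b)) bs"

lemma length_prefix_sums: "length (prefix_sums a xs) = length xs"
  by (induction xs arbitrary: a) auto

lemma prefix_sums_append: "prefix_sums a (xs @ ys) = prefix_sums a xs @ prefix_sums (last_or a (prefix_sums a xs)) ys"
  by (induction xs arbitrary: a) auto

lemma concat_prefix_sum_blocks: "concat (prefix_sum_blocks a bs) = prefix_sums a (concat bs)"
  by (induction bs arbitrary: a) (auto simp: prefix_sums_append)

lemma nth_prefix_sums: "i < length xs \<Longrightarrow> oval (prefix_sums a xs ! i) = oval a + (\<Sum>t\<le>i. oval (xs ! t))"
proof (induction xs arbitrary: a i)
  case (Cons x xs)
  then show ?case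
    by (cases i) (auto simp: oval_ad sum.atMost_Suc_shift simp del: sum.atMost_Suc)
qed simp

text \<open>The row for j = 1 is done separately: dividing by 1 - X means taking prefix sums. Its
  factor X accounts for the shift, entry i being the value of q at i + 1.\<close>

lemma nth_prefix_sums_eq_q:
  assumes G: "agrees xs G" "parts_fps 1 * G = (\<Sum>i=1..K. parts_fps i)"
    and i: "i < length xs" "2 * length xs < Suc K * (K + 2)"
  shows "oval (prefix_sums Nil8 xs ! i) = q (i + 1)"
proof -
  define H where "H = fps_X ^ 1 * G * inverse (1 - fps_X ^ 1)"
  have H: "H = fps_X ^ 1 * (H + G)" unfolding H_def by (rule fps_geom_shift(1)) simp
  have P: "parts_fps 1 * (1 - fps_X) = (fps_X :: rat fps)"
    using parts_fps_Suc[of 0] parts_fps_0 by (simp add: algebra_simps)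
  have "H * (1 - fps_X) = fps_X * G" using H by (simp add: algebra_simps)
  also have "\<dots> = parts_fps 1 * G * (1 - fps_X)" using P by (metis mult.assoc mult.commute)
  finally have "H = parts_fps 1 * G"
  proof -
    assume a: "H * (1 - fps_X) = parts_fps 1 * G * (1 - fps_X)"
    have "fps_nth (1 - fps_X) 0 = (1::rat)" by simp
    then have "(1 - fps_X) \<noteq> (0 :: rat fps)" by fastforce
    then show ?thesis using a by simp
  qed
  then have "1 + H = parts_fps 0 + (\<Sum>i=1..K. parts_fps i)" using G parts_fps_0 by simp
  also have "\<dots> = (\<Sum>i\<le>K. parts_fps i)"
    by (simp add: atMost_atLeast0 sum.atLeast_Suc_atMost)
  finally have 1: "1 + H = (\<Sum>i\<le>K. parts_fps i)" .
  have "fps_nth H (m + 1) = (\<Sum>t\<le>m. fps_nth G t)" for m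
  proof (induction m)
    case 0
    show ?case using fps_geom_shift(2)[of 1 0 G] fps_geom_shift(3)[of 1 G 0]
      unfolding H_def by simp
  next
    case (Suc m)
    then show ?case using fps_geom_shift(3)[of 1 G "Suc m"] unfolding H_def by simp
  qed
  then have "fps_nth H (i + 1) = (\<Sum>t\<le>i. fps_nth G t)" .
  also have "\<dots> = (\<Sum>t\<le>i. of_nat (oval (xs ! t)))"
    using G(1) i(1) by (intro sum.cong) (auto simp: agrees_def)
  also have "\<dots> = of_nat (oval (prefix_sums Nil8 xs ! i))" using nth_prefix_sums[OF i(1), of Nil8] by simp
  finally have "of_nat (oval (prefix_sums Nil8 xs ! i)) = fps_nth H (i + 1)" by simp
  also have "\<dots> = fps_nth (1 + H) (i + 1)" by simp
  also have "\<dots> = of_nat (q (i + 1))"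
    unfolding 1 using i by (intro q_eq_sum_parts_fps[symmetric] le_less_trans[OF _ i(2)]) simp
  finally show ?thesis by simp
qed

section \<open>Integer sign tests on truncated values\<close>

definition tilted :: "int \<Rightarrow> int \<Rightarrow> int \<Rightarrow> int \<Rightarrow> int \<Rightarrow> int" where
  "tilted m a b c d = m^3 * d - 3 * m^2 * (m+1) * c + 3 * m * (m+1)^2 * b - (m+1)^3 * a"

text \<open>\<open>tilted m\<close> is - (m + 1)^3 times the cubic at x = - m / (m + 1), cleared of
  denominators. A larger m means a smaller x, so a negative value at m' > m is a positive value of
  the cubic further to the left.\<close>

definition sign_changes :: "int \<Rightarrow> int \<Rightarrow> int \<Rightarrow> int \<Rightarrow> bool" where
  "sign_changes a b c d \<longleftrightarrow> (\<exists>m m'. 0 < m \<and> m < m' \<and> tilted m' a b c d < 0 \<and> 0 < tilted m a b c d)"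

text \<open>One application of the operator m * E - (m + 1), with E the shift. Three applications
  give \<open>tilted\<close> on every window of four consecutive entries, with the intermediate
  values shared between windows.\<close>

fun tilted_steps :: "int \<Rightarrow> int list \<Rightarrow> int list" where
  "tilted_steps m (a # b # xs) = (m * (b - a) - a) # tilted_steps m (b # xs)"
| "tilted_steps m [a] = []"
| "tilted_steps m [] = []"

lemma length_tilted_steps: "length (tilted_steps m xs) = length xs - 1"
  by (induction m xs rule: tilted_steps.induct) auto

lemma nth_tilted_steps: "i + 1 < length xs \<Longrightarrow> tilted_steps m xs ! i = m * (xs ! (i+1) - xs ! i) - xs ! i"
proof (induction m xs arbitrary: i rule: tilted_steps.induct)
  case (1 m a b xs)
  then show ?case by (cases i) auto
qed auto

lemma nth_tilted_steps_3:
  assumes "i + 3 < length xs"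
  shows "tilted_steps m (tilted_steps m (tilted_steps m xs)) ! i = tilted m (xs ! i) (xs ! (i+1)) (xs ! (i+2)) (xs ! (i+3))"
proof -
  have 1: "tilted_steps m xs ! k = m * (xs ! (k+1) - xs ! k) - xs ! k" if "k \<le> i + 2" for k
    using assms that by (intro nth_tilted_steps) simp
  have 2: "tilted_steps m (tilted_steps m xs) ! k = m * (tilted_steps m xs ! (k+1) - tilted_steps m xs ! k) - tilted_steps m xs ! k" if "k \<le> i + 1" for k
    using assms that by (intro nth_tilted_steps) (simp add: length_tilted_steps)
  have 3: "tilted_steps m (tilted_steps m (tilted_steps m xs)) ! i
      = m * (tilted_steps m (tilted_steps m xs) ! (i+1) - tilted_steps m (tilted_steps m xs) ! i) - tilted_steps m (tilted_steps m xs) ! i"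
    using assms by (intro nth_tilted_steps) (simp add: length_tilted_steps)
  have k: "i + 1 + 1 = i + 2" "i + 2 + 1 = i + 3" by simp_all
  have d: "tilted_steps m xs ! i = m * (xs ! (i+1) - xs ! i) - xs ! i"
    "tilted_steps m xs ! (i+1) = m * (xs ! (i+2) - xs ! (i+1)) - xs ! (i+1)"
    "tilted_steps m xs ! (i+2) = m * (xs ! (i+3) - xs ! (i+2)) - xs ! (i+2)"
    using 1[of i] 1[of "i+1"] 1[of "i+2"] unfolding k by simp_all
  have e: "tilted_steps m (tilted_steps m xs) ! i = m * (tilted_steps m xs ! (i+1) - tilted_steps m xs ! i) - tilted_steps m xs ! i"
    "tilted_steps m (tilted_steps m xs) ! (i+1) = m * (tilted_steps m xs ! (i+2) - tilted_steps m xs ! (i+1)) - tilted_steps m xs ! (i+1)"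
    using 2[of i] 2[of "i+1"] unfolding k by simp_all
  show ?thesis
    unfolding 3 e d tilted_def by (simp add: power2_eq_square power3_eq_cube algebra_simps)
qed

primrec all_below :: "int \<Rightarrow> int list \<Rightarrow> bool" where
  "all_below c [] = True"
| "all_below c (x # xs) = (x < - c \<and> all_below c xs)"

primrec all_above :: "int \<Rightarrow> int list \<Rightarrow> bool" where
  "all_above c [] = True"
| "all_above c (x # xs) = (c < x \<and> all_above c xs)"

lemma all_below_nth: "all_below c xs \<Longrightarrow> i < length xs \<Longrightarrow> xs ! i < - c"
  by (induction xs arbitrary: i) (auto simp: nth_Cons split: nat.split)

lemma all_above_nth: "all_above c xs \<Longrightarrow> i < length xs \<Longrightarrow> c < xs ! i"
  by (induction xs arbitrary: i) (auto simp: nth_Cons split: nat.split)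

primrec trunc :: "unit list \<Rightarrow> oct \<Rightarrow> oct" where
  "trunc [] x = x"
| "trunc (t # ts) x = trunc ts (high_digits x)"

lemma oval_trunc: "oval (trunc ts x) = oval x div 8 ^ length ts"
proof (induction ts arbitrary: x)
  case (Cons t ts)
  have "oval (high_digits x) = oval x div 8" using oval_digits[of x] low_digit_less[of x] by simp
  then show ?case using Cons by (simp add: div_mult2_eq)
qed simp

definition ival :: "oct \<Rightarrow> int" where "ival x = int (oval x)"

lemma ival_rules:
  "ival Nil8 = 0" "ival (D0 x) = 8 * ival x" "ival (D1 x) = 8 * ival x + 1" "ival (D2 x) = 8 * ival x + 2"
  "ival (D3 x) = 8 * ival x + 3" "ival (D4 x) = 8 * ival x + 4" "ival (D5 x) = 8 * ival x + 5"
  "ival (D6 x) = 8 * ival x + 6" "ival (D7 x) = 8 * ival x + 7"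
  by (simp_all add: ival_def)

primrec ivals :: "unit list \<Rightarrow> oct list \<Rightarrow> int list" where
  "ivals ts [] = []"
| "ivals ts (x # xs) = ival (trunc ts x) # ivals ts xs"

lemma ivals_map: "ivals ts xs = map (\<lambda>x. int (oval x) div 8 ^ length ts) xs"
  by (induction xs) (auto simp: ival_def oval_trunc zdiv_int)

text \<open>The absolute values of the coefficients of \<open>tilted\<close> add up to (m + (m +
  1))^3. This bounds the effect of dropped digits in units of the last kept digit; without dropped
  digits the test is exact.\<close>

primrec margin :: "unit list \<Rightarrow> int \<Rightarrow> int" where
  "margin [] m = 0"
| "margin (t # ts) m = (2 * m + 1) * ((2 * m + 1) * (2 * m + 1))"

text \<open>\<open>tilted\<close> is linear in the four entries, so quotients and remainders modulo
  \<open>8 ^ length ts\<close> can be treated separately.\<close>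

lemma tilted_trunc_bounds:
  fixes ts :: "unit list"
  assumes m: "0 < m" and a: "0 \<le> a" "0 \<le> b" "0 \<le> c" "0 \<le> d"
  defines "t \<equiv> 8 ^ length ts"
  shows "tilted m a b c d \<le> t * (tilted m (a div t) (b div t) (c div t) (d div t) + margin ts m)"
    and "tilted m a b c d \<ge> t * (tilted m (a div t) (b div t) (c div t) (d div t) - margin ts m)"
proof -
  have t: "t > 0" by (simp add: t_def)
  have lin: "tilted m a b c d = t * tilted m (a div t) (b div t) (c div t) (d div t)
      + tilted m (a mod t) (b mod t) (c mod t) (d mod t)"
  proof -
    have "a = t * (a div t) + a mod t" "b = t * (b div t) + b mod t"
      "c = t * (c div t) + c mod t" "d = t * (d div t) + d mod t" by simp_all
    then obtain a1 a2 b1 b2 c1 c2 d1 d2 where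
      e: "a = t * a1 + a2" "a div t = a1" "a mod t = a2" "b = t * b1 + b2" "b div t = b1" "b mod t = b2"
      "c = t * c1 + c2" "c div t = c1" "c mod t = c2" "d = t * d1 + d2" "d div t = d1" "d mod t = d2"
      by blast
    show ?thesis unfolding e(2,3,5,6,8,9,11,12) unfolding e(1,4,7,10) tilted_def
      by (simp add: algebra_simps)
  qed
  have "\<bar>tilted m (a mod t) (b mod t) (c mod t) (d mod t)\<bar> \<le> t * margin ts m"
  proof (cases ts)
    case Nil
    then show ?thesis by (simp add: t_def tilted_def)
  next
    case (Cons u us)
    define A B C D where "A = a mod t" and "B = b mod t" and "C = c mod t" and "D = d mod t"
    have r: "0 \<le> A" "A \<le> t" "0 \<le> B" "B \<le> t" "0 \<le> C" "C \<le> t" "0 \<le> D" "D \<le> t"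
      using t by (auto simp: A_def B_def C_def D_def intro: less_imp_le)
    have n: "0 \<le> m^3" "0 \<le> 3 * m^2 * (m+1)" "0 \<le> 3 * m * (m+1)^2" "0 \<le> (m+1)^3" using m by auto
    have "m^3 * D \<le> m^3 * t" "3 * m^2 * (m+1) * C \<le> 3 * m^2 * (m+1) * t"
      "3 * m * (m+1)^2 * B \<le> 3 * m * (m+1)^2 * t" "(m+1)^3 * A \<le> (m+1)^3 * t"
      using r n by (auto intro!: mult_left_mono simp del: zero_le_power_eq)
    moreover have "0 \<le> m^3 * D" "0 \<le> 3 * m^2 * (m+1) * C" "0 \<le> 3 * m * (m+1)^2 * B" "0 \<le> (m+1)^3 * A"
      using r n by (auto intro!: mult_nonneg_nonneg)
    moreover have "t * margin ts m = m^3 * t + 3 * m^2 * (m+1) * t + 3 * m * (m+1)^2 * t + (m+1)^3 * t"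
      using Cons by (simp add: power2_eq_square power3_eq_cube algebra_simps)
    ultimately show ?thesis unfolding tilted_def A_def[symmetric] B_def[symmetric] C_def[symmetric] D_def[symmetric]
      by linarith
  qed
  then show "tilted m a b c d \<le> t * (tilted m (a div t) (b div t) (c div t) (d div t) + margin ts m)"
    and "tilted m a b c d \<ge> t * (tilted m (a div t) (b div t) (c div t) (d div t) - margin ts m)"
    unfolding lin by (simp_all add: algebra_simps abs_le_iff)
qed

type_synonym params = "int \<times> int \<times> unit list"

fun check_ints :: "params \<Rightarrow> int list \<Rightarrow> bool" where
  "check_ints (m', m, ts) ys = (0 < m \<and> m < m' \<and> all_below (margin ts m') (tilted_steps m' (tilted_steps m' (tilted_steps m' ys)))
     \<and> all_above (margin ts m) (tilted_steps m (tilted_steps m (tilted_steps m ys))))"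

fun check_block :: "params \<Rightarrow> oct list \<Rightarrow> bool" where
  "check_block (m', m, ts) xs = check_ints (m', m, ts) (ivals ts xs)"

lemma check_block_sound:
  assumes "check_block p xs" "i + 3 < length xs"
  shows "sign_changes (oval (xs ! i)) (oval (xs ! (i+1))) (oval (xs ! (i+2))) (oval (xs ! (i+3)))"
proof -
  obtain m' m ts where p: "p = (m', m, ts)" by (cases p)
  define t :: int where "t = 8 ^ length ts"
  have t: "t > 0" by (simp add: t_def)
  define ys where "ys = ivals ts xs"
  have ys: "length ys = length xs" "\<And>k. k < length xs \<Longrightarrow> ys ! k = int (oval (xs ! k)) div t"
    by (simp_all add: ys_def ivals_map t_def)
  have m: "0 < m" "m < m'" and N: "all_below (margin ts m') (tilted_steps m' (tilted_steps m' (tilted_steps m' ys)))"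
    and P: "all_above (margin ts m) (tilted_steps m (tilted_steps m (tilted_steps m ys)))"
    using assms(1) by (simp_all add: p ys_def)
  define T where "T k = tilted k (ys ! i) (ys ! (i+1)) (ys ! (i+2)) (ys ! (i+3))" for k
  have "T m' < - margin ts m'" "margin ts m < T m"
    using all_below_nth[OF N, of i] all_above_nth[OF P, of i] assms(2) ys(1) nth_tilted_steps_3[of i ys]
    by (simp_all add: length_tilted_steps T_def)
  then have "t * (T m' + margin ts m') < 0" "0 < t * (T m - margin ts m)"
    using t by (simp_all add: mult_pos_neg)
  moreover have "tilted m' (oval (xs ! i)) (oval (xs ! (i+1))) (oval (xs ! (i+2))) (oval (xs ! (i+3)))
      \<le> t * (T m' + margin ts m')"
    unfolding T_def using assms(2) ys(2) m
    using tilted_trunc_bounds(1)[of m' "oval (xs ! i)" "oval (xs ! (i+1))" "oval (xs ! (i+2))" "oval (xs ! (i+3))" ts]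
    by (simp add: t_def)
  moreover have "tilted m (oval (xs ! i)) (oval (xs ! (i+1))) (oval (xs ! (i+2))) (oval (xs ! (i+3)))
      \<ge> t * (T m - margin ts m)"
    unfolding T_def using assms(2) ys(2) m
    using tilted_trunc_bounds(2)[of m "oval (xs ! i)" "oval (xs ! (i+1))" "oval (xs ! (i+2))" "oval (xs ! (i+3))" ts]
    by (simp add: t_def)
  ultimately show ?thesis using m unfolding sign_changes_def
    by (intro exI[of _ m] exI[of _ m'] conjI) linarith+
qed

fun last3 :: "'a list \<Rightarrow> 'a list" where
  "last3 (a # b # c # d # xs) = last3 (b # c # d # xs)"
| "last3 [] = []" | "last3 [a] = [a]" | "last3 [a, b] = [a, b]" | "last3 [a, b, c] = [a, b, c]"

lemma last3_drop: "last3 xs = drop (length xs - 3) xs"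
  by (induction xs rule: last3.induct) auto

text \<open>Windows that straddle a block boundary are tested with the parameters of the later
  block, which is why the last three entries are carried over. As in the scan,
  \<open>check_next\<close> lets the enlarged block be evaluated once.\<close>

function (sequential) check_blocks :: "params list \<Rightarrow> oct list \<Rightarrow> oct list list \<Rightarrow> bool"
  and check_next :: "params list \<Rightarrow> params \<Rightarrow> oct list \<Rightarrow> oct list list \<Rightarrow> bool" where
  "check_blocks ps c [] = True"
| "check_blocks [] c (b # bs) = False"
| "check_blocks (p # ps) c (b # bs) = check_next ps p (c @ b) bs"
| "check_next ps p w bs = (check_block p w \<and> check_blocks ps (last3 w) bs)"
  by pat_completeness auto
termination by (relation "Wellfounded.measure (\<lambda>x. case x of Inl (ps, c, bs) \<Rightarrow> 2 * length bs
    | Inr (ps, p, c, bs) \<Rightarrow> 2 * length bs + 1)") auto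

lemma check_blocks_sound:
  assumes "check_blocks ps c bs" "length c \<le> 3" "i + 3 < length (c @ concat bs)"
  defines "xs \<equiv> c @ concat bs"
  shows "sign_changes (oval (xs ! i)) (oval (xs ! (i+1))) (oval (xs ! (i+2))) (oval (xs ! (i+3)))"
  using assms(1-3) unfolding xs_def
proof (induction bs arbitrary: ps c i)
  case Nil
  then show ?case by simp
next
  case (Cons b bs)
  then obtain p ps' where ps: "ps = p # ps'" by (cases ps) auto
  define w where "w = c @ b"
  have c: "check_block p w" and s: "check_blocks ps' (last3 w) bs" using Cons.prems(1) ps by (auto simp: w_def)
  have x: "c @ concat (b # bs) = w @ concat bs" by (simp add: w_def)
  show ?case
  proof (cases "i + 3 < length w")
    case True
    then show ?thesis unfolding x using check_block_sound[OF c True] by (simp add: nth_append)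
  next
    case False
    define k where "k = length w - 3"
    have w: "w = take k w @ last3 w" by (simp add: last3_drop k_def)
    have ki: "k \<le> i" using False by (simp add: k_def)
    have lk: "length (take k w) = k" by (simp add: k_def)
    have "w @ concat bs = take k w @ (last3 w @ concat bs)" using w by (metis append_assoc)
    then have nt: "(w @ concat bs) ! (i + l) = (last3 w @ concat bs) ! (i - k + l)" for l
      using lk ki by (metis Nat.add_diff_assoc2 nth_append_length_plus le_add_diff_inverse add.assoc)
    have "i - k + 3 < length (last3 w @ concat bs)"
      using Cons.prems(3) ki unfolding x by (simp add: last3_drop k_def)
    from Cons.IH[OF s _ this] have "sign_changes (oval ((last3 w @ concat bs) ! (i - k)))
       (oval ((last3 w @ concat bs) ! (i - k + 1))) (oval ((last3 w @ concat bs) ! (i - k + 2)))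
       (oval ((last3 w @ concat bs) ! (i - k + 3)))" by (simp add: last3_drop)
    then show ?thesis unfolding x nt[symmetric] using nt[of 0] by simp
  qed
qed

fun check_from :: "unit list \<Rightarrow> params list \<Rightarrow> oct list list \<Rightarrow> bool" where
  "check_from ts ps [] = False"
| "check_from ts ps (b # bs) = check_blocks ps [] (drop_like ts b # bs)"

lemma replicate_numeral_rule: "replicate (numeral k) x = x # replicate (pred_numeral k) x"
  by (simp add: numeral_eq_Suc)

lemma replicate_1: "replicate 1 x = [x]"
  by simp

lemma partition_rows_numeral:
  "partition_rows (numeral k # js) bs = partition_rows js ((D1 Nil8 # replicate (pred_numeral k) Nil8)
     # scan_blocks (replicate (numeral k) Nil8)
         (reblock [replicate (pred_numeral k) ()] (replicate (numeral k) ()) [] [] bs))"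
  by (simp add: numeral_eq_Suc)

lemmas list_rules = add_lists.simps scan_blocks.simps scan_next.simps take_like.simps drop_like.simps reblock.simps reblock_next.simps
  partition_rows.simps(1) partition_rows_numeral prefix_sums.simps last_or.simps prefix_sum_blocks.simps append.simps
  replicate_numeral_rule replicate_1 replicate_0 pred_numeral_simps BitM.simps

lemmas check_rules = tilted_steps.simps all_below.simps all_above.simps trunc.simps high_digits.simps ival_rules ivals.simps
  margin.simps check_ints.simps check_block.simps last3.simps check_blocks.simps check_next.simps check_from.simps

text \<open>Starting from 52 coefficients, the rows 99, ..., 2 produce 52 + 4949 = 5001 entries,
  that is q 1, ..., q 5001. Dropping 119 of them makes q 120 the first, as n = 121 requires; the 3
  entries left of the first block contain no window, so its parameters test nothing. Each further
  triple (m', m, digits dropped) serves all n of one block. The blocks near n = 121 are short, and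
  the number of dropped digits follows the growth of q.\<close>

lemma check_eq_True:
  "check_from (replicate 119 ())
    [(2, 1, []), (17, 10, []), (16, 10, []), (17, 12, []),
     (21, 15, [()]), (24, 18, replicate 4 ()), (28, 21, replicate 6 ()), (30, 23, replicate 8 ()),
     (33, 26, replicate 10 ()), (35, 28, replicate 12 ()), (38, 30, replicate 13 ()), (40, 32, replicate 15 ()),
     (42, 34, replicate 16 ()), (44, 35, replicate 18 ()), (45, 37, replicate 19 ()), (47, 38, replicate 20 ()),
     (49, 40, replicate 21 ()), (50, 41, replicate 23 ()), (52, 43, replicate 24 ()), (53, 44, replicate 25 ()),
     (55, 45, replicate 26 ()), (56, 47, replicate 27 ()), (58, 48, replicate 28 ()), (59, 49, replicate 29 ()),
     (60, 50, replicate 30 ()), (62, 52, replicate 31 ()), (63, 53, replicate 32 ()), (64, 54, replicate 33 ()),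
     (65, 55, replicate 34 ()), (67, 56, replicate 35 ()), (68, 57, replicate 35 ()), (69, 58, replicate 36 ()),
     (70, 59, replicate 37 ()), (71, 60, replicate 38 ()), (72, 61, replicate 39 ()), (73, 62, replicate 40 ()),
     (74, 63, replicate 40 ()), (75, 64, replicate 41 ()), (76, 65, replicate 42 ()), (77, 66, replicate 43 ()),
     (78, 67, replicate 43 ()), (79, 68, replicate 44 ()), (80, 69, replicate 45 ()), (81, 70, replicate 46 ()),
     (82, 70, replicate 46 ())]
    (prefix_sum_blocks Nil8 (reblock
      [replicate 2 (), replicate 3 (), replicate 48 (), replicate 101 (),
     replicate 119 (), replicate 119 (), replicate 119 (), replicate 119 (),
     replicate 119 (), replicate 119 (), replicate 119 (), replicate 119 (),
     replicate 119 (), replicate 119 (), replicate 119 (), replicate 119 (),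
     replicate 119 (), replicate 119 (), replicate 119 (), replicate 119 (),
     replicate 119 (), replicate 119 (), replicate 119 (), replicate 119 (),
     replicate 119 (), replicate 119 (), replicate 119 (), replicate 119 (),
     replicate 119 (), replicate 119 (), replicate 119 (), replicate 119 (),
     replicate 119 (), replicate 119 (), replicate 119 (), replicate 119 (),
     replicate 119 (), replicate 119 (), replicate 119 (), replicate 119 (),
     replicate 119 (), replicate 119 (), replicate 119 (), replicate 40 ()]
      (replicate 122 ()) [] [] (partition_rows [99, 98, 97, 96, 95, 94, 93, 92, 91, 90, 89, 88, 87, 86, 85, 84, 83, 82, 81, 80,
     79, 78, 77, 76, 75, 74, 73, 72, 71, 70, 69, 68, 67, 66, 65, 64, 63, 62, 61, 60,
     59, 58, 57, 56, 55, 54, 53, 52, 51, 50, 49, 48, 47, 46, 45, 44, 43, 42, 41, 40,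
     39, 38, 37, 36, 35, 34, 33, 32, 31, 30, 29, 28, 27, 26, 25, 24, 23, 22, 21, 20,
     19, 18, 17, 16, 15, 14, 13, 12, 11, 10, 9, 8, 7, 6, 5, 4, 3, 2] [D1 Nil8 # replicate 51 Nil8]))) = True"
  by (simp only: list_rules check_rules ad_rules ad_Nil8_rules inc.simps arith_simps rel_simps simp_thms
      add_0_left add_0_right mult_zero_left mult_zero_right if_True if_False Num.arith_special
      mult_1 mult_1_right list.simps neg_equal_0_iff_equal neg_less_0_iff_less minus_zero numeral_One)

lemma sign_changes_from_check:
  assumes "check_from ts ps (prefix_sum_blocks Nil8 (reblock Ts us [] [] (partition_rows (rev [2..<Suc K]) [D1 Nil8 # replicate l Nil8])))"
    and "l + sum_list (rev [2..<Suc K]) = L" "1 \<le> K" "2 * Suc L < Suc K * (K + 2)"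
    and n: "length ts + 2 \<le> n" "n < L"
  shows "sign_changes (q (n - 1)) (q n) (q (n + 1)) (q (n + 2))"
proof -
  define B where "B = partition_rows (rev [2..<Suc K]) [D1 Nil8 # replicate l Nil8]"
  define S where "S = prefix_sum_blocks Nil8 (reblock Ts us [] [] B)"
  have "agrees (concat [D1 Nil8 # replicate l Nil8]) 1"
    by (auto simp: agrees_def nth_Cons split: nat.split)
  moreover have "parts_fps K * 1 = (\<Sum>i=K..K. parts_fps i)" by simp
  moreover have "rev [2..<Suc K] = rev [1+1..<Suc K]" by (simp add: numeral_2_eq_2)
  ultimately obtain G where G: "agrees (concat B) G" "parts_fps 1 * G = (\<Sum>i=1..K. parts_fps i)"
    and lB: "length (concat B) = length (concat [D1 Nil8 # replicate l Nil8]) + sum_list (rev [2..<Suc K])"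
    unfolding B_def using agrees_partition_rows[OF _ assms(3)] by blast
  have L: "length (concat B) = Suc L" using lB assms(2) by simp
  have cS: "concat S = prefix_sums Nil8 (concat B)" by (simp add: S_def concat_prefix_sum_blocks concat_reblock)
  have lS: "length (concat S) = Suc L" by (simp add: cS length_prefix_sums L)
  have qS: "oval (concat S ! i) = q (i + 1)" if "i < Suc L" for i
    unfolding cS using G that L assms(4) by (intro nth_prefix_sums_eq_q) auto
  from assms(1) obtain b bs where S: "S = b # bs" and sg: "check_blocks ps [] (drop_like ts b # bs)"
    unfolding S_def B_def by (metis check_from.elims(2))
  define k where "k = length (take (length ts) b)"
  have k: "k \<le> length ts" by (simp add: k_def)
  have split: "concat S = take (length ts) b @ (drop_like ts b @ concat bs)" by (simp add: S drop_like_eq)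
  have nth: "(drop_like ts b @ concat bs) ! i = concat S ! (k + i)" for i
    unfolding split k_def by (rule nth_append_length_plus[symmetric])
  have c0: "[] @ concat (drop_like ts b # bs) = drop_like ts b @ concat bs" by simp
  have len: "k + length (drop_like ts b @ concat bs) = Suc L" using lS unfolding split k_def by simp
  define i where "i = n - 2 - k"
  have i: "k + i = n - 2" "i + 3 < length (drop_like ts b @ concat bs)" using n k len by (auto simp: i_def)
  have "k + i + 1 = n - 1" "k + (i + 1) + 1 = n" "k + (i + 2) + 1 = n + 1" "k + (i + 3) + 1 = n + 2"
    using i n by auto
  then show ?thesis
    using check_blocks_sound[OF sg _ i(2)[folded c0]] unfolding c0 nth using qS[of "k + i"] qS[of "k + (i + 1)"] qS[of "k + (i + 2)"] qS[of "k + (i + 3)"] n i(1)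
    by simp
qed

lemma small_n_sign_changes:
  assumes "121 \<le> n" "n < 5000"
  shows "sign_changes (q (n - 1)) (q n) (q (n + 1)) (q (n + 2))"
proof -
  have js: "rev [2..<Suc 99] = [99, 98, 97, 96, 95, 94, 93, 92, 91, 90, 89, 88, 87, 86, 85, 84, 83, 82, 81, 80,
     79, 78, 77, 76, 75, 74, 73, 72, 71, 70, 69, 68, 67, 66, 65, 64, 63, 62, 61, 60,
     59, 58, 57, 56, 55, 54, 53, 52, 51, 50, 49, 48, 47, 46, 45, 44, 43, 42, 41, 40,
     39, 38, 37, 36, 35, 34, 33, 32, 31, 30, 29, 28, 27, 26, 25, 24, 23, 22, 21, 20,
     19, 18, 17, 16, 15, 14, 13, 12, 11, 10, 9, 8, 7, 6, 5, 4, 3, 2]"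
    by (simp add: upt_rec)
  show ?thesis
    using assms
    \<comment> \<open>99 parts suffice because 2 * 5001 < 100 * 101.\<close>
    by (intro sign_changes_from_check[where K = 99 and l = 51 and L = 5000, unfolded js, OF check_eq_True[THEN iffD2[OF _ TrueI]]]) auto
qed

section \<open>Characteristic functions of Bernoulli variables\<close>

definition fermi :: "real \<Rightarrow> real" where "fermi x = exp (- x) / (1 + exp (- x))"
definition fvar :: "real \<Rightarrow> real" where "fvar x = exp (- x) / (1 + exp (- x))^2"
definition fskew :: "real \<Rightarrow> real" where "fskew x = exp (- x) * (1 - exp (- x)) / (1 + exp (- x))^3"

text \<open>For a Bernoulli variable with odds exp (- x), \<open>fermi x\<close> is the success
  probability, \<open>fvar x\<close> the variance and \<open>fskew x\<close> the third central
  moment. \<open>cfun x\<close> is its characteristic function, centred by the last factor.\<close>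

definition cfun :: "real \<Rightarrow> real \<Rightarrow> complex" where
  "cfun x \<alpha> = (1 + of_real (exp (- x)) * cis \<alpha>) / (1 + of_real (exp (- x))) * cis (- (fermi x * \<alpha>))"

lemma one_plus_exp_nonzero: "1 + exp x \<noteq> (0 :: real)"
  by (metis add_pos_pos exp_gt_zero less_numeral_extra(1) less_numeral_extra(3))

lemma fvar_fermi: "fvar x = fermi x * (1 - fermi x)"
proof -
  show ?thesis
    using one_plus_exp_nonzero[of "- x"] by (simp add: fvar_def fermi_def field_simps power2_eq_square)
qed

lemma fskew_fermi: "fskew x = fermi x * (1 - fermi x) * ((1 - fermi x)^2 - (fermi x)^2)"
proof -
  define e where "e = exp (-x)"
  have e: "1 + e \<noteq> 0" unfolding e_def by (rule one_plus_exp_nonzero)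
  have 1: "1 - e / (1 + e) = 1 / (1 + e)" using e by (simp add: field_simps)
  have "(1 / (1 + e))^2 - (e / (1 + e))^2 = (1 - e) * (1 + e) / (1 + e)^2"
    by (simp add: power_divide diff_divide_distrib[symmetric]) (simp add: power2_eq_square algebra_simps)
  also have "\<dots> = (1 - e) / (1 + e)" using e by (simp add: power2_eq_square)
  finally show ?thesis
    unfolding fskew_def fermi_def e_def[symmetric] 1 by (simp add: power3_eq_cube)
qed

lemma fermi_bounds: "0 < fermi x" "fermi x < 1"
  by (simp_all add: fermi_def add_pos_pos)

lemma fvar_nonneg: "0 \<le> fvar x"
  by (simp add: fvar_def)

text \<open>The squared modulus equals 1 - 2 * fvar x * (1 - cos \<alpha>) exactly; then 1 + y \<le>
  exp y.\<close>

lemma cmod_cfun_le: "cmod (cfun x \<alpha>) \<le> exp (- (fvar x * (1 - cos \<alpha>)))"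
proof -
  define e where "e = exp (-x)"
  have e: "e > 0" by (simp add: e_def)
  have "(cmod (1 + of_real e * cis \<alpha>))^2 = (1 + e * cos \<alpha>)^2 + (e * sin \<alpha>)^2"
    by (simp add: cmod_power2)
  also have "\<dots> = 1 + 2 * e * cos \<alpha> + e^2 * ((cos \<alpha>)^2 + (sin \<alpha>)^2)"
    by (simp only: power2_eq_square) algebra
  also have "\<dots> = 1 + 2 * e * cos \<alpha> + e^2" by simp
  also have "\<dots> = (1 + e)^2 * (1 - 2 * (e / (1 + e)^2) * (1 - cos \<alpha>))"
  proof -
    have "A * (1 - 2 * B * C) = A - 2 * (A * B) * C" for A B C :: real by (simp add: algebra_simps)
    note gen = this[of "(1 + e)^2" "e / (1 + e)^2" "1 - cos \<alpha>"]
    have "(1 + e)^2 * (e / (1 + e)^2) = e" using e by simp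
    then have "(1 + e)^2 * (1 - 2 * (e / (1 + e)^2) * (1 - cos \<alpha>)) = (1 + e)^2 - 2 * e * (1 - cos \<alpha>)"
      using gen by (simp only:)
    then show ?thesis by (simp add: power2_eq_square algebra_simps)
  qed
  finally have 1: "(cmod (1 + of_real e * cis \<alpha>))^2 = (1 + e)^2 * (1 - 2 * fvar x * (1 - cos \<alpha>))"
    by (simp add: fvar_def e_def)
  have n: "cmod (1 + complex_of_real e) = 1 + e"
    using e by (metis abs_of_pos add_pos_pos norm_of_real of_real_1 of_real_add zero_less_one)
  have "(cmod (cfun x \<alpha>))^2 = (cmod (1 + of_real e * cis \<alpha>))^2 / (1 + e)^2"
    using n by (simp add: cfun_def norm_mult norm_divide e_def power_divide)
  also have "\<dots> = 1 - 2 * fvar x * (1 - cos \<alpha>)"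
    unfolding 1 using e by simp
  also have "\<dots> \<le> exp (- (2 * fvar x * (1 - cos \<alpha>)))"
    using exp_ge_add_one_self[of "- (2 * fvar x * (1 - cos \<alpha>))"] by simp
  also have "\<dots> = (exp (- (fvar x * (1 - cos \<alpha>))))^2"
    by (simp add: power2_eq_square exp_add[symmetric])
  finally show ?thesis by (rule power2_le_imp_le) simp
qed

text \<open>With p = \<open>fermi x\<close> and q = 1 - p, both exponentials are expanded to third
  order. Centring removes the linear term, and the remainder carries the fourth central moment q *
  p^4 + p * q^4 = p * q * (1 - 3 * p * q).\<close>

lemma cfun_moments:
  "cmod (cfun x \<alpha> - (1 - of_real (fvar x * \<alpha>^2 / 2) - \<i> * of_real (fskew x * \<alpha>^3 / 6)))
    \<le> fvar x * (1 - 3 * fvar x) * \<alpha>^4 / 24"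
proof -
  define p where "p = fermi x"
  define q where "q = 1 - p"
  have pq: "p > 0" "q > 0" using fermi_bounds by (auto simp: p_def q_def)
  define T where "T y = (\<Sum>k\<le>3. (\<i> * of_real y)^k / fact k)" for y :: real
  have T: "T y = 1 + \<i> * y - y^2 / 2 - \<i> * y^3 / 6" for y
    by (simp add: T_def eval_nat_numeral power_mult_distrib algebra_simps fact_numeral)
  have R: "cmod (cis y - T y) \<le> \<bar>y\<bar>^4 / 24" for y
    using iexp_approx1[of y 3] by (simp add: T_def cis_conv_exp fact_numeral eval_nat_numeral)
  have c: "cfun x \<alpha> = of_real q * cis (- (p * \<alpha>)) + of_real p * cis (q * \<alpha>)"
  proof -
    have e: "1 + exp (-x) \<noteq> 0" by (rule one_plus_exp_nonzero)
    have q: "q = 1 / (1 + exp (-x))" using e by (simp add: q_def p_def fermi_def field_simps)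
    have "(1 + complex_of_real (exp (- x)) * cis \<alpha>) / (1 + of_real (exp (- x))) = of_real q + of_real p * cis \<alpha>"
      by (simp add: q p_def fermi_def add_divide_distrib)
    then have "cfun x \<alpha> = of_real q * cis (- (p * \<alpha>)) + of_real p * (cis \<alpha> * cis (- (p * \<alpha>)))"
      by (simp add: cfun_def p_def algebra_simps)
    also have "cis \<alpha> * cis (- (p * \<alpha>)) = cis (q * \<alpha>)"
      by (simp add: cis_mult q_def algebra_simps)
    finally show ?thesis .
  qed
  have v: "fvar x = p * q" by (simp add: fvar_fermi p_def q_def)
  have k: "fskew x = p * q * (q^2 - p^2)" by (simp add: fskew_fermi p_def q_def)
  have q1: "q = 1 - p" by (simp add: q_def)
  have "of_real q * T (- (p * \<alpha>)) + of_real p * T (q * \<alpha>)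
      = 1 - of_real (fvar x * \<alpha>^2 / 2) - \<i> * of_real (fskew x * \<alpha>^3 / 6)"
    unfolding T v k q1 by (simp add: field_simps power2_eq_square power3_eq_cube)
  then have "cfun x \<alpha> - (1 - of_real (fvar x * \<alpha>^2 / 2) - \<i> * of_real (fskew x * \<alpha>^3 / 6))
      = of_real q * (cis (- (p * \<alpha>)) - T (- (p * \<alpha>))) + of_real p * (cis (q * \<alpha>) - T (q * \<alpha>))"
    unfolding c by (simp add: algebra_simps)
  also have "cmod \<dots> \<le> q * (\<bar>- (p * \<alpha>)\<bar>^4 / 24) + p * (\<bar>q * \<alpha>\<bar>^4 / 24)"
    using R[of "- (p * \<alpha>)"] R[of "q * \<alpha>"] pq
    by (intro order_trans[OF norm_triangle_ineq] add_mono) (simp_all add: norm_mult)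
  also have "\<dots> = (q * p^4 + p * q^4) * \<alpha>^4 / 24"
    by (simp add: power_mult_distrib field_simps power_even_abs)
  also have "q * p^4 + p * q^4 = fvar x * (1 - 3 * fvar x)"
    unfolding v q1 by (simp add: eval_nat_numeral algebra_simps)
  finally show ?thesis .
qed

text \<open>The skewness enters as a phase in the exponent: products of such factors keep this form,
  and their modulus is purely Gaussian.\<close>

definition gfun :: "real \<Rightarrow> real \<Rightarrow> complex" where
  "gfun x \<alpha> = exp (- (of_real (fvar x * \<alpha>^2 / 2) + \<i> * of_real (fskew x * \<alpha>^3 / 6)))"

lemma fskew_abs_le: "0 \<le> x \<Longrightarrow> \<bar>fskew x\<bar> \<le> fvar x"
proof -
  assume x: "0 \<le> x"
  define e where "e = exp (-x)"
  have e: "0 < e" "e \<le> 1" using x by (auto simp: e_def)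
  have "fskew x = fvar x * ((1 - e) / (1 + e))"
    by (simp add: fskew_def fvar_def e_def power2_eq_square power3_eq_cube)
  moreover have "\<bar>(1 - e) / (1 + e)\<bar> \<le> 1" using e by (auto simp: field_simps)
  ultimately show ?thesis using fvar_nonneg[of x] by (simp only: abs_mult abs_of_nonneg mult_left_le)
qed

lemma cmod_exp_minus_1_le:
  fixes X :: complex
  assumes "Re X \<ge> 0"
  shows "cmod (exp (- X) - 1) \<le> cmod X"
proof -
  have "cmod (exp (- (of_real 1 * X)) - exp (- (of_real 0 * X))) \<le> cmod X * 1 - cmod X * 0"
  proof (rule differentiable_bound_general)
    fix t :: real assume t: "0 < t" "t < 1"
    show "((\<lambda>t. exp (- (of_real t * X))) has_vector_derivative (- X * exp (- (of_real t * X)))) (at t)"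
      by (rule has_vector_derivative_real_field) (auto intro!: derivative_eq_intros)
    show "((\<lambda>t. cmod X * t) has_vector_derivative (cmod X)) (at t)"
      by (auto intro!: derivative_eq_intros simp: has_vector_derivative_def)
    show "cmod (- X * exp (- (of_real t * X))) \<le> cmod X"
      using assms t by (simp add: norm_mult mult_left_le)
  qed (auto intro!: continuous_intros)
  then show ?thesis by simp
qed

lemma cmod_exp_minus_Taylor_le:
  fixes X :: complex
  assumes "Re X \<ge> 0"
  shows "cmod (exp (- X) - 1 + X) \<le> (cmod X)^2 / 2"
proof -
  let ?f = "\<lambda>t::real. exp (- (of_real t * X)) + of_real t * X"
  let ?g = "\<lambda>t::real. (cmod X)^2 / 2 * t^2"
  have "cmod (?f 1 - ?f 0) \<le> ?g 1 - ?g 0"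
  proof (rule differentiable_bound_general)
    fix t :: real assume t: "0 < t" "t < 1"
    show "(?f has_vector_derivative (- X * exp (- (of_real t * X)) + X)) (at t)"
      by (rule has_vector_derivative_real_field) (auto intro!: derivative_eq_intros)
    show "(?g has_vector_derivative ((cmod X)^2 * t)) (at t)"
      by (auto intro!: derivative_eq_intros simp: has_vector_derivative_def)
    have "- X * exp (- (of_real t * X)) + X = - X * (exp (- (of_real t * X)) - 1)"
      by (simp add: algebra_simps)
    also have "cmod \<dots> = cmod X * cmod (exp (- (of_real t * X)) - 1)" by (simp add: norm_mult)
    also have "\<dots> \<le> cmod X * cmod (of_real t * X)"
      using assms t by (intro mult_left_mono cmod_exp_minus_1_le) auto
    finally show "cmod (- X * exp (- (of_real t * X)) + X) \<le> (cmod X)^2 * t"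
      using t by (simp add: norm_mult power2_eq_square mult_ac)
  qed (auto intro!: continuous_intros)
  then show ?thesis by (simp add: algebra_simps)
qed

text \<open>The variance part of (cmod X)^2 / 2 is v^2 * \<alpha>^4 / 8, which is exactly
  compensated by the negative term - 3 * v^2 * \<alpha>^4 / 24 in \<open>cfun_moments\<close>. Only
  the skewness part adds to v * \<alpha>^4 / 24, and it accounts for \<tau> / 3.\<close>

lemma cmod_cfun_gfun:
  assumes x: "0 \<le> x" and t: "fvar x * \<alpha>^2 \<le> \<tau>"
  shows "cmod (cfun x \<alpha> - gfun x \<alpha>) \<le> fvar x * \<alpha>^4 / 24 * (1 + \<tau> / 3)"
proof -
  define X where "X = complex_of_real (fvar x * \<alpha>^2 / 2) + \<i> * of_real (fskew x * \<alpha>^3 / 6)"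
  define v where "v = fvar x"
  have v: "0 \<le> v" using fvar_nonneg by (auto simp: v_def)
  have "Re X \<ge> 0" using v by (simp add: X_def v_def)
  then have 1: "cmod (exp (- X) - 1 + X) \<le> (cmod X)^2 / 2" by (rule cmod_exp_minus_Taylor_le)
  have 3: "(cmod X)^2 = v^2 * \<alpha>^4 / 4 + (fskew x)^2 * \<alpha>^6 / 36"
    by (simp add: X_def v_def cmod_power2 power_mult_distrib power_divide flip: power_mult)
  have "(fskew x)^2 \<le> v^2"
    using fskew_abs_le[OF x] v by (simp add: v_def abs_le_square_iff[symmetric])
  then have "(fskew x)^2 * \<alpha>^6 \<le> v^2 * \<alpha>^6" by (intro mult_right_mono) auto
  also have "\<dots> = v * \<alpha>^4 * (v * \<alpha>^2)" by (simp add: eval_nat_numeral)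
  also have "\<dots> \<le> v * \<alpha>^4 * \<tau>" using t v by (intro mult_left_mono) (auto simp: v_def)
  finally have 4: "(fskew x)^2 * \<alpha>^6 \<le> v * \<alpha>^4 * \<tau>" .
  have "cfun x \<alpha> - gfun x \<alpha> = (cfun x \<alpha> - (1 - X)) - (exp (- X) - 1 + X)"
    by (simp add: gfun_def X_def)
  also have "cmod \<dots> \<le> cmod (cfun x \<alpha> - (1 - X)) + cmod (exp (- X) - 1 + X)"
    by (rule norm_triangle_ineq4)
  also have "\<dots> \<le> v * (1 - 3 * v) * \<alpha>^4 / 24 + (cmod X)^2 / 2"
    using cfun_moments[of x \<alpha>] 1 by (intro add_mono) (auto simp: X_def v_def algebra_simps)
  also have "\<dots> \<le> v * \<alpha>^4 / 24 * (1 + \<tau> / 3)"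
    unfolding 3 using 4 by (simp add: field_simps power2_eq_square)
  finally show ?thesis by (simp add: v_def)
qed

text \<open>Factors are exchanged one at a time. Each exchange keeps the decay of all other factors,
  and \<open>exp (h i)\<close> pays for the missing one.\<close>

lemma norm_prod_diff_le:
  fixes z w :: "'i \<Rightarrow> 'a::{real_normed_field}"
  assumes "finite I" "\<And>i. i \<in> I \<Longrightarrow> norm (z i) \<le> exp (- h i)" "\<And>i. i \<in> I \<Longrightarrow> norm (w i) \<le> exp (- h i)"
  shows "norm ((\<Prod>i\<in>I. z i) - (\<Prod>i\<in>I. w i)) \<le> exp (- (\<Sum>i\<in>I. h i)) * (\<Sum>i\<in>I. norm (z i - w i) * exp (h i))"
  using assms
proof (induction I rule: finite_induct)
  case empty
  then show ?case by simp
next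
  case (insert j I)
  let ?Z = "\<Prod>i\<in>I. z i" and ?W = "\<Prod>i\<in>I. w i" and ?H = "\<Sum>i\<in>I. h i"
  have W: "norm ?W \<le> exp (- ?H)"
  proof -
    have "norm ?W = (\<Prod>i\<in>I. norm (w i))" by (simp add: prod_norm)
    also have "\<dots> \<le> (\<Prod>i\<in>I. exp (- h i))" using insert.prems by (intro prod_mono) auto
    also have "\<dots> = exp (- ?H)" using insert.hyps by (simp add: exp_sum sum_negf[symmetric])
    finally show ?thesis .
  qed
  have "(\<Prod>i\<in>insert j I. z i) - (\<Prod>i\<in>insert j I. w i) = z j * (?Z - ?W) + (z j - w j) * ?W"
    using insert.hyps by (simp add: algebra_simps)
  also have "norm \<dots> \<le> norm (z j) * norm (?Z - ?W) + norm (z j - w j) * norm ?W"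
    by (metis norm_mult norm_triangle_ineq)
  also have "\<dots> \<le> exp (- h j) * (exp (- ?H) * (\<Sum>i\<in>I. norm (z i - w i) * exp (h i))) + norm (z j - w j) * exp (- ?H)"
    using insert W by (intro add_mono mult_mono) (auto intro!: mult_nonneg_nonneg sum_nonneg)
  also have "\<dots> = exp (- (\<Sum>i\<in>insert j I. h i)) * (\<Sum>i\<in>insert j I. norm (z i - w i) * exp (h i))"
  proof -
    have "exp (- (\<Sum>i\<in>insert j I. h i)) = exp (- h j) * exp (- ?H)"
      using insert.hyps by (simp add: mult_exp_exp)
    moreover have "exp (- h j) * exp (h j) = 1" by (simp add: mult_exp_exp)
    moreover have "(\<Sum>i\<in>insert j I. norm (z i - w i) * exp (h i))
        = norm (z j - w j) * exp (h j) + (\<Sum>i\<in>I. norm (z i - w i) * exp (h i))"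
      using insert.hyps by simp
    ultimately show ?thesis by algebra
  qed
  finally show ?case .
qed

section \<open>Minor arcs: Abel summation against the Dirichlet kernel\<close>

lemma abel_sum_nonneg:
  fixes v d :: "nat \<Rightarrow> real"
  assumes v: "\<And>j. 0 \<le> v j" "\<And>j. 1 \<le> j \<Longrightarrow> v (Suc j) \<le> v j"
    and d: "\<And>J. 0 \<le> (\<Sum>j=1..J. d j)"
  shows "0 \<le> (\<Sum>j=1..N. v j * d j)"
proof -
  have "v N * (\<Sum>j=1..N. d j) \<le> (\<Sum>j=1..N. v j * d j)"
  proof (induction N)
    case (Suc N)
    show ?case
    proof (cases "N = 0")
      case False
      then have "v (Suc N) * (\<Sum>j=1..N. d j) \<le> v N * (\<Sum>j=1..N. d j)"
        using v d by (intro mult_right_mono) auto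
      then show ?thesis using Suc by (simp add: algebra_simps)
    qed simp
  qed simp
  then show ?thesis using v(1)[of N] d[of N] by (meson mult_nonneg_nonneg order_trans)
qed

lemma sum_cos_le:
  assumes "0 < \<theta>" "\<theta> \<le> pi"
  shows "(\<Sum>j=1..J. cos (real j * \<theta>)) \<le> 1 / (2 * sin (\<theta> / 2)) - 1 / 2"
proof -
  have s: "sin (\<theta> / 2) > 0" using assms by (intro sin_gt_zero) auto
  have "2 * sin (\<theta> / 2) * (\<Sum>j=1..J. cos (real j * \<theta>)) = sin ((real J + 1/2) * \<theta>) - sin (\<theta> / 2)"
  proof (induction J)
    case (Suc J)
    have "2 * sin (\<theta> / 2) * cos (real (Suc J) * \<theta>)
        = sin (real (Suc J) * \<theta> + \<theta> / 2) - sin (real (Suc J) * \<theta> - \<theta> / 2)"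
      by (simp add: sin_add sin_diff)
    also have "real (Suc J) * \<theta> + \<theta> / 2 = (real (Suc J) + 1/2) * \<theta>" by (simp add: algebra_simps)
    also have "real (Suc J) * \<theta> - \<theta> / 2 = (real J + 1/2) * \<theta>" by (simp add: algebra_simps)
    finally show ?case using Suc by (simp add: distrib_left)
  qed simp
  also have "\<dots> \<le> 1 - sin (\<theta> / 2)" by simp
  finally show ?thesis using s by (simp add: field_simps)
qed

text \<open>Partial sums of the cosines are at most J trivially and at most K by the Dirichlet
  kernel. Hence (1 for j \<le> K, else 0) - cos (j * \<theta>) has nonnegative partial sums, and
  decreasing weights preserve this.\<close>

lemma minor_arc_sum:
  fixes v :: "nat \<Rightarrow> real"
  assumes v: "\<And>j. 0 \<le> v j" "\<And>j. 1 \<le> j \<Longrightarrow> v (Suc j) \<le> v j"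
    and t: "0 < \<theta>" "\<theta> \<le> pi" and K: "1 / (2 * sin (\<theta> / 2)) - 1 / 2 \<le> real K"
  shows "(\<Sum>j=1..N. if K < j then v j else 0) \<le> (\<Sum>j=1..N. v j * (1 - cos (real j * \<theta>)))"
proof -
  define d where "d j = (if j \<le> K then 1 else 0) - cos (real j * \<theta>)" for j
  have "0 \<le> (\<Sum>j=1..N. v j * d j)"
  proof (rule abel_sum_nonneg)
    show "0 \<le> v j" "1 \<le> j \<Longrightarrow> v (Suc j) \<le> v j" for j using v by auto
    fix J
    have "(\<Sum>j=1..J. if j \<le> K then 1 else 0 :: real) = real (card {j \<in> {1..J}. j \<le> K})"
      by (simp add: sum.If_cases Int_def)
    also have "{j \<in> {1..J}. j \<le> K} = {1..min J K}" by auto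
    finally have 1: "(\<Sum>j=1..J. if j \<le> K then 1 else 0 :: real) = real (min J K)" by simp
    have "(\<Sum>j=1..J. cos (real j * \<theta>)) \<le> (\<Sum>j=1..J. 1)" by (intro sum_mono) simp
    then have "(\<Sum>j=1..J. cos (real j * \<theta>)) \<le> real J" by simp
    moreover have "(\<Sum>j=1..J. cos (real j * \<theta>)) \<le> real K"
      using sum_cos_le[OF t, of J] K by linarith
    ultimately show "0 \<le> (\<Sum>j=1..J. d j)"
      unfolding d_def sum_subtractf 1 by simp
  qed
  also have "(\<Sum>j=1..N. v j * d j)
      = (\<Sum>j=1..N. v j * (1 - cos (real j * \<theta>))) - (\<Sum>j=1..N. if K < j then v j else 0)"
    unfolding sum_subtractf[symmetric] d_def by (intro sum.cong refl) (auto simp: algebra_simps)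
  finally show ?thesis by simp
qed

lemma has_real_derivative_fermi: "(fermi has_real_derivative - fvar x) (at x)"
proof -
  have "1 + exp (- x) \<noteq> 0" by (rule one_plus_exp_nonzero)
  then show ?thesis unfolding fermi_def[abs_def] fvar_def
    by (auto intro!: derivative_eq_intros simp: field_simps power2_eq_square)
qed

lemma fermi_antimono: "x \<le> y \<Longrightarrow> fermi y \<le> fermi x"
proof -
  have f: "fermi x = 1 / (1 + exp x)" for x
    by (simp add: fermi_def exp_minus field_simps add_pos_pos add.commute)
  show "x \<le> y \<Longrightarrow> fermi y \<le> fermi x" unfolding f
    by (intro divide_left_mono) (auto intro!: mult_pos_pos add_pos_pos)
qed

lemma fermi_conv: "fermi x = 1 / (1 + exp x)"
  by (simp add: fermi_def exp_minus field_simps add_pos_pos add.commute)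

lemma fvar_antimono: "0 \<le> x \<Longrightarrow> x \<le> y \<Longrightarrow> fvar y \<le> fvar x"
proof -
  assume a: "0 \<le> x" "x \<le> y"
  have "fermi x \<le> fermi 0" "fermi y \<le> fermi x" using a by (auto intro: fermi_antimono)
  moreover have "fermi 0 = 1 / 2" by (simp add: fermi_def)
  ultimately have "0 \<le> (fermi x - fermi y) * (1 - fermi x - fermi y)"
    by (intro mult_nonneg_nonneg) linarith+
  then show ?thesis by (simp add: fvar_fermi algebra_simps)
qed

lemma fvar_ge_diff:
  assumes "0 \<le> x" "0 < s"
  shows "(fermi x - fermi (x + s)) / s \<le> fvar x"
proof -
  obtain z where z: "x < z" "fermi (x + s) - fermi x = (x + s - x) * (- fvar z)"
    using MVT2[of x "x + s" fermi "\<lambda>x. - fvar x"] has_real_derivative_fermi assms(2) by auto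
  have "s * fvar z \<le> s * fvar x" using z(1) assms by (intro mult_left_mono fvar_antimono) auto
  then have "fermi x - fermi (x + s) \<le> s * fvar x" using z(2) by simp
  then show ?thesis using assms(2) by (simp add: pos_divide_le_eq mult.commute)
qed

text \<open>\<open>fvar\<close> is minus the derivative of \<open>fermi\<close> and decreasing on
  the half-line, so the sum dominates its integral, which telescopes.\<close>

lemma fvar_tail_sum:
  assumes "0 < s" "K \<le> N"
  shows "(fermi ((real K + 1) * s) - fermi ((real N + 1) * s)) / s
    \<le> (\<Sum>j=1..N. if K < j then fvar (real j * s) else 0)"
  using assms(2)
proof (induction N rule: dec_induct)
  case base
  then show ?case by simp
next
  case (step N)
  have "(fermi ((real N + 1) * s) - fermi ((real N + 1) * s + s)) / s \<le> fvar ((real N + 1) * s)"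
    using assms(1) by (intro fvar_ge_diff) auto
  moreover have "(real N + 1) * s + s = (real (Suc N) + 1) * s" by (simp add: algebra_simps)
  ultimately show ?case using step by (simp add: diff_divide_distrib add.commute)
qed

lemma cos_ge_quadratic: "1 - y^2 / 2 \<le> cos (y::real)"
proof -
  have "(sin (y / 2))^2 \<le> (y / 2)^2"
    using abs_sin_x_le_abs_x[of "y / 2"] by (simp add: abs_le_square_iff[symmetric])
  then show ?thesis using cos_double_sin[of "y / 2"] by (simp add: power_divide)
qed

lemma sin_ge_cubic: "0 \<le> y \<Longrightarrow> y - y^3 / 6 \<le> sin (y::real)"
proof -
  assume y: "0 \<le> y"
  have "sin 0 - (0 - 0^3 / 6) \<le> sin y - (y - y^3 / 6)"
  proof (rule DERIV_nonneg_imp_nondecreasing[OF y])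
    fix x :: real
    show "\<exists>d. ((\<lambda>y. sin y - (y - y^3 / 6)) has_real_derivative d) (at x) \<and> 0 \<le> d"
      using cos_ge_quadratic[of x]
      by (intro exI[of _ "cos x - (1 - x^2 / 2)"]) (auto intro!: derivative_eq_intros)
  qed
  then show ?thesis by simp
qed

lemma cos_le_quartic: "cos (y::real) \<le> 1 - y^2 / 2 + y^4 / 24"
proof -
  have *: "cos y \<le> 1 - y^2 / 2 + y^4 / 24" if y: "0 \<le> y" for y :: real
  proof -
    have "(1 - 0^2 / 2 + 0^4 / 24) - cos 0 \<le> (1 - y^2 / 2 + y^4 / 24) - cos y"
    proof (rule DERIV_nonneg_imp_nondecreasing[OF y])
      fix x :: real assume "0 \<le> x"
      then show "\<exists>d. ((\<lambda>y. (1 - y^2 / 2 + y^4 / 24) - cos y) has_real_derivative d) (at x) \<and> 0 \<le> d"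
        using sin_ge_cubic[of x]
        by (intro exI[of _ "sin x - (x - x^3 / 6)"]) (auto intro!: derivative_eq_intros)
    qed
    then show ?thesis by simp
  qed
  show ?thesis using *[of "\<bar>y\<bar>"] by simp
qed

text \<open>In the form 1 / sin y \<le> 1 / y + 1: half of the 1 is exactly the - 1/2 of the
  Dirichlet kernel bound, so the cutoff below comes out as 1 / (\<tau> * s).\<close>

lemma sin_ge_quot:
  assumes "0 \<le> y" "y \<le> 1"
  shows "y / (1 + y) \<le> sin (y::real)"
proof -
  have "y^2 \<le> y" using assms by (simp add: power2_eq_square mult_left_le)
  then have "0 \<le> y * (y * (6 - y - y^2))" using assms by (intro mult_nonneg_nonneg) auto
  then have "y / (1 + y) \<le> y - y^3 / 6"
    using assms by (simp add: field_simps power2_eq_square power3_eq_cube)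
  then show ?thesis using sin_ge_cubic[OF assms(1)] by linarith
qed

lemma cmod_prod_cfun_le:
  "cmod (\<Prod>j=1..N. cfun (real j * s) (real j * \<theta>)) \<le> exp (- (\<Sum>j=1..N. fvar (real j * s) * (1 - cos (real j * \<theta>))))"
proof -
  have "cmod (\<Prod>j=1..N. cfun (real j * s) (real j * \<theta>)) = (\<Prod>j=1..N. cmod (cfun (real j * s) (real j * \<theta>)))"
    by (simp add: prod_norm)
  also have "\<dots> \<le> (\<Prod>j=1..N. exp (- (fvar (real j * s) * (1 - cos (real j * \<theta>)))))"
    by (intro prod_mono) (simp add: cmod_cfun_le)
  also have "\<dots> = exp (- (\<Sum>j=1..N. fvar (real j * s) * (1 - cos (real j * \<theta>))))"
    by (simp add: exp_sum sum_negf[symmetric])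
  finally show ?thesis .
qed

text \<open>The integer cutoff K is at most 1 / (\<tau> * s) + 1, and the tail starts at K + 1; the
  two extra steps appear as 2 * s in the argument of \<open>fermi\<close>.\<close>

lemma cmod_prod_cfun_minor:
  assumes s: "0 < s" and \<tau>: "0 < \<tau>" "\<tau> * s \<le> 2" and \<theta>: "\<tau> * s \<le> \<theta>" "\<theta> \<le> pi"
    and N: "1 / (\<tau> * s) + 1 \<le> real N"
  shows "cmod (\<Prod>j=1..N. cfun (real j * s) (real j * \<theta>))
    \<le> exp (- ((fermi (1 / \<tau> + 2 * s) - fermi (real N * s)) / s))"
proof -
  define y where "y = \<tau> * s / 2"
  have y: "0 < y" "y \<le> 1" using assms by (auto simp: y_def)
  have \<theta>0: "0 < \<theta>" using \<theta>(1) s \<tau>(1) by (meson less_le_trans mult_pos_pos)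
  define A where "A = 1 / (2 * sin (\<theta> / 2)) - 1 / 2"
  define K where "K = nat \<lceil>A\<rceil>"
  have "y / (1 + y) \<le> sin y" using y by (intro sin_ge_quot) auto
  also have "\<dots> \<le> sin (\<theta> / 2)" using \<theta> y by (intro sin_monotone_2pi_le) (auto simp: y_def)
  finally have "y / (1 + y) \<le> sin (\<theta> / 2)" .
  moreover have "0 < y / (1 + y)" using y by auto
  ultimately have "1 / sin (\<theta> / 2) \<le> 1 / (y / (1 + y))"
    by (intro divide_left_mono mult_pos_pos) linarith+
  also have "\<dots> = 1 / y + 1" using y by (simp add: field_simps)
  finally have "A \<le> 1 / (2 * y)" by (simp add: A_def)
  then have A: "A \<le> 1 / (\<tau> * s)" by (simp add: y_def)
  have A0: "A \<ge> 0"
  proof -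
    have "0 < sin (\<theta> / 2)" using \<theta>0 \<theta>(2) by (intro sin_gt_zero) auto
    then show ?thesis by (simp add: A_def field_simps)
  qed
  have K: "A \<le> real K" "real K \<le> A + 1" using A0 unfolding K_def by linarith+
  have KN: "K \<le> N" using K(2) A N by linarith
  have "(fermi (1 / \<tau> + 2 * s) - fermi (real N * s)) / s
      \<le> (fermi ((real K + 1) * s) - fermi ((real N + 1) * s)) / s"
  proof (intro divide_right_mono diff_mono fermi_antimono)
    have "(real K + 1) * s \<le> (1 / (\<tau> * s) + 2) * s" using K(2) A s by (intro mult_right_mono) auto
    also have "\<dots> = 1 / \<tau> + 2 * s" using s \<tau> by (simp add: field_simps)
    finally show "(real K + 1) * s \<le> 1 / \<tau> + 2 * s" .
  qed (use s in \<open>auto simp: algebra_simps\<close>)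
  also have "\<dots> \<le> (\<Sum>j=1..N. if K < j then fvar (real j * s) else 0)"
    by (rule fvar_tail_sum[OF s KN])
  also have "\<dots> \<le> (\<Sum>j=1..N. fvar (real j * s) * (1 - cos (real j * \<theta>)))"
    using \<theta>0 \<theta>(2) K(1) s
    by (intro minor_arc_sum) (auto simp: A_def fvar_nonneg intro!: fvar_antimono mult_right_mono)
  finally show ?thesis
    using cmod_prod_cfun_le[of s \<theta> N] by (meson exp_le_cancel_iff neg_le_iff_le order_trans)
qed

section \<open>Power sums of geometric sequences with explicit bounds\<close>

lemma summable_power_geometric:
  fixes x :: real
  shows "\<bar>x\<bar> < 1 \<Longrightarrow> summable (\<lambda>n. real n ^ p * x ^ n)"
proof (induction p arbitrary: x)
  case 0
  then show ?case by (simp add: summable_geometric)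
next
  case (Suc p)
  have "summable (\<lambda>n. diffs (\<lambda>n. real n ^ p) n * x ^ n)"
    by (rule termdiff_converges[where K = 1]) (use Suc in auto)
  then have "summable (\<lambda>n. real (Suc n) ^ Suc p * x ^ n)" by (simp add: diffs_def)
  then have "summable (\<lambda>n. x * (real (Suc n) ^ Suc p * x ^ n))" by (rule summable_mult)
  then have "summable (\<lambda>n. real (Suc n) ^ Suc p * x ^ Suc n)" by (simp add: mult_ac)
  then show ?case by (subst (asm) summable_Suc_iff)
qed

text \<open>Up to powers of exp (a / 2), the power sums of a geometric sequence with ratio exp (- a)
  are polynomials in h a and c a.\<close>

definition hsinh :: "real \<Rightarrow> real" where "hsinh a = exp (a / 2) - exp (- (a / 2))"
definition hcosh :: "real \<Rightarrow> real" where "hcosh a = exp (a / 2) + exp (- (a / 2))"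

definition power_sum :: "nat \<Rightarrow> real \<Rightarrow> real" where "power_sum p a = (\<Sum>n. real n ^ p * exp (- a) ^ n)"

lemma power_sum_sums: "0 < a \<Longrightarrow> (\<lambda>n. real n ^ p * exp (- a) ^ n) sums power_sum p a"
  unfolding power_sum_def by (intro summable_sums summable_power_geometric) simp

lemma power_sum_step:
  assumes "0 < a" "0 < p" "(\<lambda>n. real (Suc n) ^ p * exp (- a) ^ n) sums T"
  shows "power_sum p a = exp (- a) * T"
proof -
  have "(\<lambda>n. exp (- a) * (real (Suc n) ^ p * exp (- a) ^ n)) sums (exp (- a) * T)"
    using assms(3) by (rule sums_mult)
  then have "(\<lambda>n. real (Suc n) ^ p * exp (- a) ^ Suc n) sums (exp (- a) * T)" by (simp add: mult_ac)
  then have "(\<lambda>n. real n ^ p * exp (- a) ^ n) sums (exp (- a) * T)"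
    using assms(2) by (subst (asm) sums_Suc_iff) (simp add: power_0_left)
  then show ?thesis using power_sum_sums[OF assms(1), of p] sums_unique2 by blast
qed

text \<open>Shifting the summation index gives a binomial recurrence in p. The closed forms in x =
  exp (- a) and y = 1 - x then become symmetric after scaling by powers of w = exp (a / 2).\<close>

lemma power_sum_values:
  assumes a: "0 < a"
  shows "power_sum 1 a = 1 / hsinh a ^ 2" "power_sum 2 a = hcosh a / hsinh a ^ 3"
    "power_sum 3 a = 6 / hsinh a ^ 4 + 1 / hsinh a ^ 2" "power_sum 4 a = hcosh a * (hsinh a ^ 2 + 12) / hsinh a ^ 5"
proof -
  define x where "x = exp (- a)"
  define w where "w = exp (a / 2)"
  have x: "0 < x" "x < 1" using a by (auto simp: x_def)
  have w: "w > 1" using a by (simp add: w_def)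
  have iw: "exp (- (a / 2)) = 1 / w" by (simp add: w_def exp_minus field_simps)
  have xw: "x = 1 / w^2"
  proof -
    have "w^2 = exp a" by (simp add: w_def power2_eq_square mult_exp_exp)
    then show ?thesis by (simp add: x_def exp_minus field_simps)
  qed
  have s: "(\<lambda>n. real n ^ p * x ^ n) sums power_sum p a" for p unfolding x_def by (rule power_sum_sums[OF a])
  have P0: "power_sum 0 a * (1 - x) = 1"
  proof -
    have "(\<lambda>n. x ^ n) sums (1 / (1 - x))" using x by (intro geometric_sums) auto
    then have "power_sum 0 a = 1 / (1 - x)" using s[of 0] sums_unique2 by auto
    then show ?thesis using x by simp
  qed
  have P1: "power_sum 1 a = x * (power_sum 1 a + power_sum 0 a)"
    unfolding x_def using sums_add[OF s[of 1] s[of 0]]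
    by (intro power_sum_step[OF a]) (auto simp: x_def algebra_simps)
  have P2: "power_sum 2 a = x * (power_sum 2 a + 2 * power_sum 1 a + power_sum 0 a)"
    unfolding x_def using sums_add[OF sums_add[OF s[of 2] sums_mult[OF s[of 1], of 2]] s[of 0]]
    by (intro power_sum_step[OF a]) (auto simp: x_def algebra_simps power2_eq_square)
  have P3: "power_sum 3 a = x * (power_sum 3 a + 3 * power_sum 2 a + 3 * power_sum 1 a + power_sum 0 a)"
    unfolding x_def using sums_add[OF sums_add[OF sums_add[OF s[of 3] sums_mult[OF s[of 2], of 3]]
        sums_mult[OF s[of 1], of 3]] s[of 0]]
    by (intro power_sum_step[OF a]) (auto simp: x_def algebra_simps power2_eq_square power3_eq_cube)
  have P4: "power_sum 4 a = x * (power_sum 4 a + 4 * power_sum 3 a + 6 * power_sum 2 a + 4 * power_sum 1 a + power_sum 0 a)"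
    unfolding x_def using sums_add[OF sums_add[OF sums_add[OF sums_add[OF s[of 4] sums_mult[OF s[of 3], of 4]]
        sums_mult[OF s[of 2], of 6]] sums_mult[OF s[of 1], of 4]] s[of 0]]
    by (intro power_sum_step[OF a]) (auto simp: x_def algebra_simps eval_nat_numeral)
  define y where "y = 1 - x"
  have y: "y > 0" using x by (simp add: y_def)
  have p0: "power_sum 0 a = 1 / y" using P0 y by (simp add: y_def field_simps)
  have "power_sum 1 a * y = x * power_sum 0 a" using P1 by (simp add: y_def algebra_simps)
  then have p1: "power_sum 1 a = x / y^2"
    unfolding p0 using y by (simp add: field_simps power2_eq_square)
  have "power_sum 2 a * y = x * (2 * power_sum 1 a + power_sum 0 a)" using P2 by (simp add: y_def algebra_simps)
  then have "power_sum 2 a = x * (2 * power_sum 1 a + power_sum 0 a) / y" using y by (simp add: field_simps)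
  also have "\<dots> = x * (2 * x + y) / y^3" unfolding p0 p1 using y by (simp add: field_simps power2_eq_square power3_eq_cube)
  finally have p2: "power_sum 2 a = x * (1 + x) / y^3" by (simp add: y_def)
  have "power_sum 3 a * y = x * (3 * power_sum 2 a + 3 * power_sum 1 a + power_sum 0 a)" using P3 by (simp add: y_def algebra_simps)
  then have "power_sum 3 a = x * (3 * power_sum 2 a + 3 * power_sum 1 a + power_sum 0 a) / y" using y by (simp add: field_simps)
  also have "\<dots> = x * (3 * x * (1 + x) + 3 * x * y + y^2) / y^4" unfolding p0 p1 p2 using y
    by (simp add: field_simps eval_nat_numeral)
  also have "3 * x * (1 + x) + 3 * x * y + y^2 = 1 + 4 * x + x^2"
    by (simp add: y_def algebra_simps power2_eq_square)
  finally have p3: "power_sum 3 a = x * (1 + 4 * x + x^2) / y^4" .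
  have "power_sum 4 a * y = x * (4 * power_sum 3 a + 6 * power_sum 2 a + 4 * power_sum 1 a + power_sum 0 a)" using P4 by (simp add: y_def algebra_simps)
  then have "power_sum 4 a = x * (4 * power_sum 3 a + 6 * power_sum 2 a + 4 * power_sum 1 a + power_sum 0 a) / y" using y by (simp add: field_simps)
  also have "\<dots> = x * (4 * x * (1 + 4 * x + x^2) + 6 * x * (1 + x) * y + 4 * x * y^2 + y^3) / y^5" unfolding p0 p1 p2 p3 using y
    by (simp add: field_simps eval_nat_numeral)
  also have "4 * x * (1 + 4 * x + x^2) + 6 * x * (1 + x) * y + 4 * x * y^2 + y^3 = 1 + 11 * x + 11 * x^2 + x^3"
    by (simp add: y_def algebra_simps power2_eq_square power3_eq_cube)
  finally have p4: "power_sum 4 a = x * (1 + 11 * x + 11 * x^2 + x^3) / y^5" .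
  have h: "hsinh a = w * y" "hcosh a = w * (1 + x)"
    unfolding hsinh_def hcosh_def iw using w by (auto simp: w_def[symmetric] y_def xw field_simps power2_eq_square)
  have wx: "w^2 * x = 1" using w by (simp add: xw)
  have w0: "w \<noteq> 0" "y \<noteq> 0" using w y by auto
  show "power_sum 1 a = 1 / hsinh a ^ 2"
    unfolding p1 h using w0 wx by (simp add: field_simps power_mult_distrib)
  have "hcosh a / hsinh a ^ 3 = (w^2 * x) * (w * (1 + x)) / (w^3 * y^3)"
    unfolding h power_mult_distrib wx by simp
  also have "\<dots> = power_sum 2 a" unfolding p2 using w0 by (simp add: field_simps eval_nat_numeral)
  finally show "power_sum 2 a = hcosh a / hsinh a ^ 3" by simp
  have "6 / hsinh a ^ 4 + 1 / hsinh a ^ 2 = (6 + w^2 * y^2) / (w^4 * y^4)"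
    unfolding h power_mult_distrib using w0 by (simp add: field_simps eval_nat_numeral)
  also have "\<dots> = (w^2 * x)^2 * (6 + w^2 * y^2) / (w^4 * y^4)" by (simp add: wx)
  also have "\<dots> = (6 * x^2 + (w^2 * x) * x * y^2) / y^4"
    using w0 by (simp add: field_simps eval_nat_numeral)
  also have "\<dots> = power_sum 3 a" unfolding wx p3 by (simp add: y_def field_simps eval_nat_numeral)
  finally show "power_sum 3 a = 6 / hsinh a ^ 4 + 1 / hsinh a ^ 2" by simp
  have "hcosh a * (hsinh a ^ 2 + 12) / hsinh a ^ 5 = w * (1 + x) * (w^2 * y^2 + 12) / (w^5 * y^5)"
    unfolding h power_mult_distrib by simp
  also have "\<dots> = (w^2 * x)^2 * (w * (1 + x) * (w^2 * y^2 + 12)) / (w^5 * y^5)" by (simp add: wx)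
  also have "\<dots> = (1 + x) * ((w^2 * x) * x * y^2 + 12 * x^2) / y^5"
    using w0 by (simp add: field_simps eval_nat_numeral)
  also have "\<dots> = power_sum 4 a" unfolding wx p4 by (simp add: y_def field_simps eval_nat_numeral)
  finally show "power_sum 4 a = hcosh a * (hsinh a ^ 2 + 12) / hsinh a ^ 5" by simp
qed

lemma hcosh_hsinh: "hcosh a ^ 2 = hsinh a ^ 2 + 4"
proof -
  have "exp (a / 2) * exp (- (a / 2)) = 1" by (simp add: mult_exp_exp)
  then show ?thesis unfolding hsinh_def hcosh_def by algebra
qed

lemma hsinh_ge: "0 \<le> a \<Longrightarrow> a \<le> hsinh a"
proof -
  assume a: "0 \<le> a"
  have "hsinh 0 - 0 \<le> hsinh a - a"
  proof (rule DERIV_nonneg_imp_nondecreasing[OF a])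
    fix x :: real
    have "hcosh x ^ 2 \<ge> 2^2" by (simp add: hcosh_hsinh)
    then have "2 \<le> hcosh x" by (rule power2_le_imp_le) (simp add: hcosh_def add_nonneg_nonneg)
    then show "\<exists>d. ((\<lambda>x. hsinh x - x) has_real_derivative d) (at x) \<and> 0 \<le> d"
      by (intro exI[of _ "hcosh x / 2 - 1"]) (auto intro!: derivative_eq_intros simp: hsinh_def hcosh_def)
  qed
  then show ?thesis by (simp add: hsinh_def)
qed

lemma hcosh_ge: "2 \<le> hcosh a"
proof -
  have "2^2 \<le> hcosh a ^ 2" by (simp add: hcosh_hsinh)
  then show ?thesis by (rule power2_le_imp_le) (simp add: hcosh_def add_nonneg_nonneg)
qed

text \<open>By \<open>hcosh_hsinh\<close> it is enough to bound \<open>hsinh x\<close> crudely by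
  5/4 * x, because 25/16 \<le> 8/5. Integrating this bound yields the 1/15 in
  \<open>hsinh_le\<close>.\<close>

lemma hcosh_le:
  assumes "0 \<le> x" "x \<le> 1"
  shows "hcosh x \<le> 2 + 2 * x^2 / 5"
proof -
  have "exp (x / 2) \<le> 1 + x / 2 + (x / 2)^2" using assms by (intro exp_bound) auto
  moreover have "1 + - (x / 2) \<le> exp (- (x / 2))" by (rule exp_ge_add_one_self)
  ultimately have "hsinh x \<le> x + x * x / 4" by (simp add: hsinh_def power2_eq_square)
  moreover have "x * x \<le> x * 1" using assms by (intro mult_left_mono) auto
  ultimately have "hsinh x \<le> 5 / 4 * x" by simp
  then have "hsinh x ^ 2 \<le> (5 / 4 * x)^2" using hsinh_ge[OF assms(1)] assms by (intro power_mono) auto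
  moreover have "(5 / 4 * x)^2 = 25 / 16 * x^2" by (simp add: power2_eq_square)
  moreover have "(2 + 2 * x^2 / 5)^2 = 4 + 8 / 5 * x^2 + 4 / 25 * (x^2)^2"
    by (simp add: power2_eq_square algebra_simps)
  ultimately have "hcosh x ^ 2 \<le> (2 + 2 * x^2 / 5)^2"
    using hcosh_hsinh[of x] zero_le_power2[of x] zero_le_power2[of "x^2"] by linarith
  then show ?thesis by (rule power2_le_imp_le) simp
qed

lemma hsinh_le: "0 \<le> a \<Longrightarrow> a \<le> 1 \<Longrightarrow> hsinh a \<le> a * (1 + a^2 / 15)"
proof -
  assume a: "0 \<le> a" "a \<le> 1"
  have "0 * (1 + 0^2 / 15) - hsinh 0 \<le> a * (1 + a^2 / 15) - hsinh a"
  proof (rule DERIV_nonneg_imp_nondecreasing[OF a(1)])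
    fix x :: real assume x: "0 \<le> x" "x \<le> a"
    show "\<exists>d. ((\<lambda>x. x * (1 + x^2 / 15) - hsinh x) has_real_derivative d) (at x) \<and> 0 \<le> d"
      using hcosh_le[of x] x a
      by (intro exI[of _ "1 + 3 * x^2 / 15 - hcosh x / 2"])
        (auto intro!: derivative_eq_intros simp: hsinh_def hcosh_def power2_eq_square field_simps)
  qed
  then show ?thesis by (simp add: hsinh_def)
qed

text \<open>The range is 4 / 72 = 1 / 18 because power sums are taken at up to 4 * s with s \<le> 1
  / 72. There a^2 / 15 \<le> 1 / 4860, whence the factor 1 - 1 / 4000.\<close>

lemma inverse_hsinh_bounds:
  assumes "0 < a" "a \<le> 1/18"
  shows "1 / hsinh a ^ k \<le> 1 / a ^ k" and "(1 - 1 / 4000) ^ k / a ^ k \<le> 1 / hsinh a ^ k"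
proof -
  have h: "a \<le> hsinh a" "hsinh a \<le> a * (1 + a^2 / 15)" using assms by (auto intro: hsinh_ge hsinh_le)
  show "1 / hsinh a ^ k \<le> 1 / a ^ k"
    using h assms by (intro divide_left_mono power_mono mult_pos_pos zero_less_power) auto
  have "a^2 \<le> (1/18)^2" using assms by (intro power_mono) auto
  then have "a^2 / 15 \<le> 1 / 4860" by (simp add: power2_eq_square)
  then have "a * (1 + a^2 / 15) \<le> a * (1 + 1 / 4860)" using assms by (intro mult_left_mono) auto
  then have "hsinh a \<le> a * (1 + 1 / 4860)" using h by linarith
  then have "hsinh a * (1 - 1 / 4000) \<le> a" using assms by (simp add: field_simps)
  then have "(1 - 1 / 4000) / a \<le> 1 / hsinh a" using h assms by (simp add: field_simps)
  then have "((1 - 1 / 4000) / a) ^ k \<le> (1 / hsinh a) ^ k" using assms by (intro power_mono) auto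
  then show "(1 - 1 / 4000) ^ k / a ^ k \<le> 1 / hsinh a ^ k" by (simp add: power_divide)
qed

text \<open>Two-sided versions of power_sum p a = fact p / a ^ (p + 1) * (1 + O(a ^ 2)).\<close>

lemma power_sum_bounds:
  assumes "0 < a" "a \<le> 1/18"
  shows "power_sum 1 a \<le> 1 / a^2" "(1 - 1 / 2000) / a^2 \<le> power_sum 1 a"
    "power_sum 2 a \<le> (2 + 1 / 800) / a^3" "(2 - 1 / 600) / a^3 \<le> power_sum 2 a"
    "power_sum 3 a \<le> (6 + 1 / 300) / a^4" "(6 - 1 / 100) / a^4 \<le> power_sum 3 a"
    "power_sum 4 a \<le> (24 + 1 / 10) / a^5"
proof -
  note b = inverse_hsinh_bounds[OF assms]
  have h: "0 < hsinh a" using hsinh_ge[of a] assms by simp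
  have a2: "a^2 \<le> 1 / 324" using power_mono[OF assms(2), of 2] assms(1) by (simp add: power2_eq_square)
  have c: "2 \<le> hcosh a" "hcosh a \<le> 2 + 1 / 800" using hcosh_ge hcosh_le[of a] assms a2 by auto
  show "power_sum 1 a \<le> 1 / a^2" unfolding power_sum_values[OF assms(1)] by (rule b)
  have "(1 - 1 / 2000) / a^2 \<le> (1 - 1 / 4000)^2 / a^2"
    by (intro divide_right_mono) (auto simp: power2_eq_square)
  then show "(1 - 1 / 2000) / a^2 \<le> power_sum 1 a" unfolding power_sum_values[OF assms(1)] using b(2)[of 2] by linarith
  have "hcosh a * (1 / hsinh a ^ 3) \<le> (2 + 1 / 800) * (1 / a^3)"
    using c b(1)[of 3] h assms by (intro mult_mono) auto
  then show "power_sum 2 a \<le> (2 + 1 / 800) / a^3" unfolding power_sum_values[OF assms(1)] by simp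
  have "(2 - 1 / 600) / a^3 \<le> 2 * ((1 - 1 / 4000)^3 / a^3)"
    unfolding times_divide_eq_right using assms by (intro divide_right_mono) (auto simp: power3_eq_cube)
  also have "\<dots> \<le> hcosh a * (1 / hsinh a ^ 3)" using c b(2)[of 3] assms by (intro mult_mono) auto
  finally show "(2 - 1 / 600) / a^3 \<le> power_sum 2 a" unfolding power_sum_values[OF assms(1)] by simp
  have "1 / a^2 = a^2 / a^4" using assms by (simp add: power2_eq_square eval_nat_numeral)
  also have "\<dots> \<le> (1 / 324) / a^4" using a2 by (intro divide_right_mono) auto
  finally have e: "1 / a^2 \<le> (1 / 324) / a^4" .
  have "6 * (1 / hsinh a ^ 4) + 1 / hsinh a ^ 2 \<le> 6 * (1 / a^4) + (1 / 324) / a^4"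
    using b(1)[of 4] b(1)[of 2] e by linarith
  also have "\<dots> = (6 + 1 / 324) / a^4" by (simp add: add_divide_distrib)
  also have "\<dots> \<le> (6 + 1 / 300) / a^4" by (intro divide_right_mono) auto
  finally show "power_sum 3 a \<le> (6 + 1 / 300) / a^4" unfolding power_sum_values[OF assms(1)] by simp
  have "(6 - 1 / 100) / a^4 \<le> 6 * ((1 - 1 / 4000)^4 / a^4)"
    unfolding times_divide_eq_right using assms by (intro divide_right_mono) (auto simp: eval_nat_numeral)
  also have "\<dots> \<le> 6 * (1 / hsinh a ^ 4) + 1 / hsinh a ^ 2" using b(2)[of 4] h by (simp add: add_increasing2)
  finally show "(6 - 1 / 100) / a^4 \<le> power_sum 3 a" unfolding power_sum_values[OF assms(1)] by simp
  have h2: "hsinh a ^ 2 \<le> 1 / 300"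
  proof -
    have "hsinh a \<le> a * (1 + a^2 / 15)" using assms by (intro hsinh_le) auto
    also have "\<dots> \<le> a * (1 + 1/1000)" using a2 assms by (intro mult_left_mono) auto
    also have "\<dots> \<le> (1/18) * (1 + 1/1000)" using assms by (intro mult_right_mono) auto
    finally have "hsinh a ^ 2 \<le> ((1/18) * (1 + 1/1000))^2" using h by (intro power_mono) auto
    then show ?thesis by (simp add: power2_eq_square)
  qed
  have "hcosh a * (hsinh a ^ 2 + 12) * (1 / hsinh a ^ 5) \<le> ((2 + 1 / 800) * (1 / 300 + 12)) * (1 / a^5)"
    using c b(1)[of 5] h h2 assms by (intro mult_mono mult_nonneg_nonneg add_mono) auto
  also have "\<dots> \<le> (24 + 1 / 10) * (1 / a^5)" using assms by (intro mult_right_mono) auto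
  finally show "power_sum 4 a \<le> (24 + 1 / 10) / a^5" unfolding power_sum_values[OF assms(1)] by simp
qed

section \<open>Moments of the tilted distribution\<close>

definition Mean :: "nat \<Rightarrow> real \<Rightarrow> real" where "Mean N s = (\<Sum>j=1..N. real j * fermi (real j * s))"
definition Var :: "nat \<Rightarrow> real \<Rightarrow> real" where "Var N s = (\<Sum>j=1..N. real j ^ 2 * fvar (real j * s))"
definition Skew :: "nat \<Rightarrow> real \<Rightarrow> real" where "Skew N s = (\<Sum>j=1..N. real j ^ 3 * fskew (real j * s))"
definition Fourth :: "nat \<Rightarrow> real \<Rightarrow> real" where "Fourth N s = (\<Sum>j=1..N. real j ^ 4 * fvar (real j * s))"

lemma sum_le_sums:
  fixes t u :: "nat \<Rightarrow> real"
  assumes "\<And>j. t j \<le> u j" "\<And>j. 0 \<le> u j" "u sums U"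
  shows "(\<Sum>j=1..N. t j) \<le> U"
proof -
  have "(\<Sum>j=1..N. t j) \<le> (\<Sum>j=1..N. u j)" using assms(1) by (intro sum_mono)
  also have "\<dots> \<le> U" using assms(2,3) by (metis sum_le_suminf sums_iff finite_atLeastAtMost)
  finally show ?thesis .
qed

lemma power_sum_sums_scaled:
  assumes "0 < s" "0 < k"
  shows "(\<lambda>n. real n ^ p * exp (- (real n * s)) ^ k) sums power_sum p (real k * s)"
proof -
  have "exp (- (real k * s)) ^ n = exp (- (real n * s)) ^ k" for n
    by (simp add: exp_of_nat_mult[symmetric] mult_ac)
  then show ?thesis using power_sum_sums[of "real k * s" p] assms by simp
qed

context
  fixes s :: real
  assumes s: "0 < s" "s \<le> 1 / 72"
begin

text \<open>1 / (1 + e) \<le> 1 - e + e^2 bounds the mean by three power sums, with leading constant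
  1 - 1/4 + 1/9.\<close>

lemma Mean_le: "Mean N s \<le> 0.8625 / s^2"
proof -
  define e where "e j = exp (- (real j * s))" for j :: nat
  have e: "0 < e j" "e j \<le> 1" for j using s by (auto simp: e_def)
  define u where "u j = real j ^ 1 * e j ^ 1 - real j ^ 1 * e j ^ 2 + real j ^ 1 * e j ^ 3" for j
  have "Mean N s \<le> power_sum 1 (real 1 * s) - power_sum 1 (real 2 * s) + power_sum 1 (real 3 * s)"
    unfolding Mean_def
  proof (rule sum_le_sums)
    show "u sums
       (power_sum 1 (real 1 * s) - power_sum 1 (real 2 * s) + power_sum 1 (real 3 * s))"
      unfolding u_def[abs_def] e_def using s(1) by (intro sums_add sums_diff power_sum_sums_scaled) auto
    fix j
    have "e j / (1 + e j) \<le> e j - e j ^ 2 + e j ^ 3"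
    proof -
      have "(e j - e j ^ 2 + e j ^ 3) * (1 + e j) = e j + e j ^ 4"
        by (simp add: algebra_simps eval_nat_numeral)
      then have "e j \<le> (e j - e j ^ 2 + e j ^ 3) * (1 + e j)" using e[of j] by simp
      then show ?thesis using e[of j] by (simp add: divide_le_eq add_pos_pos)
    qed
    then have *: "real j * fermi (real j * s) \<le> real j * (e j - e j ^ 2 + e j ^ 3)"
      by (intro mult_left_mono) (auto simp: fermi_def e_def)
    then show "real j * fermi (real j * s) \<le> u j"
      by (simp add: u_def algebra_simps)
    show "0 \<le> u j"
      using * fermi_bounds(1)[of "real j * s"] by (simp add: u_def algebra_simps) (smt (verit) mult_nonneg_nonneg of_nat_0_le_iff)
  qed
  also have "\<dots> \<le> 1 / (real 1 * s)^2 - (1 - 1 / 2000) / (real 2 * s)^2 + 1 / (real 3 * s)^2"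
    using s by (intro add_mono diff_mono power_sum_bounds) auto
  also have "\<dots> = (1 - (1 - 1 / 2000) / 4 + 1 / 9) * (1 / s^2)"
    by (simp add: power_mult_distrib)
  also have "\<dots> \<le> 0.8625 * (1 / s^2)" by (intro mult_right_mono) auto
  finally show ?thesis by simp
qed

lemma Fourth_le: "Fourth N s \<le> 24.1 / s^5"
proof -
  have "Fourth N s \<le> power_sum 4 (real 1 * s)"
    unfolding Fourth_def
  proof (rule sum_le_sums)
    show "(\<lambda>j. real j ^ 4 * exp (- (real j * s)) ^ 1) sums power_sum 4 (real 1 * s)"
      using s(1) by (intro power_sum_sums_scaled) auto
    fix j
    have "1 * 1 \<le> (1 + exp (- (real j * s))) * (1 + exp (- (real j * s)))" by (intro mult_mono) auto
    then have "fvar (real j * s) \<le> exp (- (real j * s)) / 1"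
      unfolding fvar_def by (intro divide_left_mono) (auto simp: power2_eq_square)
    then show "real j ^ 4 * fvar (real j * s) \<le> real j ^ 4 * exp (- (real j * s)) ^ 1"
      by (intro mult_left_mono) auto
  qed auto
  also have "\<dots> \<le> (24 + 1 / 10) / (real 1 * s)^5" using s by (intro power_sum_bounds) auto
  finally show ?thesis by simp
qed

lemma Var_le: "Var N s \<le> 2.01 / s^3"
proof -
  have "Var N s \<le> power_sum 2 (real 1 * s)"
    unfolding Var_def
  proof (rule sum_le_sums)
    show "(\<lambda>j. real j ^ 2 * exp (- (real j * s)) ^ 1) sums power_sum 2 (real 1 * s)"
      using s(1) by (intro power_sum_sums_scaled) auto
    fix j
    have "1 * 1 \<le> (1 + exp (- (real j * s))) * (1 + exp (- (real j * s)))" by (intro mult_mono) auto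
    then have "fvar (real j * s) \<le> exp (- (real j * s)) / 1"
      unfolding fvar_def by (intro divide_left_mono) (auto simp: power2_eq_square)
    then show "real j ^ 2 * fvar (real j * s) \<le> real j ^ 2 * exp (- (real j * s)) ^ 1"
      by (intro mult_left_mono) auto
  qed auto
  also have "\<dots> \<le> (2 + 1 / 800) / (real 1 * s)^3" using s by (intro power_sum_bounds) auto
  also have "\<dots> \<le> 2.01 / s^3" unfolding of_nat_1 mult_1 using s by (intro divide_right_mono) auto
  finally show ?thesis .
qed

lemma Skew_le: "Skew N s \<le> 5.05 / s^4"
proof -
  define e where "e j = exp (- (real j * s))" for j :: nat
  have e: "0 < e j" "e j \<le> 1" for j using s by (auto simp: e_def)
  \<comment> \<open>The coefficients 1, -4, 9, -6 are those of (1 - e) * (1 - 3 * e + 6 * e^2),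
    where the second factor is the truncated series of 1 / (1 + e)^3.\<close>
  define u where "u j = real j ^ 3 * e j ^ 1 - 4 * (real j ^ 3 * e j ^ 2) + 9 * (real j ^ 3 * e j ^ 3) - 6 * (real j ^ 3 * e j ^ 4)" for j
  have "Skew N s \<le> power_sum 3 (real 1 * s) - 4 * power_sum 3 (real 2 * s) + 9 * power_sum 3 (real 3 * s) - 6 * power_sum 3 (real 4 * s)"
    unfolding Skew_def
  proof (rule sum_le_sums)
    show "u sums
       (power_sum 3 (real 1 * s) - 4 * power_sum 3 (real 2 * s) + 9 * power_sum 3 (real 3 * s) - 6 * power_sum 3 (real 4 * s))"
      unfolding u_def[abs_def] e_def using s(1) by (intro sums_add sums_diff sums_mult power_sum_sums_scaled) auto
    fix j
    have n: "0 \<le> e j * (1 - e j)" using e[of j] by simp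
    have "1 / (1 + e j)^3 \<le> 1 - 3 * e j + 6 * e j ^ 2"
    proof -
      have "(1 - 3 * e j + 6 * e j ^ 2) * (1 + e j)^3 = 1 + 10 * e j ^ 3 + 15 * e j ^ 4 + 6 * e j ^ 5"
        by (simp add: algebra_simps eval_nat_numeral)
      then have "1 \<le> (1 - 3 * e j + 6 * e j ^ 2) * (1 + e j)^3" using e[of j] by simp
      then show ?thesis using e[of j] by (simp add: divide_le_eq add_pos_pos)
    qed
    from mult_left_mono[OF this n]
    have k: "fskew (real j * s) \<le> e j * (1 - e j) * (1 - 3 * e j + 6 * e j ^ 2)"
      by (simp add: fskew_def e_def)
    have k0: "0 \<le> fskew (real j * s)" using n e[of j] by (simp add: fskew_def e_def)
    have k: "real j ^ 3 * fskew (real j * s) \<le> real j ^ 3 * (e j * (1 - e j) * (1 - 3 * e j + 6 * e j ^ 2))"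
      using k by (intro mult_left_mono) auto
    have eq: "real j ^ 3 * (e j * (1 - e j) * (1 - 3 * e j + 6 * e j ^ 2))
      = u j"
      by (simp add: u_def algebra_simps eval_nat_numeral)
    show "real j ^ 3 * fskew (real j * s) \<le> u j"
      using k eq by simp
    have "0 \<le> real j ^ 3 * fskew (real j * s)" using k0 by simp
    then show "0 \<le> u j"
      using k eq by linarith
  qed
  also have "\<dots> \<le> (6 + 1 / 300) / (real 1 * s)^4 - 4 * ((6 - 1 / 100) / (real 2 * s)^4)
      + 9 * ((6 + 1 / 300) / (real 3 * s)^4) - 6 * ((6 - 1 / 100) / (real 4 * s)^4)"
    using s by (intro add_mono diff_mono mult_left_mono power_sum_bounds) auto
  also have "\<dots> = (6 + 1 / 300 - 4 * (6 - 1 / 100) / 16 + 9 * (6 + 1 / 300) / 81 - 6 * (6 - 1 / 100) / 256) * (1 / s^4)"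
    by (simp add: power_mult_distrib algebra_simps)
  also have "\<dots> \<le> 5.05 * (1 / s^4)" by (intro mult_right_mono) auto
  finally show ?thesis by simp
qed

text \<open>The minorant 1 - 2 e + 2 e^2 - 3/4 e^3 of 1 / (1 + e)^2 is exact at e = 1 and to first
  order at e = 0, which a truncated series would not achieve. It gives 2 * (1 - 2/8 + 2/27 - 3/256),
  slightly above 1.62. A lower bound has to account for the terms beyond N, hence the condition on N
  * s.\<close>

lemma Var_ge:
  assumes N: "40 \<le> real N * s"
  shows "1.62 / s^3 \<le> Var N s"
proof -
  define e where "e j = exp (- (real j * s))" for j :: nat
  have e: "0 < e j" "e j \<le> 1" for j using s by (auto simp: e_def)
  define P where "P p = (\<Sum>j=1..N. real j ^ 2 * e j ^ p)" for p
  have sm: "(\<lambda>j. real j ^ 2 * e j ^ p) sums power_sum 2 (real p * s)" if "0 < p" for p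
    unfolding e_def using s that by (intro power_sum_sums_scaled) auto
  have tail: "power_sum 2 (real p * s) - P p \<le> 0.0005 / s^3" if p: "0 < p" for p
  proof -
    have s2: "(\<lambda>j. real j ^ 2 * exp (- (s / 2)) ^ j) sums power_sum 2 (s / 2)" using s by (intro power_sum_sums) auto
    have "power_sum 2 (real p * s) - P p = (\<Sum>j. real (j + Suc N) ^ 2 * e (j + Suc N) ^ p)"
    proof -
      have "(\<Sum>j<Suc N. real j ^ 2 * e j ^ p) = P p"
        unfolding P_def lessThan_Suc_atMost atMost_atLeast0 by (simp add: sum.atLeast_Suc_atMost)
      then show ?thesis
        using suminf_minus_initial_segment[OF sums_summable[OF sm[OF p]], of "Suc N"] sums_unique[OF sm[OF p]] by simp
    qed
    also have "\<dots> \<le> (\<Sum>j. exp (- 20) * (real (j + Suc N) ^ 2 * exp (- (s / 2)) ^ (j + Suc N)))"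
    proof (rule suminf_le)
      fix j
      have "e (j + Suc N) ^ p \<le> e (j + Suc N) ^ 1" using e p by (intro power_decreasing) (auto simp: less_imp_le)
      \<comment> \<open>Half of the exponent is at least 20 beyond N; the other half keeps the tail
        summable.\<close>
      also have "e (j + Suc N) ^ 1 = exp (- (real (j + Suc N) * s / 2)) * exp (- (s / 2)) ^ (j + Suc N)"
        unfolding exp_of_nat_mult[symmetric] mult_exp_exp e_def by (simp add: field_simps)
      also have "\<dots> \<le> exp (- 20) * exp (- (s / 2)) ^ (j + Suc N)"
      proof (intro mult_right_mono)
        have "real N * s \<le> real (j + Suc N) * s" using s by (intro mult_right_mono) auto
        then show "exp (- (real (j + Suc N) * s / 2)) \<le> exp (- 20)" using N by simp
      qed simp
      finally show "real (j + Suc N) ^ 2 * e (j + Suc N) ^ p \<le> exp (- 20) * (real (j + Suc N) ^ 2 * exp (- (s / 2)) ^ (j + Suc N))"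
        using mult_left_mono[of "e (j + Suc N) ^ p" _ "real (j + Suc N) ^ 2"] by (simp add: mult_ac)
      show "summable (\<lambda>j. real (j + Suc N) ^ 2 * e (j + Suc N) ^ p)"
        by (rule summable_ignore_initial_segment[OF sums_summable[OF sm[OF p]]])
      show "summable (\<lambda>j. exp (- 20) * (real (j + Suc N) ^ 2 * exp (- (s / 2)) ^ (j + Suc N)))"
        by (intro summable_mult summable_ignore_initial_segment[OF sums_summable[OF s2]])
    qed
    also have "\<dots> = exp (- 20) * (\<Sum>j. real (j + Suc N) ^ 2 * exp (- (s / 2)) ^ (j + Suc N))"
      by (intro suminf_mult summable_ignore_initial_segment[OF sums_summable[OF s2]])
    also have "\<dots> \<le> exp (- 20) * power_sum 2 (s / 2)"
    proof (intro mult_left_mono)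
      show "(\<Sum>j. real (j + Suc N) ^ 2 * exp (- (s / 2)) ^ (j + Suc N)) \<le> power_sum 2 (s / 2)"
        using suminf_minus_initial_segment[OF sums_summable[OF s2], of "Suc N"] sums_unique[OF s2]
          sum_nonneg[of "{..<Suc N}" "\<lambda>j. real j ^ 2 * exp (- (s / 2)) ^ j"] by simp
    qed simp
    also have "\<dots> \<le> (1 / 2 ^ 20) * ((2 + 1 / 800) / (s / 2)^3)"
    proof (intro mult_mono power_sum_bounds)
      have "(2::real) \<le> exp 1" using exp_ge_add_one_self[of 1] by simp
      then have "(2::real) ^ 20 \<le> exp 1 ^ 20" by (intro power_mono) auto
      also have "\<dots> = exp 20" by (simp flip: exp_of_nat_mult)
      finally show "exp (- 20) \<le> (1::real) / 2 ^ 20" by (simp add: exp_minus field_simps)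
      show "0 \<le> power_sum 2 (s / 2)" unfolding power_sum_def using s
        by (intro suminf_nonneg sums_summable[OF s2]) auto
    qed (use s in auto)
    also have "\<dots> = (8 * (2 + 1 / 800) / 2 ^ 20) * (1 / s^3)" by (simp add: power_divide)
    also have "\<dots> \<le> 0.0005 * (1 / s^3)" using s by (intro mult_right_mono) auto
    finally show ?thesis by simp
  qed
  have up: "P p \<le> power_sum 2 (real p * s)" if "0 < p" for p
    unfolding P_def by (rule sum_le_sums[OF _ _ sm[OF that]]) (auto simp: e less_imp_le)
  have "P 1 - 2 * P 2 + 2 * P 3 - 3 / 4 * P 4 \<le> Var N s"
  proof -
    have "P 1 - 2 * P 2 + 2 * P 3 - 3 / 4 * P 4
        = (\<Sum>j=1..N. real j ^ 2 * (e j * (1 - 2 * e j + 2 * e j ^ 2 - 3 / 4 * e j ^ 3)))"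
      unfolding P_def sum_distrib_left sum_subtractf[symmetric] sum.distrib[symmetric]
      by (intro sum.cong refl) (simp add: algebra_simps eval_nat_numeral)
    also have "\<dots> \<le> Var N s" unfolding Var_def
    proof (intro sum_mono mult_left_mono)
      fix j
      define x where "x = e j"
      have x: "0 < x" "x \<le> 1" using e by (auto simp: x_def)
      have "x^2 \<le> 1" using x by (simp add: power_le_one)
      then have "0 \<le> x^2 * ((1 - x) * (1 - x / 4 - 3 / 4 * x^2))"
        using x by (intro mult_nonneg_nonneg) auto
      also have "\<dots> = 1 - (1 - 2 * x + 2 * x^2 - 3 / 4 * x^3) * (1 + x)^2"
        by (simp add: field_simps eval_nat_numeral)
      finally have "1 - 2 * x + 2 * x^2 - 3 / 4 * x^3 \<le> 1 / (1 + x)^2"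
        using x by (simp add: le_divide_eq)
      from mult_left_mono[OF this, of x] x
      show "e j * (1 - 2 * e j + 2 * e j ^ 2 - 3 / 4 * e j ^ 3) \<le> fvar (real j * s)"
        by (simp add: fvar_def x_def e_def)
    qed auto
    finally show ?thesis .
  qed
  moreover have "1.62 / s^3 \<le> P 1 - 2 * P 2 + 2 * P 3 - 3 / 4 * P 4"
  proof -
    have 1: "(2 - 1 / 600) / (real 1 * s)^3 - 0.0005 / s^3 \<le> P 1"
      using tail[of 1] power_sum_bounds(4)[of "real 1 * s"] s by simp
    have 3: "(2 - 1 / 600) / (real 3 * s)^3 - 0.0005 / s^3 \<le> P 3"
      using tail[of 3] power_sum_bounds(4)[of "real 3 * s"] s by simp
    have 2: "P 2 \<le> (2 + 1 / 800) / (real 2 * s)^3"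
      using up[of 2] power_sum_bounds(3)[of "real 2 * s"] s by simp
    have 4: "P 4 \<le> (2 + 1 / 800) / (real 4 * s)^3"
      using up[of 4] power_sum_bounds(3)[of "real 4 * s"] s by simp
    define S where "S = 1 / s^3"
    have S: "S > 0" using s by (simp add: S_def)
    have "(2 - 1 / 600) * S - 0.0005 * S \<le> P 1" "(2 - 1 / 600) / 27 * S - 0.0005 * S \<le> P 3"
      "P 2 \<le> (2 + 1 / 800) / 8 * S" "P 4 \<le> (2 + 1 / 800) / 64 * S"
      using 1 2 3 4 by (simp_all add: S_def power_mult_distrib)
    then have "1.62 * S \<le> P 1 - 2 * P 2 + 2 * P 3 - 3 / 4 * P 4" using S by simp
    then show ?thesis by (simp add: S_def)
  qed
  ultimately show ?thesis by linarith
qed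

end

 

section \<open>Gaussian integrals of polynomials and the Fourier integral\<close>

definition gpoly :: "real \<Rightarrow> real \<Rightarrow> real \<Rightarrow> real \<Rightarrow> real \<Rightarrow> real \<Rightarrow> real \<Rightarrow> real \<Rightarrow> real \<Rightarrow> real \<Rightarrow> real" where
  "gpoly c4 c5 c6 c7 c8 c9 c10 c11 c15 x = c4 * x^4 + c5 * x^5 + c6 * x^6 + c7 * x^7 + c8 * x^8 + c9 * x^9 + c10 * x^10 + c11 * x^11 + c15 * x^15"

text \<open>The integral of gpoly against exp (- (x ^ 2)) over the half-line.\<close>

definition gval :: "real \<Rightarrow> real \<Rightarrow> real \<Rightarrow> real \<Rightarrow> real \<Rightarrow> real \<Rightarrow> real \<Rightarrow> real \<Rightarrow> real \<Rightarrow> real" where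
  "gval c4 c5 c6 c7 c8 c9 c10 c11 c15 = sqrt pi / 2 * (3/4 * c4 + 15/8 * c6 + 105/16 * c8 + 945/32 * c10)
      + (c5 + 3 * c7 + 12 * c9 + 60 * c11 + 2520 * c15)"

lemma gauss_poly_integral:
  fixes \<beta> c4 c5 c6 c7 c8 c9 c10 c11 c15 :: real
  defines "P \<equiv> gpoly c4 c5 c6 c7 c8 c9 c10 c11 c15" and "V \<equiv> gval c4 c5 c6 c7 c8 c9 c10 c11 c15"
  assumes "0 < \<beta>"
  shows "has_bochner_integral lborel (\<lambda>t. indicator {0..} t *\<^sub>R (exp (- (\<beta> * t)\<^sup>2) * P (\<beta> * t))) (V / \<beta>)"
proof -
  let ?M = "\<lambda>k x. indicator {0..} x *\<^sub>R (exp (- x\<^sup>2) * x^k) :: real"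
  have e: "has_bochner_integral lborel (?M 4) (sqrt pi / 2 * (3/4))"
    "has_bochner_integral lborel (?M 6) (sqrt pi / 2 * (15/8))"
    "has_bochner_integral lborel (?M 8) (sqrt pi / 2 * (105/16))"
    "has_bochner_integral lborel (?M 10) (sqrt pi / 2 * (945/32))"
    using gaussian_moment_even_pos[of 2] gaussian_moment_even_pos[of 3]
      gaussian_moment_even_pos[of 4] gaussian_moment_even_pos[of 5]
    by (simp_all add: fact_numeral)
  have o: "has_bochner_integral lborel (?M 5) 1" "has_bochner_integral lborel (?M 7) 3"
    "has_bochner_integral lborel (?M 9) 12" "has_bochner_integral lborel (?M 11) 60"
    "has_bochner_integral lborel (?M 15) 2520"
    using gaussian_moment_odd_pos[of 2] gaussian_moment_odd_pos[of 3] gaussian_moment_odd_pos[of 4]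
      gaussian_moment_odd_pos[of 5] gaussian_moment_odd_pos[of 7]
    by (simp_all add: fact_numeral)
  note add = has_bochner_integral_add and mult = has_bochner_integral_mult_right
  have "has_bochner_integral lborel (\<lambda>x. c4 * ?M 4 x + c5 * ?M 5 x + c6 * ?M 6 x + c7 * ?M 7 x + c8 * ?M 8 x
      + c9 * ?M 9 x + c10 * ?M 10 x + c11 * ?M 11 x + c15 * ?M 15 x)
     (c4 * (sqrt pi / 2 * (3/4)) + c5 * 1 + c6 * (sqrt pi / 2 * (15/8)) + c7 * 3 + c8 * (sqrt pi / 2 * (105/16))
      + c9 * 12 + c10 * (sqrt pi / 2 * (945/32)) + c11 * 60 + c15 * 2520)"
    by (intro add mult e o)
  also have "(\<lambda>x. c4 * ?M 4 x + c5 * ?M 5 x + c6 * ?M 6 x + c7 * ?M 7 x + c8 * ?M 8 x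
      + c9 * ?M 9 x + c10 * ?M 10 x + c11 * ?M 11 x + c15 * ?M 15 x) = (\<lambda>x. indicator {0..} x *\<^sub>R (exp (- x\<^sup>2) * P x))"
    by (simp add: fun_eq_iff P_def gpoly_def algebra_simps)
  also have "c4 * (sqrt pi / 2 * (3/4)) + c5 * 1 + c6 * (sqrt pi / 2 * (15/8)) + c7 * 3 + c8 * (sqrt pi / 2 * (105/16))
      + c9 * 12 + c10 * (sqrt pi / 2 * (945/32)) + c11 * 60 + c15 * 2520 = V"
    by (simp add: V_def gval_def algebra_simps)
  finally have "has_bochner_integral lborel (\<lambda>t. indicator {0..} (0 + \<beta> * t) *\<^sub>R (exp (- (0 + \<beta> * t)\<^sup>2) * P (0 + \<beta> * t))) (V /\<^sub>R \<bar>\<beta>\<bar>)"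
    using assms(3) by (subst (asm) lborel_has_bochner_integral_real_affine_iff[where c = \<beta> and t = 0]) auto
  moreover have "indicator {0..} (\<beta> * t) = (indicator {0..} t :: real)" for t
    using assms(3) by (auto simp: indicator_def zero_le_mult_iff)
  ultimately show ?thesis using assms(3) by (simp add: divide_inverse mult.commute)
qed

text \<open>A minorant that is nonpositive beyond X may be integrated over the whole half-line,
  where the moments are explicit; this replaces any tail estimate for the Gaussian.\<close>

lemma gauss_poly_lower:
  fixes F :: "real \<Rightarrow> real" and \<beta> c4 c5 c6 c7 c8 c9 c10 c11 c15 :: real
  defines "P \<equiv> gpoly c4 c5 c6 c7 c8 c9 c10 c11 c15" and "V \<equiv> gval c4 c5 c6 c7 c8 c9 c10 c11 c15"
  assumes "0 < \<beta>" "continuous_on {0..X / \<beta>} F"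
    and F: "\<And>t. 0 \<le> t \<Longrightarrow> t \<le> X / \<beta> \<Longrightarrow> exp (- (\<beta> * t)\<^sup>2) * P (\<beta> * t) \<le> F t"
    and P: "\<And>x. X \<le> x \<Longrightarrow> P x \<le> 0"
  shows "V / \<beta> \<le> integral {0..X / \<beta>} F"
proof -
  have G: "has_bochner_integral lborel (\<lambda>t. indicator {0..} t *\<^sub>R (exp (- (\<beta> * t)\<^sup>2) * P (\<beta> * t))) (V / \<beta>)"
    unfolding P_def V_def by (rule gauss_poly_integral[OF assms(3)])
  have I: "integrable lborel (\<lambda>t. indicator {0..X / \<beta>} t *\<^sub>R F t)"
    using assms(4) by (intro borel_integrable_compact) auto
  have "V / \<beta> = (\<integral>t. indicator {0..} t *\<^sub>R (exp (- (\<beta> * t)\<^sup>2) * P (\<beta> * t)) \<partial>lborel)"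
    using G by (simp add: has_bochner_integral_integral_eq)
  also have "\<dots> \<le> (\<integral>t. indicator {0..X / \<beta>} t *\<^sub>R F t \<partial>lborel)"
  proof (rule integral_mono[OF _ I])
    show "integrable lborel (\<lambda>t. indicator {0..} t *\<^sub>R (exp (- (\<beta> * t)\<^sup>2) * P (\<beta> * t)))"
      using G by (rule integrable.intros)
    fix t :: real
    show "indicator {0..} t *\<^sub>R (exp (- (\<beta> * t)\<^sup>2) * P (\<beta> * t)) \<le> indicator {0..X / \<beta>} t *\<^sub>R F t"
    proof (cases "t \<le> X / \<beta>")
      case True
      then show ?thesis using F[of t] by (auto simp: indicator_def)
    next
      case False
      then have "X \<le> \<beta> * t" using assms(3) by (simp add: field_simps)
      then have "exp (- (\<beta> * t)\<^sup>2) * P (\<beta> * t) \<le> 0" using P by (simp add: mult_nonneg_nonpos)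
      then show ?thesis using False by (auto simp: indicator_def)
    qed
  qed
  also have "\<dots> = integral {0..X / \<beta>} F"
    using set_borel_integral_eq_integral(2)[of "{0..X / \<beta>}" F] I
    by (simp add: set_integrable_def set_lebesgue_integral_def)
  finally show ?thesis .
qed

lemma integral_cos_int:
  "integral {0..pi} (\<lambda>t. cos (of_int k * t)) = (if k = 0 then pi else 0)"
proof (cases "k = 0")
  case False
  have "((\<lambda>t. cos (of_int k * t)) has_integral (sin (of_int k * pi) / of_int k - sin (of_int k * 0) / of_int k)) {0..pi}"
    using False by (intro fundamental_theorem_of_calculus)
      (auto intro!: derivative_eq_intros simp flip: has_real_derivative_iff_has_vector_derivative)
  moreover have "sin (of_int k * pi) = 0" using sin_int_times_real sin_zero_iff_int2 by blast
  ultimately show ?thesis using False by (auto simp: integral_unique)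
qed simp

text \<open>Since n + 1/2 is the midpoint of the four indices, 8 * sin (t / 2) ^ 3 * sin ((l - n -
  1/2) * t) is a combination of four cosines of integer frequency with coefficients 1, -3, 3, -1,
  and integration over {0..pi} keeps frequency 0 only. Parts above N do not occur in partitions of
  numbers up to N, so the finite product is exact.\<close>

lemma tilted_difference_integral:
  fixes n N :: nat and s :: real
  assumes n: "1 \<le> n" "n + 2 \<le> N"
  defines "G \<equiv> \<lambda>t. \<Prod>j=1..N. 1 + of_real (exp (- (real j * s))) * cis (real j * t)"
  shows "integral {0..pi} (\<lambda>t. 8 * sin (t / 2) ^ 3 * Im (cis (- ((real n + 1/2) * t)) * G t))
    = pi * (real (q (n - 1)) * exp (- (real (n - 1) * s)) - 3 * real (q n) * exp (- (real n * s))
        + 3 * real (q (n + 1)) * exp (- (real (n + 1) * s)) - real (q (n + 2)) * exp (- (real (n + 2) * s)))"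
proof -
  define c where "c l m = (if int l = int m then 1 else 0 :: real)" for l m :: nat
  define w where "w S = exp (- (real (\<Sum>S) * s))" for S :: "nat set"
  have G: "G t = (\<Sum>S\<in>Pow {1..N}. of_real (w S) * cis (real (\<Sum>S) * t))" for t
  proof -
    have "G t = (\<Prod>j\<in>{1..N}. of_real (exp (- (real j * s))) * cis (real j * t) + 1)"
      unfolding G_def by (intro prod.cong refl add.commute)
    also have "\<dots> = (\<Sum>S\<in>Pow {1..N}. (\<Prod>j\<in>S. of_real (exp (- (real j * s))) * cis (real j * t)) * (\<Prod>j\<in>{1..N} - S. 1))"
      by (rule prod_add) simp
    also have "\<dots> = (\<Sum>S\<in>Pow {1..N}. of_real (w S) * cis (real (\<Sum>S) * t))"
    proof (intro sum.cong refl)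
      fix S assume "S \<in> Pow {1..N}"
      then have S: "finite S" using finite_subset by blast
      have "(\<Prod>j\<in>S. complex_of_real (exp (- (real j * s))) * cis (real j * t))
          = (\<Prod>j\<in>S. exp (of_real (- (real j * s)) + \<i> * of_real (real j * t)))"
        by (intro prod.cong refl) (simp only: cis_conv_exp exp_add exp_of_real)
      also have "\<dots> = exp (\<Sum>j\<in>S. of_real (- (real j * s)) + \<i> * of_real (real j * t))"
        using S by (simp add: exp_sum)
      also have "(\<Sum>j\<in>S. complex_of_real (- (real j * s)) + \<i> * of_real (real j * t))
          = of_real (- (real (\<Sum>S) * s)) + \<i> * of_real (real (\<Sum>S) * t)"
        by (simp add: sum.distrib sum_distrib_right sum_distrib_left sum_negf sum_subtractf)
      also have "exp \<dots> = of_real (w S) * cis (real (\<Sum>S) * t)"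
        by (simp only: w_def cis_conv_exp exp_add exp_of_real)
      finally show "(\<Prod>j\<in>S. complex_of_real (exp (- (real j * s))) * cis (real j * t)) * (\<Prod>j\<in>{1..N} - S. 1)
          = of_real (w S) * cis (real (\<Sum>S) * t)" by simp
    qed
    finally show ?thesis .
  qed
  have qs: "(\<Sum>S\<in>Pow {1..N}. w S * c (\<Sum>S) m) = real (q m) * exp (- (real m * s))" if "m \<le> N" for m
  proof -
    have "(\<Sum>S\<in>Pow {1..N}. w S * c (\<Sum>S) m) = (\<Sum>S\<in>Pow {1..N}. if \<Sum>S = m then exp (- (real m * s)) else 0)"
      by (intro sum.cong refl) (auto simp: c_def w_def simp del: of_nat_sum)
    also have "\<dots> = (\<Sum>S\<in>{S \<in> Pow {1..N}. \<Sum>S = m}. exp (- (real m * s)))"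
      by (rule sum.inter_filter[symmetric]) simp
    also have "\<dots> = real (q m) * exp (- (real m * s))"
      by (simp only: q_def distinct_partitions_eq[OF that] sum_constant)
    finally show ?thesis .
  qed
  define K where "K l t = cos (of_int (int l - int n + 1) * t) - 3 * cos (of_int (int l - int n) * t)
      + 3 * cos (of_int (int l - int n - 1) * t) - cos (of_int (int l - int n - 2) * t)" for l and t :: real
  have trig: "8 * sin (t / 2) ^ 3 * sin (real l * t - (real n + 1/2) * t) = K l t" for l t
  proof -
    define y where "y = t / 2"
    define B where "B = real l * t - (real n + 1/2) * t"
    have a: "of_int (int l - int n + 1) * t = B + 3 * y" "of_int (int l - int n) * t = B + y"
      "of_int (int l - int n - 1) * t = B - y" "of_int (int l - int n - 2) * t = B - 3 * y"
      by (simp_all add: B_def y_def algebra_simps)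
    have s3: "sin (3 * y) = 3 * sin y - 4 * sin y ^ 3"
    proof -
      have "sin (3 * y) = sin (2 * y + y)" by simp
      also have "\<dots> = 2 * sin y * (cos y * cos y) + (1 - 2 * sin y ^ 2) * sin y"
        by (simp only: sin_add sin_double cos_double_sin mult.assoc)
      also have "cos y * cos y = 1 - sin y ^ 2"
        using cos_squared_eq[of y] by (simp add: power2_eq_square)
      finally show ?thesis by (simp add: algebra_simps power2_eq_square power3_eq_cube)
    qed
    have "K l t = 2 * sin B * (3 * sin y - sin (3 * y))"
      unfolding K_def a by (simp add: cos_add cos_diff algebra_simps)
    then show ?thesis unfolding s3 y_def[symmetric] B_def[symmetric] by simp
  qed
  have "Im (cis (- ((real n + 1/2) * t)) * G t) = (\<Sum>S\<in>Pow {1..N}. w S * sin (real (\<Sum>S) * t - (real n + 1/2) * t))" for t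
  proof -
    have "cis (- ((real n + 1/2) * t)) * G t = (\<Sum>S\<in>Pow {1..N}. of_real (w S) * cis (real (\<Sum>S) * t - (real n + 1/2) * t))"
      unfolding G sum_distrib_left
      by (intro sum.cong refl) (simp add: cis_mult[symmetric] diff_conv_add_uminus mult_ac del: add_uminus_conv_diff)
    then show ?thesis by simp
  qed
  then have "8 * sin (t / 2) ^ 3 * Im (cis (- ((real n + 1/2) * t)) * G t) = (\<Sum>S\<in>Pow {1..N}. w S * K (\<Sum>S) t)" for t
    unfolding trig[symmetric] by (simp add: sum_distrib_left mult_ac)
  then have "integral {0..pi} (\<lambda>t. 8 * sin (t / 2) ^ 3 * Im (cis (- ((real n + 1/2) * t)) * G t))
      = integral {0..pi} (\<lambda>t. \<Sum>S\<in>Pow {1..N}. w S * K (\<Sum>S) t)" by simp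
  also have "\<dots> = (\<Sum>S\<in>Pow {1..N}. integral {0..pi} (\<lambda>t. w S * K (\<Sum>S) t))"
    unfolding K_def by (intro integral_sum integrable_continuous_interval continuous_intros) auto
  also have "\<dots> = (\<Sum>S\<in>Pow {1..N}. w S * (pi * (c (\<Sum>S) (n - 1) - 3 * c (\<Sum>S) n + 3 * c (\<Sum>S) (n + 1) - c (\<Sum>S) (n + 2))))"
  proof (intro sum.cong refl)
    fix S
    have ci: "(\<lambda>t. cos (of_int k * t)) integrable_on {0..pi}" for k
      by (intro integrable_continuous_interval continuous_intros)
    have "integral {0..pi} (K l) = integral {0..pi} (\<lambda>t. cos (of_int (int l - int n + 1) * t)) - 3 * integral {0..pi} (\<lambda>t. cos (of_int (int l - int n) * t))
      + 3 * integral {0..pi} (\<lambda>t. cos (of_int (int l - int n - 1) * t)) - integral {0..pi} (\<lambda>t. cos (of_int (int l - int n - 2) * t))" for l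
      unfolding K_def using ci
      by (simp only: integral_add integral_diff integrable_add integrable_diff integrable_on_mult_right integral_mult_right)
    then have "integral {0..pi} (K l) = pi * (c l (n - 1) - 3 * c l n + 3 * c l (n + 1) - c l (n + 2))" for l
      unfolding integral_cos_int c_def using n(1) by (auto simp: of_nat_diff)
    then show "integral {0..pi} (\<lambda>t. w S * K (\<Sum>S) t)
      = w S * (pi * (c (\<Sum>S) (n - 1) - 3 * c (\<Sum>S) n + 3 * c (\<Sum>S) (n + 1) - c (\<Sum>S) (n + 2)))" by simp
  qed
  also have "\<dots> = pi * ((\<Sum>S\<in>Pow {1..N}. w S * c (\<Sum>S) (n - 1)) - 3 * (\<Sum>S\<in>Pow {1..N}. w S * c (\<Sum>S) n)
      + 3 * (\<Sum>S\<in>Pow {1..N}. w S * c (\<Sum>S) (n + 1)) - (\<Sum>S\<in>Pow {1..N}. w S * c (\<Sum>S) (n + 2)))"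
    by (simp add: sum_distrib_left sum.distrib sum_subtractf algebra_simps)
  finally show ?thesis using n qs[of "n - 1"] qs[of n] qs[of "n + 1"] qs[of "n + 2"] by simp
qed

lemma exp_1_bounds: "2.716 \<le> exp (1::real)" "exp (1::real) \<le> 2.72"
proof -
  have "\<bar>exp 1 - 5837465777 / 2147483648\<bar> \<le> (1 / 4294967296 :: real)" using e_approx_32 by simp
  from abs_le_D2[OF this] show "2.716 \<le> exp (1::real)" by simp
  show "exp (1::real) \<le> 2.72" using e_less_272 by simp
qed

lemma exp_minus_le: "real m \<le> x \<Longrightarrow> exp (- x) \<le> 1 / 2.716 ^ m"
proof -
  assume m: "real m \<le> x"
  have "2.716 ^ m \<le> exp (1::real) ^ m" using exp_1_bounds by (intro power_mono) auto
  also have "\<dots> = exp (real m)" by (simp flip: exp_of_nat_mult)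
  also have "\<dots> \<le> exp x" using m by simp
  finally have "2.716 ^ m \<le> exp x" .
  then have "1 / exp x \<le> 1 / 2.716 ^ m" by (intro divide_left_mono) auto
  then show ?thesis by (simp add: exp_minus inverse_eq_divide)
qed

text \<open>y^m * exp (- E * y) decreases beyond m / E. With y = 1 / s this makes s = 1 / 72 the
  worst case of the layer estimates.\<close>

lemma power_exp_minus_le:
  fixes y y0 E :: real
  assumes "0 < y0" "y0 \<le> y" "real m \<le> E * y0"
  shows "y ^ m * exp (- (E * y)) \<le> y0 ^ m * exp (- (E * y0))"
proof -
  have "y / y0 \<le> exp (y / y0 - 1)" using exp_ge_add_one_self[of "y / y0 - 1"] by simp
  then have "(y / y0) ^ m \<le> exp (y / y0 - 1) ^ m" using assms by (intro power_mono) auto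
  also have "\<dots> = exp (real m * (y / y0 - 1))" by (simp flip: exp_of_nat_mult)
  also have "\<dots> \<le> exp (E * y0 * (y / y0 - 1))" using assms by (auto intro!: mult_right_mono)
  also have "E * y0 * (y / y0 - 1) = E * y - E * y0" using assms by (simp add: field_simps)
  finally have "y ^ m / y0 ^ m \<le> exp (E * y - E * y0)" by (simp add: power_divide)
  then have "y ^ m \<le> exp (E * y - E * y0) * y0 ^ m" using assms by (simp add: divide_le_eq)
  then have "y ^ m * exp (- (E * y)) \<le> exp (E * y - E * y0) * y0 ^ m * exp (- (E * y))"
    by (intro mult_right_mono) auto
  also have "\<dots> = y0 ^ m * (exp (E * y - E * y0) * exp (- (E * y)))" by simp
  also have "exp (E * y - E * y0) * exp (- (E * y)) = exp (- (E * y0))" by (simp add: mult_exp_exp)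
  finally show ?thesis .
qed

text \<open>The range must include 0.02127 * 81 = 1.723, the largest exponent d * x^4 for x \<le> 3.
  Beyond 1 the function (1 + y + y^2) * exp (- y) decreases, so checking the endpoint 7/4 is
  enough.\<close>

lemma exp_le_quadratic:
  fixes y :: real
  assumes "0 \<le> y" "y \<le> 7 / 4"
  shows "exp y \<le> 1 + y + y^2"
proof (cases "y \<le> 1")
  case True
  then show ?thesis using assms by (intro exp_bound) auto
next
  case False
  have "exp (7 / 4 :: real) \<le> 93 / 16"
  proof (rule power_le_imp_le_base[of _ 3])
    have "exp (7 / 4 :: real) ^ Suc 3 = exp 1 ^ 7" by (simp flip: exp_of_nat_mult)
    also have "\<dots> \<le> 2.72 ^ 7" using exp_1_bounds by (intro power_mono) auto
    also have "\<dots> \<le> (93 / 16) ^ Suc 3" by (simp add: eval_nat_numeral)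
    finally show "exp (7 / 4 :: real) ^ Suc 3 \<le> (93 / 16) ^ Suc 3" .
  qed simp
  then have 1: "1 \<le> (1 + 7/4 + (7/4)^2) * exp (- (7/4 :: real))"
    by (simp add: exp_minus power2_eq_square field_simps)
  have "(1 + 7/4 + (7/4)^2) * exp (- (7/4)) \<le> (1 + y + y^2) * exp (- y)"
  proof (rule DERIV_nonpos_imp_nonincreasing[OF assms(2)])
    fix x :: real assume "y \<le> x"
    then have "1 \<le> x" using False by simp
    then have "x * 1 \<le> x * x" by (intro mult_left_mono) auto
    then have "(x - x * x) * exp (- x) \<le> 0" by (intro mult_nonpos_nonneg) auto
    then show "\<exists>d. ((\<lambda>y. (1 + y + y^2) * exp (- y)) has_real_derivative d) (at x) \<and> d \<le> 0"
      by (intro exI[of _ "(x - x * x) * exp (- x)"])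
        (auto intro!: derivative_eq_intros simp: algebra_simps power2_eq_square)
  qed
  then have "1 \<le> (1 + y + y^2) * exp (- y)" using 1 by linarith
  then show ?thesis by (simp add: exp_minus field_simps)
qed

lemma fvar_square_le:
  assumes "0 \<le> x"
  shows "x^2 * fvar x \<le> 0.5424"
proof -
  have "exp (- x) / (1 + exp (- x))^2 \<le> exp (- x) / 1"
    by (intro divide_left_mono) (auto simp: power2_eq_square algebra_simps add_nonneg_nonneg intro!: mult_pos_pos add_pos_pos)
  then have "fvar x \<le> exp (- x)" by (simp add: fvar_def)
  then have "x^2 * fvar x \<le> x^2 * exp (- x)" by (intro mult_left_mono) auto
  also have "\<dots> = (x * exp (- (x / 2)))^2" by (simp add: power_mult_distrib power2_eq_square mult_exp_exp)
  also have "\<dots> \<le> (2 / exp 1)^2"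
  proof (intro power_mono)
    have "x / 2 \<le> exp (x / 2 - 1)" using exp_ge_add_one_self[of "x / 2 - 1"] by simp
    then have "x \<le> 2 * exp (x / 2) / exp 1" by (simp add: exp_diff mult.commute)
    then have "x * exp (- (x / 2)) \<le> 2 * exp (x / 2) / exp 1 * exp (- (x / 2))" by (intro mult_right_mono) auto
    also have "\<dots> = 2 / exp 1" by (simp add: exp_minus field_simps)
    finally show "x * exp (- (x / 2)) \<le> 2 / exp 1" .
  qed (use assms in auto)
  also have "\<dots> \<le> (2 / 2.716)^2" using exp_1_bounds by (intro power_mono divide_left_mono) auto
  also have "\<dots> \<le> 0.5424" by (simp add: power2_eq_square)
  finally show ?thesis .
qed

section \<open>Comparison of the characteristic function with a skewed Gaussian\<close>

definition Phi :: "nat \<Rightarrow> real \<Rightarrow> real \<Rightarrow> complex" where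
  "Phi N s t = (\<Prod>j=1..N. cfun (real j * s) (real j * t))"

text \<open>Scaled by half the variance, so that the Gaussian factor is exp (- (beta * t)^2) and x =
  beta * t is the natural variable.\<close>

definition beta :: "nat \<Rightarrow> real \<Rightarrow> real" where "beta N s = sqrt (Var N s / 2)"

locale tilt =
  fixes s :: real and N :: nat
  assumes s: "0 < s" "s \<le> 1 / 72" and N: "40 \<le> real N * s"
begin

abbreviation "\<beta> \<equiv> beta N s"
text \<open>\<open>g\<close> and \<open>d\<close> are the skewness and the fourth-order error in the
  variable x = \<beta> * t. They are of order sqrt s and s; their numerical bounds are the values at
  s = 1 / 72.\<close>

definition "g = Skew N s / (6 * \<beta>^3)"
definition "d = Fourth N s / (24 * \<beta>^4)"

lemma beta_sq: "\<beta>^2 = Var N s / 2" "0.81 / s^3 \<le> \<beta>^2" "\<beta>^2 \<le> 1.005 / s^3"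
proof -
  have V: "1.62 / s^3 \<le> Var N s" "Var N s \<le> 2.01 / s^3" using Var_ge[OF s N] Var_le[OF s] by auto
  moreover have "0 < 1.62 / s^3" using s by simp
  ultimately have "0 \<le> Var N s" by linarith
  then show b: "\<beta>^2 = Var N s / 2" by (simp add: beta_def)
  show "0.81 / s^3 \<le> \<beta>^2" "\<beta>^2 \<le> 1.005 / s^3" unfolding b using V by auto
qed

lemma beta_pos: "0 < \<beta>"
proof -
  have "0 < 0.81 / s^3" using s by simp
  then have "0 < Var N s" using beta_sq(1,2) by linarith
  then show ?thesis by (simp add: beta_def)
qed

lemma beta_4_le: "\<beta>^4 \<le> 1.0101 / s^6"
proof -
  have "(\<beta>^2)^2 \<le> (1.005 / s^3)^2" using beta_sq(3) by (intro power_mono) auto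
  also have "\<dots> = 1.010025 / s^6" by (simp add: power_divide power2_eq_square flip: power_mult power_add)
  also have "\<dots> \<le> 1.0101 / s^6" using s by (intro divide_right_mono) auto
  finally show ?thesis by (simp flip: power_mult)
qed

lemma g_bounds: "0 \<le> g" "g \<le> 0.1361"
proof -
  have "0 \<le> Skew N s"
    unfolding Skew_def fskew_def using s by (intro sum_nonneg mult_nonneg_nonneg divide_nonneg_nonneg) auto
  then show "0 \<le> g" unfolding g_def using beta_pos by simp
  have "0.9 / (s * sqrt s) \<le> \<beta>"
  proof (rule power2_le_imp_le)
    have "(s * sqrt s)^2 = s^3" using s by (simp add: power_mult_distrib power2_eq_square power3_eq_cube)
    then have "(0.9 / (s * sqrt s))^2 = 0.81 / s^3" unfolding power_divide by (simp add: power2_eq_square)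
    then show "(0.9 / (s * sqrt s))^2 \<le> \<beta>^2" using beta_sq(2) by simp
  qed (use beta_pos in simp)
  then have "(0.9 / (s * sqrt s))^3 \<le> \<beta>^3" using s by (intro power_mono) auto
  moreover have "(0.9 / (s * sqrt s))^3 = 0.729 / (s^4 * sqrt s)"
    using s by (simp add: power_divide power_mult_distrib power3_eq_cube eval_nat_numeral)
  ultimately have b3: "0.729 / (s^4 * sqrt s) \<le> \<beta>^3" by simp
  have "g \<le> (5.05 / s^4) / (6 * \<beta>^3)" unfolding g_def using Skew_le[OF s] beta_pos by (intro divide_right_mono) auto
  also have "\<dots> \<le> (5.05 / s^4) / (6 * (0.729 / (s^4 * sqrt s)))"
    using beta_pos s by (intro divide_left_mono mult_left_mono b3 mult_pos_pos) auto
  also have "\<dots> = 5.05 / 4.374 * sqrt s" using s by (simp add: field_simps)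
  also have "sqrt s \<le> 0.11786"
    using s by (intro real_le_lsqrt) (auto simp: power2_eq_square)
  finally show "g \<le> 0.1361" by simp
qed

lemma d_bounds: "0 \<le> d" "d \<le> 0.02127"
proof -
  have "0 \<le> Fourth N s" unfolding Fourth_def by (intro sum_nonneg mult_nonneg_nonneg fvar_nonneg) auto
  then show "0 \<le> d" by (simp add: d_def)
  have "(0.81 / s^3)^2 \<le> (\<beta>^2)^2" using beta_sq(2) s by (intro power_mono) auto
  then have b4: "0.6561 / s^6 \<le> \<beta>^4" by (simp add: power_divide flip: power_mult)
  have "d \<le> (24.1 / s^5) / (24 * \<beta>^4)" unfolding d_def using Fourth_le[OF s] beta_pos by (intro divide_right_mono) auto
  also have "\<dots> \<le> (24.1 / s^5) / (24 * (0.6561 / s^6))"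
    using beta_pos s by (intro divide_left_mono mult_left_mono b4 mult_pos_pos) auto
  also have "\<dots> = 24.1 / 15.7464 * s" using s by (simp add: field_simps eval_nat_numeral)
  finally show "d \<le> 0.02127" using s by simp
qed

lemma g_eq: "Skew N s * t^3 / 6 = g * (\<beta> * t)^3"
  using beta_pos by (simp add: g_def power_mult_distrib)

lemma d_eq: "Fourth N s * t^4 / 24 = d * (\<beta> * t)^4"
  using beta_pos by (simp add: d_def power_mult_distrib)

lemma Var_eq: "Var N s * t^2 / 2 = (\<beta> * t)^2"
  using beta_sq(1) by (simp add: power_mult_distrib)

text \<open>An exponent valid for both \<open>cfun\<close> and \<open>gfun\<close>, as the exchange
  of factors demands; it comes from 1 - cos y \<ge> y^2 / 2 - y^4 / 24.\<close>

definition "hj t j = fvar (real j * s) * (real j * t)^2 / 2 - fvar (real j * s) * (real j * t)^4 / 24"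

lemma sum_hj: "(\<Sum>j=1..N. hj t j) = (\<beta> * t)^2 - d * (\<beta> * t)^4"
proof -
  have "(\<Sum>j=1..N. hj t j) = Var N s * t^2 / 2 - Fourth N s * t^4 / 24"
    unfolding hj_def Var_def Fourth_def sum_subtractf sum_distrib_right sum_divide_distrib
    by (simp add: power_mult_distrib mult_ac)
  then show ?thesis by (simp add: Var_eq d_eq)
qed

lemma cfun_le_hj: "cmod (cfun (real j * s) (real j * t)) \<le> exp (- hj t j)"
proof -
  have "hj t j \<le> fvar (real j * s) * (1 - cos (real j * t))"
    using mult_left_mono[OF cos_le_quartic[of "real j * t"] fvar_nonneg[of "real j * s"]]
    by (simp add: hj_def algebra_simps)
  then show ?thesis using cmod_cfun_le[of "real j * s" "real j * t"]
    by (meson exp_le_cancel_iff neg_le_iff_le order_trans)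
qed

lemma cmod_gfun: "cmod (gfun x a) = exp (- (fvar x * a^2 / 2))"
  by (simp add: gfun_def norm_exp_eq_Re)

lemma gfun_le_hj: "cmod (gfun (real j * s) (real j * t)) \<le> exp (- hj t j)"
  unfolding cmod_gfun hj_def using fvar_nonneg[of "real j * s"] by simp

lemma Phi_le: "cmod (Phi N s t) \<le> exp (- ((\<beta> * t)^2 - d * (\<beta> * t)^4))"
proof -
  have "cmod (Phi N s t) = (\<Prod>j=1..N. cmod (cfun (real j * s) (real j * t)))"
    by (simp add: Phi_def prod_norm)
  also have "\<dots> \<le> (\<Prod>j=1..N. exp (- hj t j))" by (intro prod_mono) (simp add: cfun_le_hj)
  also have "\<dots> = exp (- ((\<beta> * t)^2 - d * (\<beta> * t)^4))"
    unfolding sum_hj[symmetric] by (simp add: exp_sum sum_negf[symmetric])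
  finally show ?thesis .
qed

lemma prod_gfun: "(\<Prod>j=1..N. gfun (real j * s) (real j * t))
    = of_real (exp (- (\<beta> * t)\<^sup>2)) * cis (- (g * (\<beta> * t)^3))"
proof -
  have "(\<Prod>j=1..N. gfun (real j * s) (real j * t))
      = exp (\<Sum>j=1..N. - (complex_of_real (fvar (real j * s) * (real j * t)^2 / 2) + \<i> * of_real (fskew (real j * s) * (real j * t)^3 / 6)))"
    unfolding gfun_def by (simp add: exp_sum)
  also have "(\<Sum>j=1..N. - (complex_of_real (fvar (real j * s) * (real j * t)^2 / 2) + \<i> * of_real (fskew (real j * s) * (real j * t)^3 / 6)))
      = of_real (- (\<Sum>j=1..N. fvar (real j * s) * (real j * t)^2 / 2)) + \<i> * of_real (- (\<Sum>j=1..N. fskew (real j * s) * (real j * t)^3 / 6))"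
    unfolding of_real_minus of_real_sum sum_negf[symmetric] sum_distrib_left sum.distrib[symmetric]
    by (intro sum.cong refl) simp
  also have "(\<Sum>j=1..N. fvar (real j * s) * (real j * t)^2 / 2) = (\<beta> * t)^2"
    unfolding Var_eq[symmetric] Var_def sum_distrib_right sum_divide_distrib
    by (intro sum.cong refl) (simp add: power_mult_distrib mult_ac)
  also have "(\<Sum>j=1..N. fskew (real j * s) * (real j * t)^3 / 6) = g * (\<beta> * t)^3"
    unfolding g_eq[symmetric] Skew_def sum_distrib_right sum_divide_distrib
    by (intro sum.cong refl) (simp add: power_mult_distrib mult_ac)
  also have "exp (of_real (- (\<beta> * t)\<^sup>2) + \<i> * of_real (- (g * (\<beta> * t)^3)))
      = of_real (exp (- (\<beta> * t)\<^sup>2)) * cis (- (g * (\<beta> * t)^3))"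
    by (simp only: exp_add exp_of_real cis_conv_exp)
  finally show ?thesis .
qed

lemma Phi_approx:
  assumes t: "0 \<le> t" "\<beta> * t \<le> 3"
  shows "cmod (Phi N s t - of_real (exp (- (\<beta> * t)\<^sup>2)) * cis (- (g * (\<beta> * t)^3)))
    \<le> 1.08 * d * (\<beta> * t)^4 * exp (- (\<beta> * t)\<^sup>2) * (1 + d * (\<beta> * t)^4 + (d * (\<beta> * t)^4)^2)"
proof -
  define x where "x = \<beta> * t"
  have x: "0 \<le> x" "x \<le> 3" using t beta_pos by (auto simp: x_def)
  \<comment> \<open>For x \<le> 3 one has t^2 / s^2 \<le> 9 / 0.81 / 72, about 0.1543, and y^2 *
    fvar y \<le> 0.5424; their product is below 0.084.\<close>
  define \<tau> where "\<tau> = (0.084 :: real)"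
  have \<tau>: "fvar (real j * s) * (real j * t)^2 \<le> \<tau>" for j
  proof -
    have "x^2 \<le> 3^2" using x by (intro power_mono) auto
    then have "t^2 * \<beta>^2 \<le> 9" by (simp add: x_def power_mult_distrib mult.commute)
    moreover have "t^2 * (0.81 / s^3) \<le> t^2 * \<beta>^2" using beta_sq(2) by (intro mult_left_mono) auto
    ultimately have "t^2 * (0.81 / s^3) \<le> 9" by linarith
    then have "t^2 \<le> 9 / 0.81 * s^3" using s by (simp add: field_simps)
    then have "t^2 / s^2 \<le> 9 / 0.81 * s" using s by (simp add: field_simps power2_eq_square power3_eq_cube)
    then have ts: "t^2 / s^2 \<le> 0.1544" using s by simp
    have "fvar (real j * s) * (real j * t)^2 = (real j * s)^2 * fvar (real j * s) * (t^2 / s^2)"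
      using s by (simp add: power_mult_distrib)
    also have "\<dots> \<le> 0.5424 * 0.1544"
      using ts s fvar_square_le[of "real j * s"] fvar_nonneg[of "real j * s"] by (intro mult_mono) auto
    finally show ?thesis by (simp add: \<tau>_def)
  qed
  have "cmod ((\<Prod>j=1..N. cfun (real j * s) (real j * t)) - (\<Prod>j=1..N. gfun (real j * s) (real j * t)))
    \<le> exp (- (\<Sum>j=1..N. hj t j)) * (\<Sum>j=1..N. cmod (cfun (real j * s) (real j * t) - gfun (real j * s) (real j * t)) * exp (hj t j))"
    by (rule norm_prod_diff_le) (auto simp: cfun_le_hj gfun_le_hj)
  \<comment> \<open>The factor 1.08 absorbs exp (\<tau> / 2) \<le> 1.0438 from the exchanged factor
    and 1 + \<tau> / 3 from \<open>cmod_cfun_gfun\<close>.\<close>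
  also have "(\<Sum>j=1..N. cmod (cfun (real j * s) (real j * t) - gfun (real j * s) (real j * t)) * exp (hj t j))
      \<le> (\<Sum>j=1..N. fvar (real j * s) * (real j * t)^4 / 24 * 1.08)"
  proof (intro sum_mono)
    fix j
    have "0 \<le> fvar (real j * s) * (real j * t)^4" by (intro mult_nonneg_nonneg fvar_nonneg) auto
    then have "hj t j \<le> \<tau> / 2" using \<tau>[of j] by (simp add: hj_def)
    then have "exp (hj t j) \<le> exp (\<tau> / 2)" by simp
    also have "\<dots> \<le> 1 + \<tau> / 2 + (\<tau> / 2)^2" by (intro exp_bound) (auto simp: \<tau>_def)
    finally have 1: "exp (hj t j) \<le> 1.0438" by (simp add: \<tau>_def power2_eq_square)
    have "cmod (cfun (real j * s) (real j * t) - gfun (real j * s) (real j * t)) * exp (hj t j)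
      \<le> (fvar (real j * s) * (real j * t)^4 / 24 * (1 + \<tau> / 3)) * 1.0438"
      using cmod_cfun_gfun[OF _ \<tau>[of j]] s 1 fvar_nonneg[of "real j * s"]
      by (intro mult_mono) (auto simp: \<tau>_def)
    also have "\<dots> \<le> fvar (real j * s) * (real j * t)^4 / 24 * 1.08"
      using fvar_nonneg[of "real j * s"] unfolding mult.assoc by (intro mult_left_mono) (auto simp: \<tau>_def)
    finally show "cmod (cfun (real j * s) (real j * t) - gfun (real j * s) (real j * t)) * exp (hj t j)
      \<le> fvar (real j * s) * (real j * t)^4 / 24 * 1.08" .
  qed
  also have "(\<Sum>j=1..N. fvar (real j * s) * (real j * t)^4 / 24 * 1.08) = 1.08 * d * x^4"
    unfolding x_def mult.assoc d_eq[symmetric] Fourth_def sum_distrib_right sum_distrib_left sum_divide_distrib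
    by (intro sum.cong refl) (simp add: power_mult_distrib mult_ac)
  also have "exp (- (\<Sum>j=1..N. hj t j)) = exp (- x\<^sup>2) * exp (d * x^4)"
    unfolding sum_hj x_def[symmetric] mult_exp_exp by simp
  finally have "cmod ((\<Prod>j=1..N. cfun (real j * s) (real j * t)) - (\<Prod>j=1..N. gfun (real j * s) (real j * t)))
     \<le> exp (- x\<^sup>2) * exp (d * x^4) * (1.08 * d * x^4)" by (simp add: mult_left_mono)
  also have "\<dots> \<le> exp (- x\<^sup>2) * (1 + d * x^4 + (d * x^4)^2) * (1.08 * d * x^4)"
  proof (intro mult_right_mono mult_left_mono exp_le_quadratic)
    have "x^4 \<le> 3^4" using x by (intro power_mono) auto
    then have "d * x^4 \<le> 0.02127 * 81" using d_bounds by (intro mult_mono) auto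
    then show "d * x^4 \<le> 7 / 4" by simp
  qed (use d_bounds in auto)
  finally show ?thesis
    unfolding prod_gfun Phi_def[symmetric] x_def[symmetric] by (simp add: mult_ac)
qed

end

lemma abs_cos_diff_le: "\<bar>cos x - cos y\<bar> \<le> \<bar>x - y :: real\<bar>"
proof -
  have "\<bar>cos x - cos y\<bar> = 2 * (\<bar>sin ((x + y) / 2)\<bar> * \<bar>sin ((y - x) / 2)\<bar>)"
    by (simp add: cos_diff_cos abs_mult)
  also have "\<dots> \<le> 2 * (1 * \<bar>(y - x) / 2\<bar>)"
    by (intro mult_left_mono mult_mono abs_sin_x_le_abs_x) auto
  finally show ?thesis by simp
qed

lemma sin_shift_ge:
  fixes A w e :: real
  assumes "\<bar>e\<bar> = 1" "0 \<le> w"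
  shows "sin A - e * w * cos A - w^2 / 2 \<le> sin (A - e * w)"
proof -
  have "sin (A - e * 0) - (sin A - e * 0 * cos A - 0^2 / 2) \<le> sin (A - e * w) - (sin A - e * w * cos A - w^2 / 2)"
  proof (rule DERIV_nonneg_imp_nondecreasing[OF assms(2)])
    fix x :: real assume x: "0 \<le> x"
    have "\<bar>e * (cos A - cos (A - e * x))\<bar> \<le> \<bar>e\<bar> * \<bar>A - (A - e * x)\<bar>"
      unfolding abs_mult by (intro mult_left_mono abs_cos_diff_le) auto
    then have "\<bar>e * (cos A - cos (A - e * x))\<bar> \<le> x" using assms(1) x by (simp add: abs_mult)
    then show "\<exists>d. ((\<lambda>w. sin (A - e * w) - (sin A - e * w * cos A - w^2 / 2)) has_real_derivative d) (at x) \<and> 0 \<le> d"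
      by (intro exI[of _ "e * (cos A - cos (A - e * x)) + x"])
        (auto intro!: derivative_eq_intros simp: algebra_simps)
  qed
  then show ?thesis by simp
qed

text \<open>The lower bound is Bernoulli's inequality (1 - w)^3 \<ge> 1 - 3 * w applied to sin y
  \<ge> y * (1 - w) with w = y^2 / 6.\<close>

lemma sin_cube_bounds:
  assumes "0 \<le> t" "t \<le> pi"
  shows "0 \<le> 8 * sin (t / 2) ^ 3" "8 * sin (t / 2) ^ 3 \<le> t^3" "t^3 - t^5 / 8 \<le> 8 * sin (t / 2) ^ 3"
proof -
  define y where "y = t / 2"
  have y: "0 \<le> y" "y \<le> 2" using assms pi_less_4 by (auto simp: y_def)
  have sy: "0 \<le> sin y" using assms by (intro sin_ge_zero) (auto simp: y_def)
  show "0 \<le> 8 * sin (t / 2) ^ 3" using sy by (simp add: y_def)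
  have "sin y ^ 3 \<le> y^3" using sy y by (intro power_mono sin_x_le_x)
  then show "8 * sin (t / 2) ^ 3 \<le> t^3" by (simp add: y_def power_divide)
  define w where "w = y^2 / 6"
  have yw: "y - y^3 / 6 = y * (1 - w)" by (simp add: w_def right_diff_distrib power2_eq_square power3_eq_cube)
  have "y^2 \<le> 2^2" using y by (intro power_mono) auto
  then have w: "0 \<le> w" "w \<le> 1" by (auto simp: w_def)
  have "0 \<le> w^2 * (3 - w)" using w by simp
  also have "\<dots> = (1 - w)^3 - (1 - 3 * w)" by (simp add: power2_eq_square power3_eq_cube algebra_simps)
  finally have "y^3 * (1 - 3 * w) \<le> y^3 * (1 - w)^3" using y by (intro mult_left_mono) auto
  also have "\<dots> = (y - y^3 / 6)^3" unfolding yw by (simp add: power_mult_distrib)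
  also have "\<dots> \<le> sin y ^ 3"
  proof (intro power_mono sin_ge_cubic y)
    show "0 \<le> y - y^3 / 6" unfolding yw using y w by simp
  qed
  finally have "y^3 * (1 - 3 * w) \<le> sin y ^ 3" .
  then show "t^3 - t^5 / 8 \<le> 8 * sin (t / 2) ^ 3"
    by (simp add: w_def y_def power_divide right_diff_distrib power2_eq_square power3_eq_cube eval_nat_numeral)
qed

lemma continuous_on_Phi: "continuous_on A (Phi N s)"
proof -
  have "continuous_on A (\<lambda>t. cfun x (k * t))" for x k
  proof -
    define K where "K = 1 / (1 + complex_of_real (exp (- x)))"
    have "cfun x (k * t) = K * (1 + of_real (exp (- x)) * cis (k * t)) * cis (- (fermi x * (k * t)))" for t
      by (simp add: cfun_def K_def)
    then show ?thesis by (auto intro!: continuous_intros)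
  qed
  then show ?thesis unfolding Phi_def[abs_def] by (intro continuous_on_prod)
qed

section \<open>The Fourier integrand near the origin and in layers\<close>

context tilt
begin

definition F :: "real \<Rightarrow> real \<Rightarrow> real" where
  "F \<mu> t = 8 * sin (t / 2) ^ 3 * Im (cis (\<mu> * t) * Phi N s t)"

lemma continuous_on_F: "continuous_on A (F \<mu>)"
  unfolding F_def[abs_def] by (intro continuous_intros continuous_on_Phi) auto

lemma F_integrable: "F \<mu> integrable_on {x..y}"
  by (intro integrable_continuous_interval continuous_on_F)

lemma abs_F_le: "0 \<le> t \<Longrightarrow> t \<le> pi \<Longrightarrow> \<bar>F \<mu> t\<bar> \<le> 8 * sin (t / 2) ^ 3 * cmod (Phi N s t)"
proof -
  assume t: "0 \<le> t" "t \<le> pi"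
  have "\<bar>Im (cis (\<mu> * t) * Phi N s t)\<bar> \<le> cmod (Phi N s t)"
    by (metis abs_Im_le_cmod mult_1 norm_cis norm_mult)
  then show ?thesis unfolding F_def abs_mult using sin_cube_bounds(1)[OF t] by (intro mult_mono) auto
qed

lemma layer_bound:
  assumes "0 \<le> x" "x \<le> y" "y \<le> pi" "\<And>t. x \<le> t \<Longrightarrow> t \<le> y \<Longrightarrow> cmod (Phi N s t) \<le> B" "0 \<le> B"
  shows "\<bar>integral {x..y} (F \<mu>)\<bar> \<le> B * y^4 / 4"
proof -
  have I: "((\<lambda>t. B * t^3) has_integral (B * y^4 / 4 - B * x^4 / 4)) {x..y}"
    using assms(2) by (intro fundamental_theorem_of_calculus)
      (auto intro!: derivative_eq_intros simp flip: has_real_derivative_iff_has_vector_derivative)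
  have "norm (integral {x..y} (F \<mu>)) \<le> integral {x..y} (\<lambda>t. B * t^3)"
  proof (rule integral_norm_bound_integral[OF F_integrable])
    show "(\<lambda>t. B * t^3) integrable_on {x..y}" using I by blast
    fix t assume t: "t \<in> {x..y}"
    then have t': "0 \<le> t" "t \<le> pi" using assms by auto
    have "\<bar>F \<mu> t\<bar> \<le> 8 * sin (t / 2) ^ 3 * cmod (Phi N s t)" by (rule abs_F_le[OF t'])
    also have "\<dots> \<le> t^3 * B"
      using t assms(4,5) sin_cube_bounds[OF t'] t' by (intro mult_mono) auto
    finally show "norm (F \<mu> t) \<le> B * t^3" by (simp add: mult.commute)
  qed
  also have "\<dots> = B * y^4 / 4 - B * x^4 / 4" using I by (rule integral_unique)
  also have "\<dots> \<le> B * y^4 / 4" using assms by simp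
  finally show ?thesis by simp
qed

lemma gaussian_layer_bound:
  assumes "0 \<le> x" "x \<le> y" "y \<le> pi" "0 < k"
    "\<And>t. x \<le> t \<Longrightarrow> t \<le> y \<Longrightarrow> cmod (Phi N s t) \<le> exp (- (k * (\<beta> * t)\<^sup>2))"
  shows "\<bar>integral {x..y} (F \<mu>)\<bar> \<le> (k * (\<beta> * x)^2 + 1) / (2 * k^2 * \<beta>^4) * exp (- (k * (\<beta> * x)\<^sup>2))"
proof -
  \<comment> \<open>An antiderivative of t^3 * exp (- k * (\<beta> * t)^2), obtained by
    parts.\<close>
  define G where "G t = - ((k * (\<beta> * t)^2 + 1) / (2 * k^2 * \<beta>^4) * exp (- (k * (\<beta> * t)\<^sup>2)))" for t
  have I: "((\<lambda>t. t^3 * exp (- (k * (\<beta> * t)\<^sup>2))) has_integral (G y - G x)) {x..y}"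
  proof (rule fundamental_theorem_of_calculus[OF assms(2)])
    fix t
    have "(G has_real_derivative (t^3 * exp (- (k * (\<beta> * t)\<^sup>2)))) (at t within {x..y})"
      unfolding G_def[abs_def] using assms(4) beta_pos
      by (auto intro!: derivative_eq_intros simp: field_simps eval_nat_numeral)
    then show "(G has_vector_derivative (t^3 * exp (- (k * (\<beta> * t)\<^sup>2)))) (at t within {x..y})"
      by (simp add: has_real_derivative_iff_has_vector_derivative)
  qed
  have "norm (integral {x..y} (F \<mu>)) \<le> integral {x..y} (\<lambda>t. t^3 * exp (- (k * (\<beta> * t)\<^sup>2)))"
  proof (rule integral_norm_bound_integral[OF F_integrable])
    show "(\<lambda>t. t^3 * exp (- (k * (\<beta> * t)\<^sup>2))) integrable_on {x..y}" using I by blast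
    fix t assume t: "t \<in> {x..y}"
    then have t': "0 \<le> t" "t \<le> pi" using assms by auto
    have "\<bar>F \<mu> t\<bar> \<le> 8 * sin (t / 2) ^ 3 * cmod (Phi N s t)" by (rule abs_F_le[OF t'])
    also have "\<dots> \<le> t^3 * exp (- (k * (\<beta> * t)\<^sup>2))"
      using t assms(5) sin_cube_bounds[OF t'] t' by (intro mult_mono) auto
    finally show "norm (F \<mu> t) \<le> t^3 * exp (- (k * (\<beta> * t)\<^sup>2))" by simp
  qed
  also have "\<dots> = G y - G x" using I by (rule integral_unique)
  also have "\<dots> \<le> - G x" unfolding G_def using assms(4) by (simp add: add_nonneg_nonneg)
  finally show ?thesis by (simp add: G_def)
qed

text \<open>A polynomial minorant of sin (a * x - e * g * x^3) for e = 1 or e = - 1: Taylor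
  expansion in the skewness phase, with \<open>e * cos\<close> replaced by a majorant in even
  powers.\<close>

definition sin_lower :: "real \<Rightarrow> real \<Rightarrow> real \<Rightarrow> real \<Rightarrow> real \<Rightarrow> real" where
  "sin_lower a u0 u1 u2 x = a * x - (a * x)^3 / 6 - g * x^3 * (u0 + u1 * (a * x)^2 + u2 * (a * x)^4) - (g * x^3)^2 / 2"

text \<open>Multiplying the phase and the imaginary part by e treats both offsets at once: the
  Gaussian model contributes sin (a * x - e * g * x^3). The two subtracted terms pay for replacing 8
  * sin (t / 2)^3 by t^3 and for \<open>Phi_approx\<close>. The second claim controls the minorant
  outside the range x \<le> 3.\<close>

lemma main_pointwise:
  fixes a e u0 u1 u2 :: real
  assumes e: "\<bar>e\<bar> = 1" and a: "0 \<le> a"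
    and u: "\<And>A. 0 \<le> A \<Longrightarrow> e * cos A \<le> u0 + u1 * A^2 + u2 * A^4"
    and t: "0 \<le> t" "\<beta> * t \<le> 3" "t \<le> pi"
  defines "x \<equiv> \<beta> * t"
  shows "exp (- x\<^sup>2) * (x^3 * sin_lower a u0 u1 u2 x
      - x^5 / (8 * \<beta>^2) - 1.08 * d * x^7 * (1 + d * x^4 + (d * x^4)^2))
    \<le> \<beta>^3 * (e * F (e * a * \<beta>) t)"
    and "0 \<le> y \<Longrightarrow> sin_lower a u0 u1 u2 y \<le> 1"
proof -
  define L where "L = sin_lower a u0 u1 u2"
  have L: "L y \<le> sin (a * y - e * (g * y^3))" if y: "0 \<le> y" for y
  proof -
    have w: "0 \<le> g * y^3" using g_bounds(1) y by simp
    have "sin (a * y) - e * (g * y^3) * cos (a * y) - (g * y^3)^2 / 2 \<le> sin (a * y - e * (g * y^3))"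
      by (rule sin_shift_ge[OF e w])
    moreover have "a * y - (a * y)^3 / 6 \<le> sin (a * y)" using a y by (intro sin_ge_cubic) auto
    moreover have "g * y^3 * (e * cos (a * y)) \<le> g * y^3 * (u0 + u1 * (a * y)^2 + u2 * (a * y)^4)"
      using a y w by (intro mult_left_mono u) auto
    ultimately show ?thesis unfolding L_def sin_lower_def by (simp add: mult_ac)
  qed
  show "0 \<le> y \<Longrightarrow> sin_lower a u0 u1 u2 y \<le> 1"
    using L[of y] sin_le_one order_trans unfolding L_def by blast
  have x: "0 \<le> x" using t beta_pos by (simp add: x_def)
  define E where "E = exp (- x\<^sup>2)"
  define S where "S = sin (a * x - e * (g * x^3))"
  define err where "err = 1.08 * d * x^4 * E * (1 + d * x^4 + (d * x^4)^2)"
  define h where "h = 8 * sin (t / 2) ^ 3"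
  have h: "0 \<le> h" "h \<le> t^3" "t^3 - t^5 / 8 \<le> h" unfolding h_def using sin_cube_bounds[of t] t by auto
  have e2: "e = 1 \<or> e = - 1" using e by (auto simp: abs_if split: if_splits)
  have mu: "e * a * \<beta> * t = e * (a * x)" by (simp add: x_def)
  define R where "R = Phi N s t - of_real E * cis (- (g * x^3))"
  have "e * Im (cis (e * a * \<beta> * t) * Phi N s t) = e * Im (cis (e * (a * x)) * (of_real E * cis (- (g * x^3)))) + e * Im (cis (e * (a * x)) * R)"
    unfolding mu R_def by (simp add: algebra_simps)
  moreover have "e * Im (cis (e * (a * x)) * (of_real E * cis (- (g * x^3)))) = E * S"
  proof -
    have "cis (e * (a * x)) * (of_real E * cis (- (g * x^3))) = of_real E * cis (e * (a * x) - g * x^3)"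
      by (simp add: cis_mult mult.left_commute[of _ "of_real E"])
    then have "e * Im (cis (e * (a * x)) * (of_real E * cis (- (g * x^3)))) = E * (e * sin (e * (a * x) - g * x^3))"
      by (simp only:) simp
    also have "e * sin (e * (a * x) - g * x^3) = S"
    proof (cases "e = 1")
      case True
      then show ?thesis by (simp add: S_def)
    next
      case False
      then have e1: "e = - 1" using e2 by simp
      have "sin (- (a * x + g * x^3)) = - sin (a * x + g * x^3)" by (rule sin_minus)
      then show ?thesis by (simp add: S_def e1)
    qed
    finally show ?thesis .
  qed
  moreover have "- err \<le> e * Im (cis (e * (a * x)) * R)"
  proof -
    have "\<bar>e * Im (cis (e * (a * x)) * R)\<bar> \<le> cmod (cis (e * (a * x)) * R)"
      using e abs_Im_le_cmod[of "cis (e * (a * x)) * R"] by (simp only: abs_mult mult_1)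
    also have "\<dots> \<le> err"
      using Phi_approx[OF t(1,2)] unfolding x_def[symmetric] E_def[symmetric] R_def[symmetric] err_def by (simp add: norm_mult)
    finally show ?thesis by linarith
  qed
  ultimately have I: "E * S - err \<le> e * Im (cis (e * a * \<beta> * t) * Phi N s t)" by linarith
  have err0: "0 \<le> err" using d_bounds(1) by (auto simp: err_def E_def intro!: mult_nonneg_nonneg add_nonneg_nonneg)
  have "t^3 * (E * L x) - t^5 / 8 * E - t^3 * err \<le> h * (E * S) - h * err"
  proof -
    have "(t^3 - h) * S \<le> (t^3 - h) * 1" using h by (intro mult_left_mono) (auto simp: S_def)
    then have "t^3 * S - t^5 / 8 \<le> h * S" using h(3) by (simp add: algebra_simps)
    moreover have "t^3 * L x \<le> t^3 * S" using L[OF x] t by (intro mult_left_mono) (auto simp: S_def)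
    ultimately have "t^3 * L x - t^5 / 8 \<le> h * S" by linarith
    then have "(t^3 * L x - t^5 / 8) * E \<le> h * S * E" by (intro mult_right_mono) (auto simp: E_def)
    moreover have "h * err \<le> t^3 * err" using h err0 by (intro mult_right_mono) auto
    ultimately show ?thesis by (simp add: algebra_simps)
  qed
  also have "\<dots> = h * (E * S - err)" by (simp add: algebra_simps)
  also have "\<dots> \<le> h * (e * Im (cis (e * a * \<beta> * t) * Phi N s t))" using I h by (intro mult_left_mono) auto
  also have "\<dots> = e * F (e * a * \<beta>) t" by (simp add: F_def h_def)
  finally have "\<beta>^3 * (t^3 * (E * L x) - t^5 / 8 * E - t^3 * err) \<le> \<beta>^3 * (e * F (e * a * \<beta>) t)"
    using beta_pos by (intro mult_left_mono) auto
  also have "\<beta>^3 * (t^3 * (E * L x) - t^5 / 8 * E - t^3 * err)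
      = (\<beta> * t)^3 * (E * L x) - (\<beta> * t)^5 / (8 * \<beta>^2) * E - (\<beta> * t)^3 * err"
    using beta_pos by (simp add: power_mult_distrib field_simps eval_nat_numeral)
  also have "\<dots> = E * (x^3 * L x - x^5 / (8 * \<beta>^2) - 1.08 * d * x^7 * (1 + d * x^4 + (d * x^4)^2))"
    unfolding x_def[symmetric] err_def by (simp add: algebra_simps eval_nat_numeral)
  finally show "exp (- x\<^sup>2) * (x^3 * sin_lower a u0 u1 u2 x
      - x^5 / (8 * \<beta>^2) - 1.08 * d * x^7 * (1 + d * x^4 + (d * x^4)^2))
    \<le> \<beta>^3 * (e * F (e * a * \<beta>) t)"
    unfolding E_def L_def .
qed

end

section \<open>Decay of the characteristic function away from the origin\<close>

context tilt
begin

lemma Phi_le_gauss: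
  assumes "0 \<le> t" "t \<le> s / 2"
  shows "cmod (Phi N s t) \<le> exp (- (0.69 * (\<beta> * t)\<^sup>2))"
proof -
  have "d * \<beta>^2 = Fourth N s / (24 * \<beta>^2)" using beta_pos by (simp add: d_def eval_nat_numeral)
  also have "\<dots> \<le> (24.1 / s^5) / (24 * (0.81 / s^3))"
    using beta_pos s Fourth_le[OF s] beta_sq(2) by (intro frac_le mult_left_mono mult_pos_pos) auto
  also have "\<dots> = 24.1 / 19.44 / s^2" using s by (simp add: field_simps eval_nat_numeral)
  finally have db: "d * \<beta>^2 \<le> 24.1 / 19.44 / s^2" .
  have "t^2 \<le> (s / 2)^2" using assms by (intro power_mono) auto
  then have "d * \<beta>^2 * t^2 \<le> (24.1 / 19.44 / s^2) * (s^2 / 4)"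
    using db d_bounds(1) by (intro mult_mono) (auto simp: power_divide)
  also have "\<dots> \<le> 0.31" using s by simp
  finally have "(d * \<beta>^2 * t^2) * (\<beta> * t)^2 \<le> 0.31 * (\<beta> * t)^2" by (intro mult_right_mono) auto
  then have "0.69 * (\<beta> * t)^2 \<le> (\<beta> * t)^2 - d * (\<beta> * t)^4"
    by (simp add: power_mult_distrib eval_nat_numeral mult_ac)
  then show ?thesis using Phi_le[of t] by (meson exp_le_cancel_iff neg_le_iff_le order_trans)
qed

lemma Phi_le_middle:
  assumes "s / 2 \<le> t" "t \<le> 2 * s / 3"
  shows "cmod (Phi N s t) \<le> exp (- (0.139 * (1 / s)))"
proof -
  define u where "u = (t / s)^2"
  have "1 / 2 \<le> t / s" "t / s \<le> 2 / 3" using assms s by (auto simp: field_simps)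
  then have "(1 / 2)^2 \<le> u" "u \<le> (2 / 3)^2" unfolding u_def by (intro power_mono; linarith)+
  then have u: "1 / 4 \<le> u" "u \<le> 4 / 9" by (auto simp: power2_eq_square)
  have t2: "t^2 = u * s^2" using s by (simp add: u_def power_divide)
  have t4: "t^4 = u^2 * s^4" using s by (simp add: u_def power_divide flip: power_mult)
  have "0.139 \<le> 0.81 * u - 24.1 / 24 * u^2"
  proof -
    \<comment> \<open>The quadratic in u is concave, so u^2 is replaced by its chord over the
      interval and the minimum sits at the endpoint u = 1/4.\<close>
    have "0 \<le> (u - 1 / 4) * (4 / 9 - u)" using u by simp
    then have "u^2 \<le> (1/4 + 4/9) * u - 1 / 9" by (simp add: power2_eq_square field_simps)
    then show ?thesis using u by simp
  qed
  then have "0.139 * (1 / s) \<le> (0.81 * u - 24.1 / 24 * u^2) * (1 / s)" using s by (intro mult_right_mono) auto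
  also have "\<dots> = 0.81 / s^3 * t^2 - (24.1 / s^5) * t^4 / 24"
    unfolding t2 t4 using s by (simp add: field_simps eval_nat_numeral)
  also have "\<dots> \<le> \<beta>^2 * t^2 - Fourth N s * t^4 / 24"
    using beta_sq(2) Fourth_le[OF s] by (intro diff_mono divide_right_mono mult_right_mono) auto
  also have "\<dots> = (\<beta> * t)^2 - d * (\<beta> * t)^4" by (simp add: d_eq power_mult_distrib)
  finally show ?thesis using Phi_le[of t] by (meson exp_le_cancel_iff neg_le_iff_le order_trans)
qed

text \<open>The condition on E says E + 0.000001 \<le> fermi (1 / \<tau> + 1 / 36), where 1 / 36
  bounds 2 * s and the millionth covers the term at N * s \<ge> 40.\<close>

lemma Phi_le_minor:
  assumes \<tau>: "1 / 2 \<le> \<tau>" "\<tau> \<le> 8" and t: "\<tau> * s \<le> t" "t \<le> pi"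
    and E: "exp (1 / \<tau> + 1 / 36) * (E + 0.000001) + (E + 0.000001) \<le> 1" "0 \<le> E"
  shows "cmod (Phi N s t) \<le> exp (- (E * (1 / s)))"
proof -
  have "\<tau> * s \<le> 8 * (1 / 72)" using \<tau> s by (intro mult_mono) auto
  moreover have "1 / (\<tau> * s) + 1 \<le> real N"
  proof -
    have "1 / \<tau> \<le> 2" using \<tau> by (simp add: field_simps)
    then have "(1 / \<tau> + s) / s \<le> 40 / s" using s by (intro divide_right_mono) auto
    also have "\<dots> \<le> real N" using N s by (simp add: field_simps)
    finally show ?thesis using s \<tau> by (simp add: add_divide_distrib)
  qed
  ultimately have 1: "cmod (Phi N s t) \<le> exp (- ((fermi (1 / \<tau> + 2 * s) - fermi (real N * s)) / s))"
    unfolding Phi_def using \<tau> t s by (intro cmod_prod_cfun_minor) auto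
  have "fermi (real N * s) \<le> exp (- (real N * s))"
    by (simp add: fermi_def divide_le_eq add_pos_pos mult_le_cancel_left1)
  also have "\<dots> \<le> exp (- 40)" using N by simp
  also have "\<dots> \<le> 1 / 2.716 ^ 14" by (rule exp_minus_le) simp
  also have "\<dots> \<le> 0.000001" by (simp add: power_divide)
  finally have f: "fermi (real N * s) \<le> 0.000001" .
  have "E + 0.000001 \<le> 1 / (1 + exp (1 / \<tau> + 1 / 36))"
    using E(1) by (subst pos_le_divide_eq) (simp_all add: add_pos_pos distrib_left mult.commute[of "E + _"])
  also have "\<dots> = fermi (1 / \<tau> + 1 / 36)" by (simp add: fermi_conv)
  also have "\<dots> \<le> fermi (1 / \<tau> + 2 * s)" using s by (intro fermi_antimono) auto
  finally have "E / s \<le> (fermi (1 / \<tau> + 2 * s) - fermi (real N * s)) / s"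
    using f s by (intro divide_right_mono) auto
  then show ?thesis using 1 by (simp add: order_trans[OF 1])
qed

lemma inverse_s: "0 < (72::real)" "72 \<le> 1 / s"
  using s by (auto simp: field_simps)

text \<open>The layers cover the range beyond t = 3 / beta; all bounds are in units of beta ^ (-4).\<close>

lemma layer_bounds:
  shows "\<bar>integral {3 / \<beta>..s / 2} (F \<mu>)\<bar> \<le> 0.019 / \<beta>^4"
    and "\<bar>integral {s / 2..2 * s / 3} (F \<mu>)\<bar> \<le> 0.012 / \<beta>^4"
    and "\<bar>integral {2 * s / 3..5 * s / 4} (F \<mu>)\<bar> \<le> 0.02 / \<beta>^4"
    and "\<bar>integral {5 * s / 4..8 * s} (F \<mu>)\<bar> \<le> 0.012 / \<beta>^4"
    and "\<bar>integral {8 * s..pi} (F \<mu>)\<bar> \<le> 0.018 / \<beta>^4"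
    and "3 / \<beta> \<le> s / 2"
proof -
  have pi3: "3 < pi" by (rule pi_gt3)
  show b3: "3 / \<beta> \<le> s / 2"
  proof -
    have "36 * s \<le> 0.81" using s by simp
    then have "36 / s^2 \<le> 0.81 / s^3" using s by (simp add: field_simps power2_eq_square power3_eq_cube)
    then have "(6 / s)^2 \<le> \<beta>^2" using beta_sq(2) by (simp add: power_divide)
    then have "6 / s \<le> \<beta>" by (rule power2_le_imp_le) (use beta_pos in simp)
    then show ?thesis using s beta_pos by (simp add: field_simps)
  qed
  have "\<bar>integral {3 / \<beta>..s / 2} (F \<mu>)\<bar>
      \<le> (0.69 * (\<beta> * (3 / \<beta>))^2 + 1) / (2 * 0.69^2 * \<beta>^4) * exp (- (0.69 * (\<beta> * (3 / \<beta>))\<^sup>2))"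
  proof (rule gaussian_layer_bound)
    show x0: "0 \<le> 3 / \<beta>" using beta_pos by simp
    show "3 / \<beta> \<le> s / 2" by (rule b3)
    show "s / 2 \<le> pi" using s pi3 by simp
    show "cmod (Phi N s t) \<le> exp (- (0.69 * (\<beta> * t)\<^sup>2))" if "3 / \<beta> \<le> t" "t \<le> s / 2" for t
      using that x0 by (intro Phi_le_gauss) linarith+
  qed simp
  also have "\<dots> = 7.21 / 0.9522 * exp (- 6.21) / \<beta>^4" using beta_pos by (simp add: power2_eq_square)
  also have "\<dots> \<le> 0.019 / \<beta>^4"
  proof (intro divide_right_mono)
    have "exp (- 6.21) \<le> 1 / (2.716::real) ^ 6" by (rule exp_minus_le) simp
    then have "7.21 / 0.9522 * exp (- 6.21) \<le> 7.21 / 0.9522 * (1 / (2.716::real) ^ 6)" by (intro mult_left_mono) auto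
    also have "\<dots> \<le> 0.019" by (simp add: power_divide)
    finally show "7.21 / 0.9522 * exp (- 6.21) \<le> (0.019::real)" .
  qed (use beta_pos in auto)
  finally show "\<bar>integral {3 / \<beta>..s / 2} (F \<mu>)\<bar> \<le> 0.019 / \<beta>^4" .
  \<comment> \<open>After multiplication by \<beta>^4, which is at most 1.0101 / s^6, a layer with
    endpoints proportional to s costs (1 / s)^2 * exp (- E / s); m is the integer part of 72 *
    E.\<close>
  have layer: "\<bar>integral {x * s..y * s} (F \<mu>)\<bar> \<le> c / \<beta>^4"
    if xy: "0 \<le> x" "x \<le> y" "y \<le> 8" and E: "real m \<le> E * 72" "2 \<le> m"
      and P: "\<And>t. x * s \<le> t \<Longrightarrow> t \<le> y * s \<Longrightarrow> cmod (Phi N s t) \<le> exp (- (E * (1 / s)))"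
      and c: "1.0101 * y^4 / 4 * 72^2 / 2.716 ^ m \<le> c" for x y E c m
  proof -
    have "y * s \<le> 8 * (1 / 72)" using xy s by (intro mult_mono) auto
    then have "\<bar>integral {x * s..y * s} (F \<mu>)\<bar> \<le> exp (- (E * (1 / s))) * (y * s)^4 / 4"
      using xy s pi3 by (intro layer_bound P) (auto intro!: mult_right_mono)
    then have "\<beta>^4 * \<bar>integral {x * s..y * s} (F \<mu>)\<bar> \<le> 1.0101 / s^6 * (exp (- (E * (1 / s))) * (y * s)^4 / 4)"
      using beta_4_le s beta_pos by (intro mult_mono) auto
    also have "\<dots> = 1.0101 * y^4 / 4 * ((1 / s)^2 * exp (- (E * (1 / s))))"
      using s by (simp add: field_simps eval_nat_numeral)
    also have "\<dots> \<le> 1.0101 * y^4 / 4 * (72^2 * exp (- (E * 72)))"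
      using inverse_s E by (intro mult_left_mono power_exp_minus_le) auto
    also have "\<dots> \<le> 1.0101 * y^4 / 4 * (72^2 * (1 / 2.716 ^ m))"
      using E(1) by (intro mult_left_mono exp_minus_le) auto
    also have "\<dots> \<le> c" using c by simp
    finally show ?thesis using beta_pos by (simp add: pos_le_divide_eq mult.commute)
  qed
  have "\<bar>integral {1/2 * s..2/3 * s} (F \<mu>)\<bar> \<le> 0.012 / \<beta>^4"
  proof (rule layer[where m = 10 and E = "0.139"])
    fix t assume t: "1/2 * s \<le> t" "t \<le> 2/3 * s"
    show "cmod (Phi N s t) \<le> exp (- (0.139 * (1 / s)))"
      by (rule Phi_le_middle) (use t in auto)
  qed (auto simp: power_divide)
  then show "\<bar>integral {s / 2..2 * s / 3} (F \<mu>)\<bar> \<le> 0.012 / \<beta>^4" by simp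
  have e2: "exp (3 / 2 + 1 / 36 :: real) \<le> 4.92"
  proof -
    have "exp (3 / 2 + 1 / 36 :: real) = exp 1 * exp (19 / 36)" by (simp add: mult_exp_exp)
    also have "\<dots> \<le> 2.72 * (1 + 19 / 36 + (19 / 36)^2)"
      using exp_1_bounds by (intro mult_mono exp_bound) auto
    also have "\<dots> \<le> 4.92" by (simp add: power2_eq_square)
    finally show ?thesis .
  qed
  have "\<bar>integral {2/3 * s..5/4 * s} (F \<mu>)\<bar> \<le> 0.02 / \<beta>^4"
  proof (rule layer[where m = 12 and E = "0.168"])
    fix t assume t: "2/3 * s \<le> t" "t \<le> 5/4 * s"
    show "cmod (Phi N s t) \<le> exp (- (0.168 * (1 / s)))"
      by (rule Phi_le_minor[of "2/3"]) (use t s pi3 e2 in auto)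
  qed (auto simp: power_divide)
  then show "\<bar>integral {2 * s / 3..5 * s / 4} (F \<mu>)\<bar> \<le> 0.02 / \<beta>^4" by simp
  have e3: "exp (4 / 5 + 1 / 36 :: real) \<le> 2.514"
  proof -
    have "exp (4 / 5 + 1 / 36 :: real) \<le> 1 + (4 / 5 + 1 / 36) + (4 / 5 + 1 / 36)^2" by (intro exp_bound) auto
    also have "\<dots> \<le> 2.514" by (simp add: power2_eq_square)
    finally show ?thesis .
  qed
  have "\<bar>integral {5/4 * s..8 * s} (F \<mu>)\<bar> \<le> 0.012 / \<beta>^4"
  proof (rule layer[where m = 20 and E = "0.28"])
    fix t assume t: "5/4 * s \<le> t" "t \<le> 8 * s"
    show "cmod (Phi N s t) \<le> exp (- (0.28 * (1 / s)))"
      by (rule Phi_le_minor[of "5/4"]) (use t s pi3 e3 in auto)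
  qed (auto simp: power_divide)
  then show "\<bar>integral {5 * s / 4..8 * s} (F \<mu>)\<bar> \<le> 0.012 / \<beta>^4" by simp
  have e4: "exp (1 / 8 + 1 / 36 :: real) \<le> 1.1762"
  proof -
    have "exp (1 / 8 + 1 / 36 :: real) \<le> 1 + (1 / 8 + 1 / 36) + (1 / 8 + 1 / 36)^2" by (intro exp_bound) auto
    also have "\<dots> \<le> 1.1762" by (simp add: power2_eq_square)
    finally show ?thesis .
  qed
  have P: "cmod (Phi N s t) \<le> exp (- (0.459 * (1 / s)))" if "8 * s \<le> t" "t \<le> pi" for t
    by (rule Phi_le_minor[of 8]) (use that s pi3 e4 in auto)
  have s8: "8 * s \<le> pi" using s pi3 by simp
  \<comment> \<open>The endpoint pi does not scale with s, so the full power (1 / s)^6 remains. The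
    cube of the sine is simply bounded by 1, and the larger E outweighs the power.\<close>
  have "norm (integral {8 * s..pi} (F \<mu>)) \<le> integral {8 * s..pi} (\<lambda>t. 8 * exp (- (0.459 * (1 / s))))"
  proof (rule integral_norm_bound_integral[OF F_integrable])
    fix t assume t: "t \<in> {8 * s..pi}"
    then have t': "0 \<le> t" "t \<le> pi" using s by auto
    have "\<bar>F \<mu> t\<bar> \<le> 8 * sin (t / 2) ^ 3 * cmod (Phi N s t)" by (rule abs_F_le[OF t'])
    also have "\<dots> \<le> 8 * exp (- (0.459 * (1 / s)))"
    proof (intro mult_mono P)
      have "sin (t / 2) ^ 3 \<le> 1" using t' by (intro power_le_one sin_ge_zero) auto
      then show "8 * sin (t / 2) ^ 3 \<le> 8" by simp
    qed (use t in auto)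
    finally show "norm (F \<mu> t) \<le> 8 * exp (- (0.459 * (1 / s)))" by simp
  qed (use s8 in auto)
  also have "\<dots> \<le> 3.15 * (8 * exp (- (0.459 * (1 / s))))"
    using s8 s pi_approx by (simp add: integral_const) 
  finally have "\<beta>^4 * \<bar>integral {8 * s..pi} (F \<mu>)\<bar> \<le> 1.0101 / s^6 * (3.15 * (8 * exp (- (0.459 * (1 / s)))))"
    using beta_4_le s beta_pos by (intro mult_mono) auto
  also have "\<dots> = 25.45452 * ((1 / s)^6 * exp (- (0.459 * (1 / s))))" by (simp add: power_divide)
  also have "\<dots> \<le> 25.45452 * (72^6 * exp (- (0.459 * 72)))"
    using inverse_s by (intro mult_left_mono power_exp_minus_le) auto
  also have "\<dots> \<le> 25.45452 * (72^6 * (1 / 2.716 ^ 33))"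
    by (intro mult_left_mono exp_minus_le) auto
  also have "\<dots> \<le> 0.018" by (simp add: power_divide)
  finally show "\<bar>integral {8 * s..pi} (F \<mu>)\<bar> \<le> 0.018 / \<beta>^4" using beta_pos by (simp add: pos_le_divide_eq mult_ac)
qed

end

section \<open>Sign of the integral and choice of the tilt\<close>

context tilt
begin

lemma integral_sign:
  fixes e :: real
  assumes e: "\<bar>e\<bar> = 1"
  shows "0 < e * integral {0..pi} (F (e * (4 / 5) * \<beta>))"
proof -
  \<comment> \<open>At 4/5 the skewness is nearly neutral, 15/8 standing against 105/32 * a^2 = 2.1,
    so its coefficient stays below 0.28 for both signs, while the main term 3/4 * a - 15/8 * a^3 / 6
    = 0.44 is still large.\<close>
  define a :: real where "a = 4 / 5"
  define \<mu> where "\<mu> = e * a * \<beta>"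
  have "\<exists>u0 u1 u2. (\<forall>A\<ge>0. e * cos A \<le> u0 + u1 * A^2 + u2 * A^4)
      \<and> 15/8 * u0 + 105/16 * u1 * a^2 + 945/32 * u2 * a^4 \<le> 0.28"
  proof (cases "e = 1")
    case True
    have "\<forall>A\<ge>0. e * cos A \<le> 1 + (- 1 / 2) * A^2 + 1 / 24 * A^4" using True cos_le_quartic by simp
    moreover have "15/8 * 1 + 105/16 * (- 1 / 2) * a^2 + 945/32 * (1 / 24) * a^4 \<le> 0.28"
      by (simp add: a_def power_divide)
    ultimately show ?thesis by blast
  next
    case False
    then have "e = - 1" using e by (auto simp: abs_if split: if_splits)
    then have "e * cos A \<le> - 1 + 1 / 2 * A^2 + 0 * A^4" for A using cos_ge_quadratic[of A] by simp
    then have "\<forall>A\<ge>0. e * cos A \<le> - 1 + 1 / 2 * A^2 + 0 * A^4" by blast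
    moreover have "15/8 * (- 1) + 105/16 * (1 / 2) * a^2 + 945/32 * 0 * a^4 \<le> 0.28"
      by (simp add: a_def power_divide)
    ultimately show ?thesis by blast
  qed
  then obtain u0 u1 u2 where u: "\<And>A. 0 \<le> A \<Longrightarrow> e * cos A \<le> u0 + u1 * A^2 + u2 * A^4"
    and u_le: "15/8 * u0 + 105/16 * u1 * a^2 + 945/32 * u2 * a^4 \<le> 0.28" by blast
  define c4 where "c4 = a"
  define c5 where "c5 = - 1 / (8 * \<beta>^2)"
  define c6 where "c6 = - (a^3) / 6 - g * u0"
  define c7 where "c7 = - 1.08 * d"
  define c8 where "c8 = - g * u1 * a^2"
  define c9 where "c9 = - (g^2) / 2"
  define c10 where "c10 = - g * u2 * a^4"
  define c11 where "c11 = - 1.08 * d^2"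
  \<comment> \<open>The extra - 1 / 3^12 outweighs x^3 for x \<ge> 3, where the minorant of the sine
    is at most 1, and so makes P nonpositive there. In the integral it costs 2520 / 3^12, less than
    0.005.\<close>
  define c15 where "c15 = - 1.08 * d^3 - 1 / 3^12"
  note cs = c4_def c5_def c6_def c7_def c8_def c9_def c10_def c11_def c15_def
  define P where "P = gpoly c4 c5 c6 c7 c8 c9 c10 c11 c15"
  define V where "V = gval c4 c5 c6 c7 c8 c9 c10 c11 c15"
  define L where "L = sin_lower a u0 u1 u2"
  define Q where "Q x = x^3 * L x - x^5 / (8 * \<beta>^2) - 1.08 * d * x^7 * (1 + d * x^4 + (d * x^4)^2)" for x
  have PQ: "P x = Q x - x^15 / 3^12" for x
    unfolding P_def gpoly_def Q_def L_def sin_lower_def cs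
    by (simp add: power_mult_distrib algebra_simps eval_nat_numeral add_divide_distrib diff_divide_distrib)
  have a0: "0 \<le> a" by (simp add: a_def)
  note lb = layer_bounds
  have b: "3 / \<beta> \<le> s / 2" by (rule lb(6))
  have "V / \<beta> \<le> integral {0..3 / \<beta>} (\<lambda>t. \<beta>^3 * (e * F \<mu> t))"
    unfolding V_def
  proof (rule gauss_poly_lower[OF beta_pos])
    show "continuous_on {0..3 / \<beta>} (\<lambda>t. \<beta>^3 * (e * F \<mu> t))" by (intro continuous_intros continuous_on_F)
    fix t assume t: "0 \<le> t" "t \<le> 3 / \<beta>"
    have t2: "\<beta> * t \<le> 3" using t beta_pos by (simp add: field_simps)
    have t3: "t \<le> pi" using t b s pi_gt3 by linarith
    have x: "0 \<le> \<beta> * t" using t beta_pos by simp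
    have "P (\<beta> * t) \<le> Q (\<beta> * t)" unfolding PQ using x by simp
    then have "exp (- (\<beta> * t)\<^sup>2) * P (\<beta> * t) \<le> exp (- (\<beta> * t)\<^sup>2) * Q (\<beta> * t)"
      by (intro mult_left_mono) auto
    also have "\<dots> \<le> \<beta>^3 * (e * F \<mu> t)"
      unfolding \<mu>_def Q_def L_def by (rule main_pointwise(1)[OF e a0 u t(1) t2 t3])
    finally have "exp (- (\<beta> * t)\<^sup>2) * P (\<beta> * t) \<le> \<beta>^3 * (e * F \<mu> t)" .
    then show "exp (- (\<beta> * t)\<^sup>2) * gpoly c4 c5 c6 c7 c8 c9 c10 c11 c15 (\<beta> * t) \<le> \<beta>^3 * (e * F \<mu> t)"
      unfolding P_def .
  next
    fix x :: real assume x: "3 \<le> x"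
    have "L x \<le> 1"
      unfolding L_def by (rule main_pointwise(2)[OF e a0 u, where t = 0]) (use x in auto)
    then have "x^3 * L x \<le> x^3 * 1" using x by (intro mult_left_mono) auto
    moreover have "x^3 * 1 \<le> x^15 / 3^12"
    proof -
      have "(3::real)^12 \<le> x^12" using x by (intro power_mono) auto
      then have "x^3 * 3^12 \<le> x^3 * x^12" using x by (intro mult_left_mono) auto
      then show ?thesis by (simp add: power_add[symmetric] le_divide_eq)
    qed
    moreover have "0 \<le> x^5 / (8 * \<beta>^2)" using x by simp
    moreover have "0 \<le> 1.08 * d * x^7 * (1 + d * x^4 + (d * x^4)^2)"
      using x d_bounds(1) by (intro mult_nonneg_nonneg add_nonneg_nonneg) auto
    ultimately have "P x \<le> 0" unfolding PQ Q_def by linarith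
    then show "gpoly c4 c5 c6 c7 c8 c9 c10 c11 c15 x \<le> 0" unfolding P_def .
  qed
  also have "\<dots> = \<beta>^3 * (e * integral {0..3 / \<beta>} (F \<mu>))" by simp
  finally have "V \<le> \<beta>^4 * (e * integral {0..3 / \<beta>} (F \<mu>))"
    using beta_pos by (simp add: field_simps eval_nat_numeral)
  moreover have "0.115 \<le> V"
  proof -
    have p: "0.886 \<le> sqrt pi / 2"
    proof -
      have "1.772 \<le> sqrt pi" using pi_approx by (intro real_le_rsqrt) (simp add: power2_eq_square)
      then show ?thesis by simp
    qed
    have "g * (15/8 * u0 + 105/16 * u1 * a^2 + 945/32 * u2 * a^4) \<le> 0.1361 * 0.28"
    proof (cases "0 \<le> 15/8 * u0 + 105/16 * u1 * a^2 + 945/32 * u2 * a^4")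
      case True
      then show ?thesis using u_le g_bounds by (intro mult_mono) auto
    next
      case False
      then have "g * (15/8 * u0 + 105/16 * u1 * a^2 + 945/32 * u2 * a^4) \<le> 0"
        using g_bounds by (intro mult_nonneg_nonpos) auto
      then show ?thesis by simp
    qed
    moreover have "3/4 * c4 + 15/8 * c6 + 105/16 * c8 + 945/32 * c10
        = 0.44 - g * (15/8 * u0 + 105/16 * u1 * a^2 + 945/32 * u2 * a^4)"
      unfolding cs by (simp add: a_def power_divide algebra_simps)
    ultimately have 1: "0.4018 \<le> 3/4 * c4 + 15/8 * c6 + 105/16 * c8 + 945/32 * c10" by simp
    have "0.886 * 0.4018 \<le> sqrt pi / 2 * (3/4 * c4 + 15/8 * c6 + 105/16 * c8 + 945/32 * c10)"
      using 1 p by (intro mult_mono) auto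
    then have 2: "0.3559 \<le> sqrt pi / 2 * (3/4 * c4 + 15/8 * c6 + 105/16 * c8 + 945/32 * c10)" by simp
    have "g^2 \<le> 0.1361^2" using g_bounds by (intro power_mono) auto
    then have g2: "g^2 \<le> 0.018524" by (simp add: power2_eq_square)
    have "d^2 \<le> 0.02127^2" using d_bounds by (intro power_mono) auto
    then have d2: "d^2 \<le> 0.000453" by (simp add: power2_eq_square)
    have "d^3 \<le> 0.02127^3" using d_bounds by (intro power_mono) auto
    then have d3: "d^3 \<le> 0.00000963" by (simp add: power3_eq_cube)
    have b2: "1 / (8 * \<beta>^2) \<le> 0.0001"
    proof -
      have "s^3 \<le> (1 / 72)^3" using s by (intro power_mono) auto
      then have "10^4 \<le> 0.81 / s^3" using s by (simp add: field_simps power3_eq_cube)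
      then have "10^4 \<le> \<beta>^2" using beta_sq(2) by linarith
      then show ?thesis using beta_pos by (simp add: field_simps)
    qed
    have c5: "- 0.0001 \<le> c5" using b2 by (simp add: c5_def)
    have "- 0.2406 \<le> c5 + 3 * c7 + 12 * c9 + 60 * c11 + 2520 * c15"
      unfolding c7_def c9_def c11_def c15_def using g2 d2 d3 c5 d_bounds(2) by simp
    then show ?thesis unfolding V_def gval_def using 2 by simp
  qed
  ultimately have "0.115 \<le> \<beta>^4 * (e * integral {0..3 / \<beta>} (F \<mu>))" by linarith
  then have main: "0.115 / \<beta>^4 \<le> e * integral {0..3 / \<beta>} (F \<mu>)"
    using beta_pos by (simp add: pos_divide_le_eq mult_ac)
  have "0 \<le> 3 / \<beta>" "s / 2 \<le> 2 * s / 3" "2 * s / 3 \<le> 5 * s / 4" "5 * s / 4 \<le> 8 * s" "8 * s \<le> pi"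
    using beta_pos s pi_gt3 by auto
  then have split: "integral {0..pi} (F \<mu>) = integral {0..3 / \<beta>} (F \<mu>) + integral {3 / \<beta>..s / 2} (F \<mu>)
      + integral {s / 2..2 * s / 3} (F \<mu>) + integral {2 * s / 3..5 * s / 4} (F \<mu>)
      + integral {5 * s / 4..8 * s} (F \<mu>) + integral {8 * s..pi} (F \<mu>)"
    using b Henstock_Kurzweil_Integration.integral_combine[OF _ _ F_integrable, of _ _ _ \<mu>] by simp
  have E: "- \<bar>x\<bar> \<le> e * x" for x using e by (auto simp: abs_if split: if_splits)
  \<comment> \<open>The layers add up to 0.081, below the 0.115 of the main range.\<close>
  have "0.115 / \<beta>^4 - 0.019 / \<beta>^4 - 0.012 / \<beta>^4 - 0.02 / \<beta>^4 - 0.012 / \<beta>^4 - 0.018 / \<beta>^4 \<le> e * integral {0..pi} (F \<mu>)"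
    unfolding split distrib_left
    using main lb(1-5)[of \<mu>] E[of "integral {3 / \<beta>..s / 2} (F \<mu>)"] E[of "integral {s / 2..2 * s / 3} (F \<mu>)"]
      E[of "integral {2 * s / 3..5 * s / 4} (F \<mu>)"] E[of "integral {5 * s / 4..8 * s} (F \<mu>)"] E[of "integral {8 * s..pi} (F \<mu>)"]
    by linarith
  moreover have "0 < 0.115 / \<beta>^4 - 0.019 / \<beta>^4 - 0.012 / \<beta>^4 - 0.02 / \<beta>^4 - 0.012 / \<beta>^4 - 0.018 / \<beta>^4"
    using beta_pos by (simp flip: diff_divide_distrib)
  ultimately show ?thesis unfolding \<mu>_def a_def by linarith
qed

definition tdiff :: "nat \<Rightarrow> real" where
  "tdiff n = real (q (n - 1)) * exp (- (real (n - 1) * s)) - 3 * real (q n) * exp (- (real n * s))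
        + 3 * real (q (n + 1)) * exp (- (real (n + 1) * s)) - real (q (n + 2)) * exp (- (real (n + 2) * s))"

text \<open>Normalising the factors of the generating function extracts a positive constant and the
  phase of the mean. Against n + 1/2 this phase leaves exactly the offset e * (4 / 5) *
  \<beta>.\<close>

lemma tdiff_sign:
  assumes n: "1 \<le> n" "n + 2 \<le> N" and e: "\<bar>e\<bar> = 1"
    and \<mu>: "Mean N s - e * (4 / 5) * \<beta> = real n + 1 / 2"
  shows "0 < e * tdiff n"
proof -
  define C where "C = (\<Prod>j=1..N. 1 + exp (- (real j * s)))"
  have C: "0 < C" unfolding C_def by (intro prod_pos) (auto intro: add_pos_pos)
  have G: "(\<Prod>j=1..N. 1 + of_real (exp (- (real j * s))) * cis (real j * t)) = of_real C * cis (Mean N s * t) * Phi N s t" for t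
  proof -
    have 1: "1 + of_real (exp (- x)) * cis a = of_real (1 + exp (- x)) * cis (fermi x * a) * cfun x a" for x a
    proof -
      have "1 + complex_of_real (exp (- x)) \<noteq> 0"
        by (metis add_pos_pos exp_gt_zero less_numeral_extra(1) less_numeral_extra(3) of_real_1 of_real_add of_real_eq_0_iff)
      moreover have "cis (fermi x * a) * cis (- (fermi x * a)) = 1" by (simp add: cis_mult)
      ultimately show ?thesis unfolding cfun_def by (simp add: mult.assoc mult.left_commute[of "cis (fermi x * a)"])
    qed
    have "cis (Mean N s * t) = (\<Prod>j=1..N. cis (fermi (real j * s) * (real j * t)))"
    proof -
      have "(\<Prod>j\<in>A. cis (f j)) = cis (\<Sum>j\<in>A. f j)" if "finite A" for f and A :: "nat set"
        using that by (induction A rule: finite_induct) (auto simp: cis_mult)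
      from this[of "{1..N}"] show ?thesis by (simp add: Mean_def sum_distrib_left mult_ac)
    qed
    then show ?thesis unfolding 1 C_def Phi_def prod.distrib of_real_prod by simp
  qed
  have hcosh: "cis (- ((real n + 1/2) * t)) * (of_real C * cis (Mean N s * t) * Phi N s t)
      = of_real C * (cis (e * (4 / 5) * \<beta> * t) * Phi N s t)" for t
  proof -
    have "e * (4 / 5) * \<beta> * t = - ((real n + 1/2) * t) + Mean N s * t" unfolding \<mu>[symmetric] by (simp add: algebra_simps)
    then have "cis (e * (4 / 5) * \<beta> * t) = cis (- ((real n + 1/2) * t)) * cis (Mean N s * t)" by (simp only: cis_mult)
    then show ?thesis by (simp add: mult_ac)
  qed
  have "pi * tdiff n = integral {0..pi} (\<lambda>t. C * F (e * (4 / 5) * \<beta>) t)"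
    unfolding tdiff_def tilted_difference_integral[OF n, symmetric] G hcosh F_def
    by (simp add: mult_ac)
  also have "\<dots> = C * integral {0..pi} (F (e * (4 / 5) * \<beta>))" by simp
  finally have "pi * (e * tdiff n) = C * (e * integral {0..pi} (F (e * (4 / 5) * \<beta>)))" by (simp add: mult_ac)
  moreover have "0 < C * (e * integral {0..pi} (F (e * (4 / 5) * \<beta>)))"
    by (intro mult_pos_pos C integral_sign e)
  ultimately have "0 < pi * (e * tdiff n)" by (simp only:)
  then show ?thesis by (simp add: zero_less_mult_iff)
qed

end

text \<open>An intermediate value argument between 1 / 72, where the shifted mean is too small, and
  1 / n, where it is of order n^2. The left end also ensures 40 * n * s \<ge> 40.\<close>

lemma exists_tilt:
  fixes e :: real
  assumes n: "5000 \<le> n" and e: "\<bar>e\<bar> = 1"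
  shows "\<exists>s. 1 / real n \<le> s \<and> s \<le> 1 / 72 \<and> Mean (40 * n) s - e * (4 / 5) * beta (40 * n) s = real n + 1 / 2"
proof -
  let ?N = "40 * n"
  define G where "G s = Mean ?N s - e * (4 / 5) * beta ?N s" for s
  have n0: "5000 \<le> real n" using n by simp
  have n72: "1 / real n \<le> 1 / 72" using n0 by (intro divide_left_mono) auto
  have t1: "tilt (1 / 72) ?N" and t2: "tilt (1 / real n) ?N"
    using n0 n72 by unfold_locales auto
  have be: "\<bar>e * (4 / 5) * beta ?N s\<bar> = 4 / 5 * beta ?N s" if "0 \<le> beta ?N s" for s
    using e that by (simp add: abs_mult)
  have "continuous_on UNIV fermi" unfolding fermi_def[abs_def]
    by (auto intro!: continuous_intros simp: add_pos_pos less_imp_neq[THEN not_sym])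
  then have cf: "continuous_on {1 / real n..1 / 72} (\<lambda>s. fermi (k * s))" for k
    by (rule continuous_on_compose2) (auto intro!: continuous_intros)
  have "continuous_on {1 / real n..1 / 72} G"
    unfolding G_def beta_def Mean_def Var_def fvar_fermi by (intro continuous_intros cf) auto
  moreover have "G (1 / 72) \<le> real n + 1 / 2"
  proof -
    \<comment> \<open>This ties 5000 to 1 / 72: 0.8625 * 72^2 + 4/5 * 613 is below 4962.\<close>
    have M: "Mean ?N (1 / 72) \<le> 0.8625 / (1 / 72)^2" by (intro Mean_le) auto
    have "beta ?N (1 / 72) ^ 2 \<le> 1.005 / (1 / 72)^3" by (rule tilt.beta_sq(3)[OF t1])
    also have "\<dots> \<le> 613^2" by (simp add: power2_eq_square power3_eq_cube)
    finally have "beta ?N (1 / 72) \<le> 613" by (rule power2_le_imp_le) simp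
    then show ?thesis unfolding G_def using M be[of "1 / 72"] tilt.beta_pos[OF t1] n0
      by (simp add: power2_eq_square abs_le_iff)
  qed
  moreover have "real n + 1 / 2 \<le> G (1 / real n)"
  proof -
    define b where "b = beta ?N (1 / real n)"
    have b0: "0 < b" unfolding b_def by (rule tilt.beta_pos[OF t2])
    have "fermi 1 = 1 / (1 + exp 1)" by (rule fermi_conv)
    also have "\<dots> \<ge> 1 / 3.72" using exp_1_bounds by (intro divide_left_mono) (auto intro: add_pos_pos)
    finally have f1: "1 / 4 \<le> fermi 1" by simp
    have "real n * (real n + 1) / 2 * (1 / 4) = (\<Sum>j=1..n. real j * (1 / 4))"
    proof -
      have "(\<Sum>j=1..n. real j) = real n * (real n + 1) / 2" by (induction n) (auto simp: field_simps)
      then show ?thesis by (simp flip: sum_distrib_right sum_divide_distrib)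
    qed
    also have "\<dots> \<le> (\<Sum>j=1..n. real j * fermi (real j * (1 / real n)))"
    proof (intro sum_mono mult_left_mono)
      fix j assume "j \<in> {1..n}"
      then have "fermi 1 \<le> fermi (real j * (1 / real n))" by (intro fermi_antimono) (auto simp: field_simps)
      then show "1 / 4 \<le> fermi (real j * (1 / real n))" using f1 by linarith
    qed auto
    also have "\<dots> \<le> Mean ?N (1 / real n)" unfolding Mean_def
      using fermi_bounds(1) by (intro sum_mono2) (auto simp: less_imp_le intro!: mult_nonneg_nonneg)
    finally have M: "real n * (real n + 1) / 8 \<le> Mean ?N (1 / real n)" by simp
    have "b^2 \<le> 1.005 / (1 / real n)^3" unfolding b_def by (rule tilt.beta_sq(3)[OF t2])
    also have "\<dots> = 1.005 * real n ^ 3" by (simp add: power_divide)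
    also have "\<dots> \<le> real n / 100 * real n ^ 3" using n0 by (intro mult_right_mono) auto
    also have "\<dots> = (real n ^ 2 / 10)^2" by (simp add: power_divide eval_nat_numeral)
    finally have "b \<le> real n ^ 2 / 10" by (rule power2_le_imp_le) simp
    moreover have "\<bar>e * (4 / 5) * b\<bar> = 4 / 5 * b" unfolding b_def using be b0 by (simp add: b_def)
    ultimately have "real n * (real n + 1) / 8 - 4 / 50 * real n ^ 2 \<le> G (1 / real n)"
      unfolding G_def using M by (simp add: b_def[symmetric] abs_le_iff)
    moreover have "5000 * real n \<le> real n ^ 2" using n0 by (simp add: power2_eq_square mult_right_mono)
    moreover have "real n * (real n + 1) / 8 = real n ^ 2 / 8 + real n / 8"
      by (simp add: power2_eq_square field_simps)
    ultimately show ?thesis using n0 by linarith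
  qed
  ultimately obtain s where "1 / real n \<le> s" "s \<le> 1 / 72" "G s = real n + 1 / 2"
    using IVT2'[of G "1 / 72" "real n + 1 / 2" "1 / real n"] n72 by blast
  then show ?thesis unfolding G_def by blast
qed

lemma Mean_antimono: "s \<le> s' \<Longrightarrow> Mean N s' \<le> Mean N s"
  unfolding Mean_def by (intro sum_mono mult_left_mono fermi_antimono) auto

lemma large_n_sign_changes:
  assumes n: "5000 \<le> n"
  shows "cubic_changes_sign (real (q (n - 1))) (real (q n)) (real (q (n + 1))) (real (q (n + 2)))"
proof -
  have P: "tilt.tdiff s n = exp (- (real (n - 1) * s)) * (real (q (n - 1)) + 3 * real (q n) * (- exp (- s))
      + 3 * real (q (n + 1)) * (- exp (- s))^2 + real (q (n + 2)) * (- exp (- s))^3)" if "tilt s N" for s N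
  proof -
    have m: "n = Suc (n - 1)" using n by simp
    have "exp (- (real n * s)) = exp (- (real (n - 1) * s)) * exp (- s)"
      "exp (- (real (n + 1) * s)) = exp (- (real (n - 1) * s)) * exp (- s) ^ 2"
      "exp (- (real (n + 2) * s)) = exp (- (real (n - 1) * s)) * exp (- s) ^ 3"
      unfolding exp_of_nat_mult[symmetric] mult_exp_exp using n by (simp_all add: of_nat_diff algebra_simps)
    then show ?thesis unfolding tilt.tdiff_def[OF that] by (simp add: algebra_simps)
  qed
  obtain s where s: "1 / real n \<le> s" "s \<le> 1 / 72"
    and ms: "Mean (40 * n) s - 1 * (4 / 5) * beta (40 * n) s = real n + 1 / 2"
    using exists_tilt[OF n, of 1] by auto
  obtain s' where s': "1 / real n \<le> s'" "s' \<le> 1 / 72"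
    and ms': "Mean (40 * n) s' - (- 1) * (4 / 5) * beta (40 * n) s' = real n + 1 / 2"
    using exists_tilt[OF n, of "- 1"] by auto
  have pos: "0 < 1 / real n" using n by simp
  have t: "tilt s (40 * n)" "tilt s' (40 * n)"
    using s s' pos n by (unfold_locales; simp add: field_simps; linarith)+
  have N: "1 \<le> n" "n + 2 \<le> 40 * n" using n by auto
  have 1: "0 < 1 * tilt.tdiff s n" by (rule tilt.tdiff_sign[OF t(1) N _ ms]) simp
  have 2: "0 < (- 1) * tilt.tdiff s' n" by (rule tilt.tdiff_sign[OF t(2) N _ ms']) simp
  \<comment> \<open>The mean at \<open>s\<close> lies above n + 1/2 and the mean at
    \<open>s'\<close> below it, and the mean decreases with the tilt.\<close>
  have "s < s'"
  proof (rule ccontr)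
    assume "\<not> s < s'"
    then have "Mean (40 * n) s \<le> Mean (40 * n) s'" by (intro Mean_antimono) auto
    then show False using ms ms' tilt.beta_pos[OF t(1)] tilt.beta_pos[OF t(2)] by linarith
  qed
  then have "- exp (- s) < - exp (- s')" "- exp (- s') < 0" by auto
  then show ?thesis
    using 1 2 unfolding P[OF t(1)] P[OF t(2)] cubic_changes_sign_def
    by (intro exI[of _ "- exp (- s)"] exI[of _ "- exp (- s')"]) (simp add: zero_less_mult_iff mult_less_0_iff)
qed

section \<open>The theorem\<close>

lemma q_pos: "0 < n \<Longrightarrow> 0 < q n"
proof -
  assume "0 < n"
  then have "{n} \<in> distinct_partitions n" by (simp add: distinct_partitions_def)
  then show ?thesis using finite_distinct_partitions[of n] by (auto simp: q_def card_gt_0_iff)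
qed

lemma sign_changes_real:
  assumes "sign_changes a b c d"
  shows "cubic_changes_sign (real_of_int a) (real_of_int b) (real_of_int c) (real_of_int d)"
proof -
  obtain m m' :: int where m: "0 < m" "m < m'" "tilted m' a b c d < 0" "0 < tilted m a b c d"
    using assms unfolding sign_changes_def by blast
  define X where "X k = - (real_of_int k / (real_of_int k + 1))" for k :: int
  define P where "P x = real_of_int a + 3 * real_of_int b * x + 3 * real_of_int c * x^2 + real_of_int d * x^3" for x
  have T: "real_of_int (tilted k a b c d) = - ((real_of_int k + 1)^3 * P (X k))" if "0 < k" for k
  proof -
    define u where "u = real_of_int k + 1"
    have u: "u > 0" using that by (simp add: u_def)
    have "u * X k = - real_of_int k" using u by (simp add: X_def u_def[symmetric])
    moreover have "u^3 * P (X k) = u^3 * real_of_int a + 3 * u^2 * real_of_int b * (u * X k)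
        + 3 * u * real_of_int c * (u * X k)^2 + real_of_int d * (u * X k)^3"
      by (simp add: P_def power2_eq_square power3_eq_cube algebra_simps)
    moreover have "real_of_int (tilted k a b c d) = real_of_int k ^ 3 * real_of_int d
        - 3 * real_of_int k ^ 2 * u * real_of_int c + 3 * real_of_int k * u^2 * real_of_int b - u^3 * real_of_int a"
      by (simp add: tilted_def u_def)
    ultimately show ?thesis unfolding u_def[symmetric] by (simp add: algebra_simps)
  qed
  have pos: "0 < (real_of_int k + 1)^3" if "0 < k" for k using that by simp
  have "0 < (real_of_int m' + 1)^3 * P (X m')" "(real_of_int m + 1)^3 * P (X m) < 0"
    using T[of m] T[of m'] m by linarith+
  then have "P (X m') > 0" "P (X m) < 0"
    using pos[of m] pos[of m'] m by (auto simp: zero_less_mult_iff mult_less_0_iff)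
  moreover have "X m' < X m" "X m < 0" using m(1,2) by (auto simp: X_def field_simps)
  ultimately show ?thesis unfolding P_def cubic_changes_sign_def by blast
qed

theorem theorem1p5:
  fixes n :: nat and z :: complex
  assumes "n \<ge> 121"
    and "poly [:of_nat (q (n - 1)), 3 * of_nat (q n), 3 * of_nat (q (n + 1)), of_nat (q (n + 2)):] z = 0"
  shows "z \<in> \<real>"
proof (rule cubic_three_real_roots)
  show "real (q (n + 2)) > 0" "real (q (n - 1)) > 0" using q_pos assms(1) by auto
  show "cubic_changes_sign (real (q (n - 1))) (real (q n)) (real (q (n + 1))) (real (q (n + 2)))"
  proof (cases "n < 5000")
    case True
    then show ?thesis using sign_changes_real[OF small_n_sign_changes[OF assms(1)]] by simp
  next
    case False
    then show ?thesis by (intro large_n_sign_changes) simp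
  qed
  show "poly [:of_real (real (q (n - 1))), 3 * of_real (real (q n)), 3 * of_real (real (q (n + 1))), of_real (real (q (n + 2))):] z = 0"
    using assms(2) by simp
qed

end
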